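(* Let $L$ be a finite dimensional Lie algebra over an algebraically closed field $F$ of characteristic $0$, graded by an arbitrary group $G$, and let $R$ be the solvable radical of $L$. Then there exists a maximal semisimple subalgebra $B$ of $L$ such that $L=B\oplus R$ is a direct sum of graded subspaces.
   Context: A Lie algebra $L$ is graded by a group $G$ if there is a fixed direct sum decomposition into subspaces $L=\bigoplus_{g\in G}L^{(g)}$ such that $[L^{(g)},L^{(h)}]\subseteq L^{(gh)}$ for all $g,h\in G$. A subspace $W\subseteq L$ is graded if $W=\bigoplus_{g\in G}(L^{(g)}\cap W)$. The solvable radical is the largest solvable ideal of $L$. The group $G$ may be infinite and non-Abelian. *)

theory Defs
  imports
    "HOL-Algebra.Group"
    "HOL-Computational_Algebra.Polynomial"
begin

context vector_space
begin

text \<open>The index set may be infinite: an element is decomposed into finitely many nonzero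
  components, and the components outside the index set are set to zero so that the family
  of components is unique as a total function.\<close>

definition direct_sum_family :: "'i set \<Rightarrow> ('i \<Rightarrow> 'b set) \<Rightarrow> 'b set \<Rightarrow> bool" where
  "direct_sum_family I U W \<longleftrightarrow>
     subspace W \<and> (\<forall>i\<in>I. subspace (U i) \<and> U i \<subseteq> W) \<and>
     (\<forall>x\<in>W. \<exists>!f. (\<forall>i\<in>I. f i \<in> U i) \<and> (\<forall>i. i \<notin> I \<longrightarrow> f i = 0) \<and>
        finite {i. f i \<noteq> 0} \<and> x = (\<Sum>i | f i \<noteq> 0. f i))"

definition direct_sum :: "'b set \<Rightarrow> 'b set \<Rightarrow> 'b set \<Rightarrow> bool" where
  "direct_sum W U V \<longleftrightarrow>
     subspace U \<and> subspace V \<and> W = {u + v | u v. u \<in> U \<and> v \<in> V} \<and> U \<inter> V = {0}"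

end

locale lie_algebra = vector_space scale
  for scale :: "'f::field \<Rightarrow> 'v::ab_group_add \<Rightarrow> 'v" +
  fixes bracket :: "'v \<Rightarrow> 'v \<Rightarrow> 'v"
  assumes linear_left: "Vector_Spaces.linear scale scale (\<lambda>x. bracket x y)"
    and linear_right: "Vector_Spaces.linear scale scale (\<lambda>y. bracket x y)"
    and alternating: "bracket x x = 0"
    and jacobi: "bracket x (bracket y z) + bracket y (bracket z x) + bracket z (bracket x y) = 0"
begin

definition subalgebra :: "'v set \<Rightarrow> bool" where
  "subalgebra S \<longleftrightarrow> subspace S \<and> (\<forall>x\<in>S. \<forall>y\<in>S. bracket x y \<in> S)"

text \<open>Ideals, radicals and semisimplicity are relative to a subalgebra \<open>S\<close>;
  the whole Lie algebra is \<open>UNIV\<close>.\<close>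

definition ideal :: "'v set \<Rightarrow> 'v set \<Rightarrow> bool" where
  "ideal S J \<longleftrightarrow> subspace J \<and> J \<subseteq> S \<and> (\<forall>x\<in>S. \<forall>y\<in>J. bracket x y \<in> J)"

primrec derived_series :: "'v set \<Rightarrow> nat \<Rightarrow> 'v set" where
  "derived_series S 0 = S"
| "derived_series S (Suc n) =
     span {bracket x y | x y. x \<in> derived_series S n \<and> y \<in> derived_series S n}"

definition solvable :: "'v set \<Rightarrow> bool" where
  "solvable S \<longleftrightarrow> (\<exists>n. derived_series S n = {0})"

text \<open>The order on sets is inclusion, so this is the largest solvable ideal of \<open>S\<close>.\<close>

definition solvable_radical :: "'v set \<Rightarrow> 'v set" where
  "solvable_radical S = (GREATEST J. ideal S J \<and> solvable J)"

definition semisimple_subalgebra :: "'v set \<Rightarrow> bool" where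
  "semisimple_subalgebra S \<longleftrightarrow> subalgebra S \<and> solvable_radical S = {0}"

definition maximal_semisimple_subalgebra :: "'v set \<Rightarrow> bool" where
  "maximal_semisimple_subalgebra B \<longleftrightarrow>
     semisimple_subalgebra B \<and> (\<forall>C. semisimple_subalgebra C \<and> B \<subseteq> C \<longrightarrow> C = B)"

end

locale graded_lie_algebra = lie_algebra scale bracket + group G
  for scale :: "'f::field \<Rightarrow> 'v::ab_group_add \<Rightarrow> 'v"
    and bracket :: "'v \<Rightarrow> 'v \<Rightarrow> 'v"
    and G :: "('g, 'm) monoid_scheme" (structure) +
  fixes component :: "'g \<Rightarrow> 'v set"
  assumes decomposition: "direct_sum_family (carrier G) component UNIV"
    and bracket_component:
      "\<lbrakk>g \<in> carrier G; h \<in> carrier G; x \<in> component g; y \<in> component h\<rbrakk>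
        \<Longrightarrow> bracket x y \<in> component (g \<otimes> h)"
begin

definition graded_subspace :: "'v set \<Rightarrow> bool" where
  "graded_subspace W \<longleftrightarrow> direct_sum_family (carrier G) (\<lambda>g. component g \<inter> W) W"

end

end

theory Submission
  imports Defs
begin

text \<open>The radical: let \<open>I\<close> be a maximal graded solvable ideal. The
  Killing form of \<open>L/I\<close> pairs the component of degree \<open>g\<close> only with that of degree \<open>g\<inverse>\<close>, so its
  radical is a graded ideal, which is solvable by Cartan's criterion and hence zero. Thus \<open>L/I\<close> has
  no abelian ideals, and \<open>I\<close> contains every solvable ideal. The complement: by descent along the
  derived series of \<open>I\<close>, a graded complement of \<open>I\<close> that is closed under the bracket modulo one term
  is corrected to one that is closed modulo the next. The obstruction is a 2-cocycle of the semisimple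
  algebra \<open>L/I\<close> with values in a finite dimensional module, so it is a coboundary by Whitehead's
  second lemma; and the degree-preserving part of a solution is again a solution, also for
  nonabelian \<open>G\<close>.\<close>

text \<open>The obstacle is that the solvable radical is not visibly stable under the projections to
  the components: for abelian \<open>G\<close> one can let characters act by automorphisms, but a
  general \<open>G\<close> provides no such action. Hence the radical is approached from below,
  through graded ideals only. The descent follows the derived series because its successive
  quotients are abelian. This makes each of them a module over \<open>L/I\<close> even while the
  complement is not yet a subalgebra, and it removes the quadratic error of a correction. The
  equation to be solved is then affine in the correction and can be projected to degree-preserving
  parts. Algebraic closedness enters through generalised eigenspaces. Characteristic 0 enters in
  Cartan's criterion, where eigenvalues are tested by functionals to the rationals, and in
  Whitehead's lemma, where the trace of a Casimir operator is a positive integer.\<close>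

sublocale finite_dimensional_vector_space \<subseteq> endo: finite_dimensional_vector_space_pair scale Basis scale Basis
  by unfold_locales

section \<open>Linear endomorphisms of a finite dimensional space\<close>

context finite_dimensional_vector_space
begin

abbreviation lin :: "('b \<Rightarrow> 'b) \<Rightarrow> bool" where
  "lin \<equiv> Vector_Spaces.linear scale scale"

lemma linI:
  assumes "\<And>x y. f (x + y) = f x + f y" "\<And>c x. f (c *s x) = c *s f x"
  shows "lin f"
  using assms by (simp add: Vector_Spaces.linear_iff vector_space_axioms)

lemma lin_add: "lin f \<Longrightarrow> f (x + y) = f x + f y"
  and lin_scale: "lin f \<Longrightarrow> f (c *s x) = c *s f x"
  by (simp_all add: Vector_Spaces.linear_iff)

lemma lin_0: "lin f \<Longrightarrow> f 0 = 0"
  by (rule endo.linear_0)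

lemma lin_diff: "lin f \<Longrightarrow> f (x - y) = f x - f y"
  by (rule endo.linear_diff)

lemma lin_neg: "lin f \<Longrightarrow> f (- x) = - f x"
  by (rule endo.linear_neg)

lemma lin_sum: "lin f \<Longrightarrow> f (\<Sum>i\<in>I. g i) = (\<Sum>i\<in>I. f (g i))"
  by (rule endo.linear_sum)

lemma lin_compose: "lin f \<Longrightarrow> lin g \<Longrightarrow> lin (\<lambda>x. f (g x))"
  by (simp add: Vector_Spaces.linear_iff)

lemma lin_id: "lin (\<lambda>x. x)"
  by (simp add: Vector_Spaces.linear_iff vector_space_axioms)

lemma lin_zero: "lin (\<lambda>x. 0)"
  by (simp add: Vector_Spaces.linear_iff vector_space_axioms)

lemma lin_plus: "lin f \<Longrightarrow> lin g \<Longrightarrow> lin (\<lambda>x. f x + g x)"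
  by (simp add: Vector_Spaces.linear_iff algebra_simps)

lemma lin_minus: "lin f \<Longrightarrow> lin g \<Longrightarrow> lin (\<lambda>x. f x - g x)"
  by (simp add: Vector_Spaces.linear_iff algebra_simps)

lemma lin_uminus: "lin f \<Longrightarrow> lin (\<lambda>x. - f x)"
  by (simp add: Vector_Spaces.linear_iff algebra_simps)

lemma lin_smult: "lin f \<Longrightarrow> lin (\<lambda>x. c *s f x)"
  by (simp add: Vector_Spaces.linear_iff algebra_simps)

lemma lin_sum_fun: "(\<And>i. i \<in> I \<Longrightarrow> lin (f i)) \<Longrightarrow> lin (\<lambda>x. \<Sum>i\<in>I. f i x)"
proof (induction I rule: infinite_finite_induct)
  case (insert i I) then show ?case by (simp add: lin_plus)
qed (simp_all add: lin_zero)

lemma lin_funpow: "lin f \<Longrightarrow> lin (f ^^ n)"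
  by (induction n) (auto simp: Vector_Spaces.linear_iff vector_space_axioms)

lemma funpow_closed: "(\<And>x. x \<in> W \<Longrightarrow> f x \<in> W) \<Longrightarrow> x \<in> W \<Longrightarrow> (f ^^ n) x \<in> W"
  by (induction n) auto

lemma subspace_lin_image: "lin f \<Longrightarrow> subspace W \<Longrightarrow> subspace (f ` W)"
  by (rule endo.linear_subspace_image)

text \<open>With \<open>U = {0}\<close> and \<open>f\<close> a difference of two maps, this also
  extends identities between linear maps from a spanning set.\<close>

lemma lin_span_closed:
  assumes "lin f" "\<And>x. x \<in> B \<Longrightarrow> f x \<in> U" "subspace U" "x \<in> span B"
  shows "f x \<in> U"
proof -
  have "subspace {x. f x \<in> U}"
    using assms by (auto simp: subspace_def lin_0 lin_add lin_scale)
  then have "span B \<subseteq> {x. f x \<in> U}"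
    using assms(2) by (intro span_minimal) auto
  with assms(4) show ?thesis by blast
qed

lemma subspace_basis: "subspace W \<Longrightarrow> \<exists>B. B \<subseteq> W \<and> independent B \<and> span B = W"
  by (metis basis_subspace_exists)

lemma sub_basis:
  assumes "span X = W"
  shows "\<exists>B. B \<subseteq> X \<and> independent B \<and> span B = W"
proof -
  obtain B where B: "B \<subseteq> X" "independent B" "X \<subseteq> span B"
    using maximal_independent_subset[of X] by blast
  then have "span B = span X"
    by (simp add: span_eq) (meson span_base subsetD subsetI)
  with B assms show ?thesis by blast
qed

lemma basis_expand:
  assumes "independent B" "v \<in> span B"
  shows "(\<Sum>b\<in>B. representation B v b *s b) = v"
  using assms by (simp add: sum_representation_eq finiteI_independent)

lemma representation_lin_sum:
  assumes "independent B" "\<And>i. i \<in> I \<Longrightarrow> v i \<in> span B"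
  shows "representation B (\<Sum>i\<in>I. c i *s v i) b = (\<Sum>i\<in>I. c i * representation B (v i) b)"
  using assms by (simp add: representation_sum representation_scale span_scale)

subsection \<open>The trace on an invariant subspace\<close>

text \<open>Only the restriction of \<open>f\<close> to \<open>W\<close> is measured, so
  \<open>f\<close> can be a map of the ambient space. The value is meaningful for linear
  \<open>f\<close> preserving \<open>W\<close>; then the chosen basis does not matter.\<close>

definition trace :: "'b set \<Rightarrow> ('b \<Rightarrow> 'b) \<Rightarrow> 'a" where
  "trace W f = (let B = SOME B. independent B \<and> span B = W
     in \<Sum>b\<in>B. representation B (f b) b)"

text \<open>Expand every \<open>b\<close> in the basis \<open>C\<close>, and every
  \<open>f c\<close> back in \<open>B\<close>. The same double sum, summed in one order or the
  other, is one trace or the other.\<close>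

lemma trace_basis_indep:
  assumes B: "independent B" "span B = W" and C: "independent C" "span C = W"
    and f: "lin f" "\<And>w. w \<in> W \<Longrightarrow> f w \<in> W"
  shows "(\<Sum>b\<in>B. representation B (f b) b) = (\<Sum>c\<in>C. representation C (f c) c)"
proof -
  have BW: "b \<in> W" if "b \<in> B" for b using that B span_base by blast
  have CW: "c \<in> W" if "c \<in> C" for c using that C span_base by blast
  have "representation B (f b) b = (\<Sum>c\<in>C. representation C b c * representation B (f c) b)" if "b \<in> B" for b
  proof -
    have "f b = f (\<Sum>c\<in>C. representation C b c *s c)"
      using basis_expand[OF C(1), of b] that BW C(2) by simp
    also have "\<dots> = (\<Sum>c\<in>C. representation C b c *s f c)"
      by (simp add: lin_sum f lin_scale)
    finally show ?thesis
      using representation_lin_sum[OF B(1), of C f "representation C b" b] CW f B by simp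
  qed
  then have "(\<Sum>b\<in>B. representation B (f b) b)
      = (\<Sum>b\<in>B. \<Sum>c\<in>C. representation C b c * representation B (f c) b)" by simp
  also have "\<dots> = (\<Sum>c\<in>C. \<Sum>b\<in>B. representation B (f c) b * representation C b c)"
    by (subst sum.swap) (simp add: mult.commute)
  also have "\<dots> = (\<Sum>c\<in>C. representation C (f c) c)"
  proof (rule sum.cong[OF refl])
    fix c assume c: "c \<in> C"
    have "(\<Sum>b\<in>B. representation B (f c) b * representation C b c)
       = representation C (\<Sum>b\<in>B. representation B (f c) b *s b) c"
      using representation_lin_sum[OF C(1), of B "\<lambda>b. b"] BW C(2) by simp
    also have "(\<Sum>b\<in>B. representation B (f c) b *s b) = f c"
      using basis_expand[OF B(1), of "f c"] c CW f B(2) by simp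
    finally show "(\<Sum>b\<in>B. representation B (f c) b * representation C b c) = representation C (f c) c" .
  qed
  finally show ?thesis .
qed

lemma trace_basis:
  assumes "independent B" "span B = W" "lin f" "\<And>w. w \<in> W \<Longrightarrow> f w \<in> W"
  shows "trace W f = (\<Sum>b\<in>B. representation B (f b) b)"
proof -
  define C where "C = (SOME B. independent B \<and> span B = W)"
  have "independent C \<and> span C = W"
    unfolding C_def using assms(1,2) by (rule_tac someI[where x=B]) simp
  then show ?thesis
    unfolding trace_def Let_def C_def[symmetric] using trace_basis_indep assms by blast
qed

lemma trace_cong:
  assumes "subspace W" "\<And>w. w \<in> W \<Longrightarrow> f w = g w"
  shows "trace W f = trace W g"
proof -
  define C where "C = (SOME B. independent B \<and> span B = W)"
  have "independent C \<and> span C = W"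
    unfolding C_def using subspace_basis[OF assms(1)] by (rule_tac someI_ex) blast
  then have "\<forall>c\<in>C. f c = g c" using span_base assms by blast
  then show ?thesis
    unfolding trace_def Let_def C_def[symmetric] by simp
qed

lemma trace_add:
  assumes "subspace W" "lin f" "\<And>w. w \<in> W \<Longrightarrow> f w \<in> W" "lin g" "\<And>w. w \<in> W \<Longrightarrow> g w \<in> W"
  shows "trace W (\<lambda>x. f x + g x) = trace W f + trace W g"
proof -
  obtain B where B: "B \<subseteq> W" "independent B" "span B = W" using subspace_basis[OF assms(1)] by blast
  have "trace W (\<lambda>x. f x + g x) = (\<Sum>b\<in>B. representation B (f b + g b) b)"
    using B assms by (intro trace_basis lin_plus) (auto intro: subspace_add)
  also have "\<dots> = (\<Sum>b\<in>B. representation B (f b) b + representation B (g b) b)"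
    using B assms by (intro sum.cong) (auto simp: representation_add)
  finally show ?thesis
    using B assms trace_basis[of B W f] trace_basis[of B W g] by (simp add: sum.distrib)
qed

lemma trace_smult:
  assumes "subspace W" "lin f" "\<And>w. w \<in> W \<Longrightarrow> f w \<in> W"
  shows "trace W (\<lambda>x. c *s f x) = c * trace W f"
proof -
  obtain B where B: "B \<subseteq> W" "independent B" "span B = W" using subspace_basis[OF assms(1)] by blast
  have "trace W (\<lambda>x. c *s f x) = (\<Sum>b\<in>B. representation B (c *s f b) b)"
    using B assms by (intro trace_basis lin_smult) (auto intro: subspace_scale)
  also have "\<dots> = (\<Sum>b\<in>B. c * representation B (f b) b)"
    using B assms by (intro sum.cong) (auto simp: representation_scale)
  finally show ?thesis
    using B assms trace_basis[of B W f] by (simp add: sum_distrib_left)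
qed

lemma trace_zero: "trace W (\<lambda>x. 0) = 0"
  by (simp add: trace_def representation_zero)

lemma trace_diff:
  assumes "subspace W" "lin f" "\<And>w. w \<in> W \<Longrightarrow> f w \<in> W" "lin g" "\<And>w. w \<in> W \<Longrightarrow> g w \<in> W"
  shows "trace W (\<lambda>x. f x - g x) = trace W f - trace W g"
proof -
  have "trace W (\<lambda>x. f x + (-1) *s g x) = trace W f + trace W (\<lambda>x. (-1) *s g x)"
    using assms by (intro trace_add lin_smult) (auto intro: subspace_scale subspace_neg)
  moreover have "trace W (\<lambda>x. (-1) *s g x) = - trace W g"
    using trace_smult[OF assms(1,4,5), of "-1"] by simp
  ultimately show ?thesis by simp
qed

lemma trace_sum:
  assumes "subspace W" "\<And>i. i \<in> I \<Longrightarrow> lin (f i)" "\<And>i w. i \<in> I \<Longrightarrow> w \<in> W \<Longrightarrow> f i w \<in> W"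
  shows "trace W (\<lambda>x. \<Sum>i\<in>I. f i x) = (\<Sum>i\<in>I. trace W (f i))"
  using assms(2,3)
proof (induction I rule: infinite_finite_induct)
  case (insert i I)
  then have "trace W (\<lambda>x. f i x + (\<Sum>i\<in>I. f i x)) = trace W (f i) + trace W (\<lambda>x. \<Sum>i\<in>I. f i x)"
    using assms(1) by (intro trace_add lin_sum_fun) (auto intro: subspace_sum)
  with insert show ?case by simp
qed (simp_all add: trace_zero)

lemma trace_commute:
  assumes "subspace W" "lin f" "\<And>w. w \<in> W \<Longrightarrow> f w \<in> W" "lin g" "\<And>w. w \<in> W \<Longrightarrow> g w \<in> W"
  shows "trace W (\<lambda>x. f (g x)) = trace W (\<lambda>x. g (f x))"
proof -
  obtain B where B: "B \<subseteq> W" "independent B" "span B = W" using subspace_basis[OF assms(1)] by blast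
  have *: "trace W (\<lambda>x. f (g x)) = (\<Sum>b\<in>B. \<Sum>c\<in>B. representation B (g b) c * representation B (f c) b)"
    if "lin f" "\<And>w. w \<in> W \<Longrightarrow> f w \<in> W" "lin g" "\<And>w. w \<in> W \<Longrightarrow> g w \<in> W" for f g
  proof -
    have "trace W (\<lambda>x. f (g x)) = (\<Sum>b\<in>B. representation B (f (g b)) b)"
      using B that by (intro trace_basis lin_compose[OF that(1,3)]) auto
    also have "\<dots> = (\<Sum>b\<in>B. \<Sum>c\<in>B. representation B (g b) c * representation B (f c) b)"
    proof (rule sum.cong[OF refl])
      fix b assume b: "b \<in> B"
      have "f (g b) = f (\<Sum>c\<in>B. representation B (g b) c *s c)"
        using basis_expand[of B "g b"] b B that by auto
      also have "\<dots> = (\<Sum>c\<in>B. representation B (g b) c *s f c)"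
        by (simp add: lin_sum that lin_scale)
      finally show "representation B (f (g b)) b = (\<Sum>c\<in>B. representation B (g b) c * representation B (f c) b)"
        using representation_lin_sum[OF B(2), of B f "representation B (g b)" b] B that by auto
    qed
    finally show ?thesis .
  qed
  show ?thesis
    using *[OF assms(2) _ assms(4)] *[OF assms(4) _ assms(2)] assms(3,5)
      sum.swap[of "\<lambda>b c. representation B (g b) c * representation B (f c) b" B B]
    by (simp add: mult.commute)
qed

text \<open>Extend a basis of \<open>U\<close> to one of \<open>W\<close>: the added vectors are
  mapped into \<open>U\<close> and contribute no diagonal entry.\<close>

lemma trace_image_subset:
  assumes "subspace W" "subspace U" "U \<subseteq> W" "lin f" "\<And>w. w \<in> W \<Longrightarrow> f w \<in> U"
  shows "trace W f = trace U f"
proof -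
  obtain B where B: "B \<subseteq> U" "independent B" "span B = U" using subspace_basis[OF assms(2)] by blast
  obtain C where C: "B \<subseteq> C" "C \<subseteq> W" "independent C" "W \<subseteq> span C"
    using maximal_independent_subset_extend[of B W] B assms(3) by auto
  have CW: "span C = W" using C assms(1) by (simp add: span_subspace)
  have fin: "finite C" using C finiteI_independent by blast
  have rep: "representation C (f b) = representation B (f b)" if "b \<in> W" for b
    using B C assms(5) that by (intro representation_extend) auto
  have "trace W f = (\<Sum>c\<in>C. representation C (f c) c)"
    using C CW assms by (intro trace_basis) auto
  also have "\<dots> = (\<Sum>c\<in>B. representation C (f c) c)"
  proof (rule sum.mono_neutral_right)
    have "representation C (f c) c = 0" if "c \<in> C - B" for c
      using rep[of c] representation_ne_zero[of B "f c" c] that C(2) by (metis DiffE subsetD)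
    then show "\<forall>c\<in>C - B. representation C (f c) c = 0" by blast
  qed (use fin C in auto)
  also have "\<dots> = (\<Sum>c\<in>B. representation B (f c) c)"
    using rep B assms(3) by (intro sum.cong) auto
  also have "\<dots> = trace U f"
    using B assms by (intro trace_basis[symmetric]) auto
  finally show ?thesis .
qed

lemma uniform_nilpotency:
  assumes "subspace W" "lin f" "\<And>w. w \<in> W \<Longrightarrow> \<exists>n. (f ^^ n) w = 0"
  shows "\<exists>n. \<forall>w\<in>W. (f ^^ n) w = 0"
proof -
  obtain B where B: "B \<subseteq> W" "independent B" "span B = W" using subspace_basis[OF assms(1)] by blast
  have fin: "finite B" using B finiteI_independent by blast
  obtain k where k: "\<And>b. b \<in> B \<Longrightarrow> (f ^^ k b) b = 0"
  proof -
    have "\<forall>b\<in>B. \<exists>n. (f ^^ n) b = 0" using B(1) assms(3) by blast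
    then show ?thesis using that by (auto dest!: bchoice)
  qed
  \<comment> \<open>The sum of the exponents of the finitely many basis vectors dominates each of
    them.\<close>
  define n where "n = (\<Sum>b\<in>B. k b)"
  have "(f ^^ n) b \<in> {0}" if "b \<in> B" for b
  proof -
    have "k b \<le> n" unfolding n_def using fin that by (simp add: member_le_sum)
    then obtain j where "n = j + k b" by (metis le_add_diff_inverse2)
    then have "(f ^^ n) b = (f ^^ j) ((f ^^ k b) b)" by (simp add: funpow_add)
    then show ?thesis using k[OF that] lin_0[OF lin_funpow[OF assms(2)]] by simp
  qed
  then have "(f ^^ n) w \<in> {0}" if "w \<in> W" for w
    using that B(3) lin_span_closed[OF lin_funpow[OF assms(2)] _ subspace_single_0, of B n w] by blast
  then show ?thesis by blast
qed

text \<open>Restricting \<open>f\<close> to its own image keeps the trace, by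
  \<open>trace_image_subset\<close>. Iterating this until the image of a power is zero takes the
  place of a triangular basis.\<close>

lemma trace_nilpotent:
  assumes "subspace W" "lin f" "\<And>w. w \<in> W \<Longrightarrow> f w \<in> W" "\<And>w. w \<in> W \<Longrightarrow> \<exists>n. (f ^^ n) w = 0"
  shows "trace W f = 0"
proof -
  obtain n where n: "\<forall>w\<in>W. (f ^^ n) w = 0"
    using uniform_nilpotency[OF assms(1,2,4)] by blast
  have step: "(f ^^ Suc k) ` W \<subseteq> (f ^^ k) ` W" for k
  proof -
    have "(f ^^ Suc k) w = (f ^^ k) (f w)" for w by (simp add: funpow_swap1)
    then show ?thesis using assms(3) by (simp add: image_subset_iff)
  qed
  have "trace W f = trace ((f ^^ k) ` W) f" for k
  proof (induction k)
    case (Suc k)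
    have "trace ((f ^^ k) ` W) f = trace ((f ^^ Suc k) ` W) f"
    proof (rule trace_image_subset[OF _ _ step assms(2)])
      show "subspace ((f ^^ k) ` W)"
        by (rule subspace_lin_image[OF lin_funpow[OF assms(2)] assms(1)])
      show "subspace ((f ^^ Suc k) ` W)"
        by (rule subspace_lin_image[OF lin_funpow[OF assms(2)] assms(1)])
      fix w assume "w \<in> (f ^^ k) ` W"
      then obtain u where "u \<in> W" "f w = (f ^^ Suc k) u" by auto
      then show "f w \<in> (f ^^ Suc k) ` W" by (simp only: image_eqI)
    qed
    with Suc show ?case by (rule trans)
  qed simp
  from this[of n] have "trace W f = trace ((f ^^ n) ` W) f" .
  also have "(f ^^ n) ` W = {0}"
    using n subspace_0[OF assms(1)] by (auto simp: image_iff)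
  also have "trace {0} f = 0"
    using trace_basis[of "{}" "{0}" f] assms(2) lin_0 by (simp add: independent_empty)
  finally show ?thesis .
qed

end

context finite_dimensional_vector_space
begin

subsection \<open>Generalised eigenspaces\<close>

definition shift :: "('b \<Rightarrow> 'b) \<Rightarrow> 'a \<Rightarrow> 'b \<Rightarrow> 'b" where
  "shift T a v = T v - a *s v"

definition gen_eigenspace :: "('b \<Rightarrow> 'b) \<Rightarrow> 'a \<Rightarrow> 'b set" where
  "gen_eigenspace T a = {v. \<exists>n. (shift T a ^^ n) v = 0}"

lemma lin_shift: "lin T \<Longrightarrow> lin (shift T a)"
  unfolding shift_def[abs_def] by (intro lin_minus lin_smult lin_id)

lemma shift_closed: "subspace W \<Longrightarrow> T v \<in> W \<Longrightarrow> v \<in> W \<Longrightarrow> shift T a v \<in> W"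
  by (simp add: shift_def subspace_diff subspace_scale)

lemma shift_commute: "lin T \<Longrightarrow> shift T a (shift T b v) = shift T b (shift T a v)"
  by (simp add: shift_def lin_diff lin_scale algebra_simps)

lemma shift_funpow_commute:
  assumes "lin T"
  shows "shift T a ((shift T b ^^ n) v) = (shift T b ^^ n) (shift T a v)"
  by (induction n) (simp_all add: shift_commute[OF assms, of a b])

lemma shift_funpow_mono:
  assumes "lin T" "(shift T a ^^ n) v = 0" "n \<le> m"
  shows "(shift T a ^^ m) v = 0"
proof -
  obtain k where "m = k + n" using assms(3) by (metis le_add_diff_inverse2)
  then show ?thesis using assms(2) lin_0[OF lin_funpow[OF lin_shift[OF assms(1)]]] by (simp add: funpow_add)
qed

lemma subspace_gen_eigenspace:
  assumes "lin T"
  shows "subspace (gen_eigenspace T a)"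
proof (rule subspaceI)
  note l = lin_funpow[OF lin_shift[OF assms]]
  show "0 \<in> gen_eigenspace T a" by (auto simp: gen_eigenspace_def intro!: exI[of _ 0])
  show "x + y \<in> gen_eigenspace T a" if x: "x \<in> gen_eigenspace T a" and y: "y \<in> gen_eigenspace T a" for x y
  proof -
    obtain m n where "(shift T a ^^ m) x = 0" "(shift T a ^^ n) y = 0"
      using x y by (auto simp: gen_eigenspace_def)
    then have "(shift T a ^^ max m n) (x + y) = 0"
      using shift_funpow_mono[OF assms] by (simp add: lin_add[OF l])
    then show ?thesis by (auto simp: gen_eigenspace_def)
  qed
  show "c *s x \<in> gen_eigenspace T a" if "x \<in> gen_eigenspace T a" for c x
    using that by (auto simp: gen_eigenspace_def lin_scale[OF l] simp del: scale_eq_0_iff) (metis scale_zero_right)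
qed

lemma gen_eigenspace_shift_closed:
  assumes "lin T" "v \<in> gen_eigenspace T a"
  shows "shift T b v \<in> gen_eigenspace T a"
  using assms lin_0[OF lin_shift[OF assms(1)]]
  by (auto simp: gen_eigenspace_def shift_funpow_commute[symmetric]) metis

text \<open>On the generalised eigenspace of \<open>b\<close> the operator \<open>T - a\<close> is
  the nonzero scalar \<open>b - a\<close> plus a nilpotent operator. The induction inverts it: a
  preimage \<open>v\<close> of \<open>(T - b) u\<close> gives the preimage
  \<open>(u - v) / (b - a)\<close> of \<open>u\<close>.\<close>

lemma shift_surj_on_gen_eigenspace:
  assumes T: "lin T" and W: "subspace W" "\<And>w. w \<in> W \<Longrightarrow> T w \<in> W" and ab: "a \<noteq> b"
  shows "u \<in> W \<Longrightarrow> (shift T b ^^ n) u = 0 \<Longrightarrow> \<exists>v\<in>W. v \<in> gen_eigenspace T b \<and> shift T a v = u"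
proof (induction n arbitrary: u)
  case 0
  then show ?case
    using W lin_0[OF lin_shift[OF T]] subspace_0[OF subspace_gen_eigenspace[OF T]] subspace_0 by fastforce
next
  case (Suc n)
  have "shift T b u \<in> W" using Suc W by (intro shift_closed) auto
  moreover have "(shift T b ^^ n) (shift T b u) = 0"
    using Suc.prems(2) by (simp add: funpow_swap1)
  ultimately obtain v where v: "v \<in> W" "v \<in> gen_eigenspace T b" "shift T a v = shift T b u"
    using Suc.IH by blast
  have u: "u \<in> gen_eigenspace T b" using Suc.prems(2) unfolding gen_eigenspace_def by blast
  have "shift T a (inverse (b - a) *s (u - v)) = inverse (b - a) *s (shift T a u - shift T a v)"
    by (simp add: lin_scale[OF lin_shift[OF T]] lin_diff[OF lin_shift[OF T]])
  also have "shift T a u - shift T a v = (b - a) *s u"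
    unfolding v(3) by (simp add: shift_def algebra_simps)
  finally have "shift T a (inverse (b - a) *s (u - v)) = u" using ab by simp
  moreover have "inverse (b - a) *s (u - v) \<in> W \<inter> gen_eigenspace T b"
    using Suc.prems(1) u v W(1) subspace_gen_eigenspace[OF T]
    by (simp add: subspace_diff subspace_scale)
  ultimately show ?case by blast
qed

text \<open>Induction on the exponent for \<open>b\<close> reduces to a true eigenvector for
  \<open>b\<close>, on which \<open>T - a\<close> is the nonzero scalar \<open>b - a\<close> and
  cannot be nilpotent.\<close>

lemma gen_eigenspace_disjoint:
  assumes T: "lin T" and ab: "a \<noteq> b" and v: "v \<in> gen_eigenspace T a" "v \<in> gen_eigenspace T b"
  shows "v = 0"
proof -
  have eig: "u = 0" if u: "u \<in> gen_eigenspace T a" "shift T b u = 0" for u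
  proof -
    obtain n where "(shift T a ^^ n) u = 0" using u(1) by (auto simp: gen_eigenspace_def)
    moreover have "(shift T a ^^ n) u = (b - a) ^ n *s u"
    proof (induction n)
      case (Suc n)
      have "shift T a u = (b - a) *s u" using u(2) by (simp add: shift_def algebra_simps)
      then show ?case using Suc by (simp add: lin_scale[OF lin_shift[OF T]] ac_simps)
    qed simp
    ultimately show ?thesis using ab by simp
  qed
  obtain n where "(shift T b ^^ n) v = 0" using v(2) by (auto simp: gen_eigenspace_def)
  then show ?thesis using v(1)
  proof (induction n arbitrary: v)
    case (Suc n)
    have "shift T b v = 0"
    proof (rule Suc.IH)
      show "(shift T b ^^ n) (shift T b v) = 0" using Suc.prems(1) by (simp add: funpow_swap1)
    qed (rule gen_eigenspace_shift_closed[OF T Suc.prems(2)])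
    then show ?case using eig Suc.prems by blast
  qed simp
qed

text \<open>A power of \<open>T - c\<close> removes the summand for \<open>c\<close> and keeps the
  others in their eigenspaces. By induction this power kills the others, so they also lie in the
  generalised eigenspace of \<open>c\<close>.\<close>

lemma gen_eigenspace_independent:
  assumes T: "lin T"
  shows "finite A \<Longrightarrow> (\<And>a. a \<in> A \<Longrightarrow> u a \<in> gen_eigenspace T a) \<Longrightarrow> (\<Sum>a\<in>A. u a) = 0 \<Longrightarrow> a \<in> A \<Longrightarrow> u a = 0"
proof (induction A arbitrary: u a rule: finite_induct)
  case (insert c A)
  obtain n where n: "(shift T c ^^ n) (u c) = 0" using insert.prems(1)[of c] by (auto simp: gen_eigenspace_def)
  let ?S = "shift T c ^^ n"
  have l: "lin ?S" by (intro lin_funpow lin_shift T)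
  have "(\<Sum>a\<in>A. ?S (u a)) = 0"
    using arg_cong[OF insert.prems(2), of ?S] insert.hyps n
    by (simp add: lin_add[OF l] lin_sum[OF l] lin_0[OF l])
  moreover have "?S (u a) \<in> gen_eigenspace T a" if "a \<in> A" for a
    using insert.prems(1)[of a] that gen_eigenspace_shift_closed[OF T]
    by (intro funpow_closed) auto
  ultimately have "?S (u a) = 0" if "a \<in> A" for a
    using insert.IH[of "\<lambda>a. ?S (u a)"] that by blast
  then have A: "u a = 0" if "a \<in> A" for a
    using gen_eigenspace_disjoint[OF T, of a c "u a"] insert.prems(1)[of a] insert.hyps that
    by (auto simp: gen_eigenspace_def)
  moreover have "u c = 0" using insert.prems(2) insert.hyps A by simp
  ultimately show ?case using insert.prems(3) by blast
qed simp

section \<open>Polynomials in an operator and the generalised eigenspace decomposition\<close>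

definition papply :: "('b \<Rightarrow> 'b) \<Rightarrow> 'a poly \<Rightarrow> 'b \<Rightarrow> 'b" where
  "papply T p w = (\<Sum>i\<le>degree p. coeff p i *s (T ^^ i) w)"

lemma papply_eq: "degree p \<le> n \<Longrightarrow> papply T p w = (\<Sum>i\<le>n. coeff p i *s (T ^^ i) w)"
  unfolding papply_def by (rule sum.mono_neutral_left) (auto simp: coeff_eq_0)

lemma papply_closed:
  "subspace W \<Longrightarrow> (\<And>w. w \<in> W \<Longrightarrow> T w \<in> W) \<Longrightarrow> w \<in> W \<Longrightarrow> papply T p w \<in> W"
  unfolding papply_def by (intro subspace_sum subspace_scale funpow_closed) auto

lemma papply_linear_factor:
  assumes T: "lin T"
  shows "papply T ([:- a, 1:] * q) w = shift T a (papply T q w)"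
proof -
  let ?n = "degree q"
  have "degree ([:- a, 1:] * q) \<le> Suc ?n"
    using degree_mult_le[of "[:- a, 1:]" q] by simp
  then have "papply T ([:- a, 1:] * q) w = (\<Sum>i\<le>Suc ?n. coeff ([:- a, 1:] * q) i *s (T ^^ i) w)"
    by (rule papply_eq)
  also have "\<dots> = (\<Sum>i\<le>Suc ?n. coeff (pCons 0 q) i *s (T ^^ i) w) - (\<Sum>i\<le>Suc ?n. (a * coeff q i) *s (T ^^ i) w)"
    unfolding sum_subtractf[symmetric] by (intro sum.cong) (simp_all add: algebra_simps)
  also have "(\<Sum>i\<le>Suc ?n. coeff (pCons 0 q) i *s (T ^^ i) w) = T (papply T q w)"
    by (subst sum.atMost_Suc_shift) (simp add: papply_def lin_sum[OF T] lin_scale[OF T])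
  also have "(\<Sum>i\<le>Suc ?n. (a * coeff q i) *s (T ^^ i) w) = a *s papply T q w"
    by (simp add: papply_eq[of q "Suc ?n"] scale_sum_right scale_right_distrib)
  finally show ?thesis by (simp add: shift_def)
qed

text \<open>The polynomial depends on \<open>w\<close> and records a linear dependence of an iterate
  of \<open>w\<close> on the earlier ones. Such a dependence exists because independent iterates
  would eventually exceed the dimension.\<close>

lemma exists_annihilating_poly: "\<exists>p. p \<noteq> 0 \<and> papply T p w = 0"
proof -
  have "\<exists>k. (T ^^ k) w \<in> span ((\<lambda>i. (T ^^ i) w) ` {..<k})"
  proof (rule ccontr)
    assume "\<not> ?thesis"
    then have not: "\<forall>k. (T ^^ k) w \<notin> span ((\<lambda>i. (T ^^ i) w) ` {..<k})" by (rule not_ex[THEN iffD1])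
    have "independent ((\<lambda>i. (T ^^ i) w) ` {..<k}) \<and> card ((\<lambda>i. (T ^^ i) w) ` {..<k}) = k" for k
    proof (induction k)
      case (Suc k)
      let ?X = "(\<lambda>i. (T ^^ i) w) ` {..<k}"
      have "(T ^^ k) w \<notin> span ?X" using not by (rule spec)
      then have "(T ^^ k) w \<notin> ?X" by (rule contrapos_nn) (rule span_base)
      moreover have "independent (insert ((T ^^ k) w) ?X)"
        using \<open>(T ^^ k) w \<notin> span ?X\<close> Suc by (intro independent_insertI) auto
      ultimately show ?case using Suc by (simp add: lessThan_Suc)
    qed (simp add: independent_empty)
    from this[of "Suc dimension"] show False
      using independent_card_le_dim[of _ UNIV] dim_subset_UNIV[of UNIV] by fastforce
  qed
  then obtain k where "(T ^^ k) w \<in> span ((\<lambda>i. (T ^^ i) w) ` {..<k})" by blast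
  moreover have "\<exists>c. v = (\<Sum>i<k. c i *s (T ^^ i) w)" if "v \<in> span ((\<lambda>i. (T ^^ i) w) ` {..<k})" for v
    using that
  proof (induction k arbitrary: v)
    case (Suc k)
    obtain x where "v - x *s (T ^^ k) w \<in> span ((\<lambda>i. (T ^^ i) w) ` {..<k})"
      using Suc.prems by (auto simp: lessThan_Suc span_breakdown_eq)
    then obtain c where c: "v - x *s (T ^^ k) w = (\<Sum>i<k. c i *s (T ^^ i) w)" using Suc.IH by blast
    have "v = (\<Sum>i<Suc k. (c(k := x)) i *s (T ^^ i) w)"
      using c by (simp add: algebra_simps)
    then show ?case by blast
  qed simp
  ultimately obtain c where c: "(T ^^ k) w = (\<Sum>i<k. c i *s (T ^^ i) w)" by blast
  define p where "p = monom 1 k - (\<Sum>i<k. monom (c i) i)"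
  have cf: "coeff p i = (if i = k then 1 else if i < k then - c i else 0)" for i
    by (auto simp: p_def coeff_sum)
  then have "p \<noteq> 0" by (metis coeff_0 zero_neq_one)
  moreover have "degree p \<le> k" by (rule degree_le) (simp add: cf)
  then have "papply T p w = (\<Sum>i\<le>k. coeff p i *s (T ^^ i) w)" by (rule papply_eq)
  then have "papply T p w = (T ^^ k) w - (\<Sum>i<k. c i *s (T ^^ i) w)"
    by (simp add: cf lessThan_Suc_atMost[symmetric] sum_negf)
  ultimately show ?thesis using c by auto
qed

end

locale ac_space = finite_dimensional_vector_space scale Basis
  for scale :: "'f::{alg_closed_field, field_char_0} \<Rightarrow> 'v::ab_group_add \<Rightarrow> 'v" (infixr "*s" 75)
    and Basis
begin

text \<open>A polynomial annihilating \<open>w\<close> splits over the field, so it suffices to undo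
  one linear factor: if \<open>(T - a) w\<close> is in the span, so is \<open>w\<close>.\<close>

lemma gen_eigenspaces_span:
  assumes T: "lin T" and W: "subspace W" "\<And>w. w \<in> W \<Longrightarrow> T w \<in> W"
  shows "span (W \<inter> (\<Union>a. gen_eigenspace T a)) = W"
proof -
  let ?X = "W \<inter> (\<Union>a. gen_eigenspace T a)"
  have XW: "span ?X \<subseteq> W" using W(1) by (intro span_minimal) auto
  have step: "w \<in> span ?X" if w: "w \<in> W" and s: "shift T a w \<in> span ?X" for a w
  proof -
    \<comment> \<open>\<open>T - a\<close> maps every generalised eigenspace other than that of
      \<open>a\<close> onto itself. So the span is its image up to the generalised eigenspace of
      \<open>a\<close>, and a suitable \<open>w - v\<close> is a generalised eigenvector for
      \<open>a\<close>.\<close>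
    have "\<exists>v\<in>span ?X. \<exists>u\<in>W \<inter> gen_eigenspace T a. y = shift T a v + u" if "y \<in> span ?X" for y
      using that
    proof (induction rule: span_induct_alt)
      case base
      show ?case
        using span_zero W(1) subspace_0 lin_0[OF lin_shift[OF T]] subspace_gen_eigenspace[OF T] by force
    next
      case (step c x y)
      obtain v u where vu: "v \<in> span ?X" "u \<in> W \<inter> gen_eigenspace T a" "y = shift T a v + u" using step by blast
      obtain b where b: "x \<in> W" "x \<in> gen_eigenspace T b" using step(1) by blast
      show ?case
      proof (cases "a = b")
        case True
        have "c *s x + u \<in> W \<inter> gen_eigenspace T a"
          using b vu True W(1) subspace_gen_eigenspace[OF T] by (simp add: subspace_add subspace_scale)
        moreover have "c *s x + y = shift T a v + (c *s x + u)" using vu by simp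
        ultimately show ?thesis using vu(1) by blast
      next
        case False
        obtain x' where x': "x' \<in> W" "x' \<in> gen_eigenspace T b" "shift T a x' = x"
          using shift_surj_on_gen_eigenspace[OF T W False b(1)] b(2) by (auto simp: gen_eigenspace_def)
        have "x' \<in> ?X" using x' by blast
        then have "c *s x' + v \<in> span ?X" using vu(1) by (intro span_add span_scale) (auto intro: span_base)
        moreover have "c *s x + y = shift T a (c *s x' + v) + u"
          using vu x' by (simp add: lin_add[OF lin_shift[OF T]] lin_scale[OF lin_shift[OF T]])
        ultimately show ?thesis using vu(2) by blast
      qed
    qed
    from this[OF s] obtain v u where vu: "v \<in> span ?X" "u \<in> W" "u \<in> gen_eigenspace T a" "shift T a w = shift T a v + u"
      by blast
    have "shift T a (w - v) = u" using vu by (simp add: lin_diff[OF lin_shift[OF T]])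
    moreover obtain n where "(shift T a ^^ n) u = 0" using vu(3) by (auto simp: gen_eigenspace_def)
    ultimately have "(shift T a ^^ Suc n) (w - v) = 0" by (simp add: funpow_swap1)
    then have "w - v \<in> gen_eigenspace T a" unfolding gen_eigenspace_def by blast
    moreover have "w - v \<in> W" using w vu(1) XW W(1) by (blast intro: subspace_diff)
    ultimately have "w - v \<in> span ?X" by (intro span_base) blast
    then show ?thesis using vu(1) span_add by fastforce
  qed
  have "p \<noteq> 0 \<Longrightarrow> w \<in> W \<Longrightarrow> papply T p w \<in> span ?X \<Longrightarrow> w \<in> span ?X" for p w
  proof (induction "degree p" arbitrary: p)
    case 0
    then obtain c where "p = [:c:]" by (metis degree_eq_zeroE)
    then have "c \<noteq> 0" "c *s w \<in> span ?X" using 0 by (auto simp: papply_def)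
    then show ?case using span_scale[of "c *s w" ?X "inverse c"] by simp
  next
    case (Suc n)
    then obtain a where "poly p a = 0" by (metis alg_closed_imp_poly_has_root zero_less_Suc)
    then obtain q where q: "p = [:- a, 1:] * q" by (metis poly_eq_0_iff_dvd dvdE)
    have q0: "q \<noteq> 0" using q Suc.prems(1) by auto
    then have "n = degree q" using Suc.hyps(2) unfolding q by (subst (asm) degree_mult_eq) auto
    moreover have "papply T q w \<in> span ?X"
      using step[of "papply T q w" a] papply_closed[of W T w q, OF W Suc.prems(2)] Suc.prems(3)
      unfolding q papply_linear_factor[OF T] by blast
    ultimately show ?case using Suc.hyps(1)[of q] q0 Suc.prems(2) by blast
  qed
  then have "W \<subseteq> span ?X" using exists_annihilating_poly[of T] span_zero by (metis subsetI)
  with XW show ?thesis by blast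
qed

lemma gen_eigenbasis:
  assumes "lin T" "subspace W" "\<And>w. w \<in> W \<Longrightarrow> T w \<in> W"
  obtains B e where "independent B" "span B = W" "B \<subseteq> W" "\<And>b. b \<in> B \<Longrightarrow> b \<in> gen_eigenspace T (e b)"
proof -
  obtain B where B: "B \<subseteq> W \<inter> (\<Union>a. gen_eigenspace T a)" "independent B" "span B = W"
    using sub_basis[OF gen_eigenspaces_span[OF assms]] by blast
  then have "\<forall>b\<in>B. \<exists>a. b \<in> gen_eigenspace T a" by blast
  then obtain e where "\<forall>b\<in>B. b \<in> gen_eigenspace T (e b)" by (auto dest!: bchoice)
  with B that show ?thesis by blast
qed

text \<open>The function \<open>g\<close> of the eigenvalue is free: the identity gives the
  semisimple part of \<open>T\<close>, a rational functional gives the test operator of Cartan's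
  criterion. The operator is prescribed on a basis of generalised eigenvectors; independence of the
  eigenspaces makes it a scalar on each of them.\<close>

lemma diagonal_operator:
  assumes T: "lin T" and W: "subspace W" "\<And>w. w \<in> W \<Longrightarrow> T w \<in> W"
  obtains y where "lin y" "\<And>w. w \<in> W \<Longrightarrow> y w \<in> W"
    "\<And>a w. w \<in> W \<Longrightarrow> w \<in> gen_eigenspace T a \<Longrightarrow> y w = g a *s w"
proof -
  obtain B e where B: "independent B" "span B = W" "B \<subseteq> W"
    and e: "\<And>b. b \<in> B \<Longrightarrow> b \<in> gen_eigenspace T (e b)"
    using gen_eigenbasis[OF assms] by blast
  have fin: "finite B" using B(1) by (rule finiteI_independent)
  obtain y where y: "lin y" "\<And>b. b \<in> B \<Longrightarrow> y b = g (e b) *s b"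
    using endo.linear_independent_extend[OF B(1), of "\<lambda>b. g (e b) *s b"] by blast
  have closed: "y w \<in> W" if "w \<in> W" for w
    by (rule lin_span_closed[OF y(1) _ W(1), of B]) (use that B y W subspace_scale in auto)
  have "y w = g a *s w" if w: "w \<in> W" "w \<in> gen_eigenspace T a" for a w
  proof -
    define r where "r = representation B w"
    have exp: "(\<Sum>b\<in>B. r b *s b) = w" unfolding r_def using B w by (simp add: basis_expand)
    \<comment> \<open>\<open>a\<close> may fail to be the eigenvalue of a basis vector, so it is
      added to provide the term from which \<open>w\<close> is subtracted.\<close>
    define A where "A = insert a (e ` B)"
    have A: "finite A" "e ` B \<subseteq> A" unfolding A_def using fin by auto
    define u where "u c = (\<Sum>b\<in>{b\<in>B. e b = c}. r b *s b)" for c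
    have u: "u c \<in> gen_eigenspace T c" for c
      unfolding u_def using e by (intro subspace_sum subspace_scale subspace_gen_eigenspace T) auto
    have group: "(\<Sum>c\<in>A. \<Sum>b\<in>{b\<in>B. e b = c}. h b) = (\<Sum>b\<in>B. h b)" for h :: "'v \<Rightarrow> 'v"
      by (rule sum.group[OF fin A])
    have "(\<Sum>c\<in>A. u c - (if c = a then w else 0)) = 0"
    proof -
      have "(\<Sum>c\<in>A. u c) = w" unfolding u_def using group exp by (rule trans)
      moreover have "a \<in> A" unfolding A_def by simp
      ultimately show ?thesis using A(1) by (simp add: sum_subtractf)
    qed
    moreover have "u c - (if c = a then w else 0) \<in> gen_eigenspace T c" for c
      using u[of c] w(2) subspace_gen_eigenspace[OF T, of c]
      by (cases "c = a") (simp_all add: subspace_diff)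
    ultimately have z: "u c - (if c = a then w else 0) = 0" if "c \<in> A" for c
      using gen_eigenspace_independent[OF T A(1), of "\<lambda>c. u c - (if c = a then w else 0)"] that
      by presburger
    have "y w - g a *s w = (\<Sum>b\<in>B. (g (e b) - g a) *s r b *s b)"
      unfolding exp[symmetric] using y
      by (simp add: lin_sum lin_scale scale_sum_right sum_subtractf[symmetric] algebra_simps)
    also have "\<dots> = (\<Sum>c\<in>A. \<Sum>b\<in>{b\<in>B. e b = c}. (g (e b) - g a) *s r b *s b)"
      by (rule group[symmetric])
    also have "\<dots> = (\<Sum>c\<in>A. (g c - g a) *s u c)"
      unfolding u_def scale_sum_right by (intro sum.cong refl) auto
    also have "\<dots> = 0"
    proof (rule sum.neutral, rule ballI)
      fix c assume "c \<in> A"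
      then show "(g c - g a) *s u c = 0" using z[of c] by (cases "c = a") simp_all
    qed
    finally show ?thesis by simp
  qed
  with that y closed show ?thesis by blast
qed

end

text \<open>The field is viewed as a vector space over the rationals; \<open>f\<close> is the
  coordinate of \<open>a\<close> in a rational basis containing \<open>a\<close>.\<close>

lemma exists_rat_functional:
  fixes a :: "'f::field_char_0"
  assumes "a \<noteq> 0"
  obtains f :: "'f \<Rightarrow> rat" where "\<And>x y. f (x + y) = f x + f y" "\<And>r x. f (of_rat r * x) = r * f x" "f a = 1"
proof -
  interpret Q: vector_space "\<lambda>r x. of_rat r * x :: 'f"
    by unfold_locales (simp_all add: algebra_simps of_rat_add of_rat_mult)
  let ?B = "Q.extend_basis {a}"
  have ind: "Q.independent {a}" using assms by simp
  have B: "Q.independent ?B" "Q.span ?B = UNIV" "a \<in> ?B"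
    using Q.independent_extend_basis[OF ind] Q.span_extend_basis[OF ind] Q.extend_basis_superset[OF ind] by auto
  show ?thesis
    by (rule that[of "\<lambda>x. Q.representation ?B x a"])
      (use B in \<open>simp_all add: Q.representation_add Q.representation_scale Q.representation_basis\<close>)
qed

context finite_dimensional_vector_space
begin

text \<open>Trace functionals are known to be additive only on the carrier, where the operators
  preserve the module, so the argument for linear maps is run inside \<open>S\<close>.\<close>

lemma span_functional_zero:
  assumes S: "subspace S" "X \<subseteq> S"
    and add: "\<And>x y. x \<in> S \<Longrightarrow> y \<in> S \<Longrightarrow> \<Phi> (x + y) = \<Phi> x + (\<Phi> y :: 'a)"
    and scale: "\<And>c x. x \<in> S \<Longrightarrow> \<Phi> (c *s x) = c * \<Phi> x"
    and X: "\<And>x. x \<in> X \<Longrightarrow> \<Phi> x = 0" and z: "z \<in> span X"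
  shows "\<Phi> z = 0"
proof -
  have "\<Phi> 0 = 0" using scale[of 0 0] S(1) subspace_0 by auto
  then have "subspace {x \<in> S. \<Phi> x = 0}"
    using S(1) add scale by (auto simp: subspace_def)
  then have "span X \<subseteq> {x \<in> S. \<Phi> x = 0}" using S X by (intro span_minimal) auto
  with z show ?thesis by blast
qed

text \<open>The dimension is bounded; this replaces chain arguments for maximal subalgebras, ideals
  and complements.\<close>

lemma exists_max_dim:
  assumes "P A"
  shows "\<exists>B. P B \<and> (\<forall>C. P C \<longrightarrow> dim C \<le> dim B)"
proof (rule ex_has_greatest_nat[of P, OF assms])
  show "\<forall>B. P B \<longrightarrow> dim B < Suc dimension" using dim_subset_UNIV by (simp add: less_Suc_eq_le)
qed

lemma gen_eigenspace_0_iff: "v \<in> gen_eigenspace T 0 \<longleftrightarrow> (\<exists>n. (T ^^ n) v = 0)"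
proof -
  have "shift T 0 = T" by (simp add: shift_def fun_eq_iff)
  then show ?thesis by (simp add: gen_eigenspace_def)
qed

text \<open>A copy of the derived series for an arbitrary bracket, since it is also taken for the
  projected bracket that models a quotient.\<close>

primrec der :: "('b \<Rightarrow> 'b \<Rightarrow> 'b) \<Rightarrow> 'b set \<Rightarrow> nat \<Rightarrow> 'b set" where
  "der br N 0 = N"
| "der br N (Suc n) = span {br x y | x y. x \<in> der br N n \<and> y \<in> der br N n}"

end

section \<open>Lie algebras and modules carried by subspaces\<close>

text \<open>Carriers are subspaces of one ambient space, so that a quotient can be replaced by a
  complement: the bracket of the quotient is then the ambient bracket followed by a projection.
  Outside the carriers the maps are linear but otherwise arbitrary.\<close>

locale lie_on = ac_space scale Basis
  for scale :: "'f::{alg_closed_field, field_char_0} \<Rightarrow> 'v::ab_group_add \<Rightarrow> 'v" (infixr "*s" 75)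
    and Basis +
  fixes S :: "'v set" and br :: "'v \<Rightarrow> 'v \<Rightarrow> 'v"
  assumes S: "subspace S"
    and br_lin_left: "lin (\<lambda>x. br x y)"
    and br_lin_right: "lin (br x)"
    and br_closed: "x \<in> S \<Longrightarrow> y \<in> S \<Longrightarrow> br x y \<in> S"
    and br_alt: "x \<in> S \<Longrightarrow> br x x = 0"
    and br_jacobi: "x \<in> S \<Longrightarrow> y \<in> S \<Longrightarrow> z \<in> S \<Longrightarrow> br x (br y z) + br y (br z x) + br z (br x y) = 0"
begin

lemmas br_simps =
  lin_add[OF br_lin_left] lin_add[OF br_lin_right] lin_scale[OF br_lin_left] lin_scale[OF br_lin_right]
  lin_diff[OF br_lin_left] lin_diff[OF br_lin_right] lin_0[OF br_lin_left] lin_0[OF br_lin_right]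
  lin_neg[OF br_lin_left] lin_neg[OF br_lin_right]

lemma br_skew: "x \<in> S \<Longrightarrow> y \<in> S \<Longrightarrow> br x y = - br y x"
  using br_alt[of "x + y"] br_alt[of x] br_alt[of y] S
  by (simp add: br_simps subspace_add add_eq_0_iff2)

lemma br_br:
  assumes "x \<in> S" "y \<in> S" "z \<in> S"
  shows "br (br x y) z = br x (br y z) - br y (br x z)"
proof -
  have "br (br x y) z = - br z (br x y)" using assms by (intro br_skew br_closed)
  moreover have "br y (br z x) = - br y (br x z)" using assms br_skew[of z x] by (simp add: br_simps)
  ultimately show ?thesis using br_jacobi[OF assms] by (simp add: algebra_simps add_eq_0_iff2)
qed

definition closed :: "'v set \<Rightarrow> bool" where
  "closed N \<longleftrightarrow> subspace N \<and> N \<subseteq> S \<and> (\<forall>x\<in>N. \<forall>y\<in>N. br x y \<in> N)"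

lemma closed_S: "closed S"
  using S br_closed by (simp add: closed_def)

end

locale lie_module = lie_on scale Basis S br
  for scale :: "'f::{alg_closed_field, field_char_0} \<Rightarrow> 'v::ab_group_add \<Rightarrow> 'v" (infixr "*s" 75)
    and Basis S br +
  fixes M :: "'v set" and act :: "'v \<Rightarrow> 'v \<Rightarrow> 'v"
  assumes M: "subspace M"
    and act_lin_left: "lin (\<lambda>x. act x m)"
    and act_lin_right: "lin (act x)"
    and act_closed: "x \<in> S \<Longrightarrow> m \<in> M \<Longrightarrow> act x m \<in> M"
    and act_br: "x \<in> S \<Longrightarrow> y \<in> S \<Longrightarrow> m \<in> M \<Longrightarrow> act (br x y) m = act x (act y m) - act y (act x m)"
begin

lemmas act_simps =
  lin_add[OF act_lin_left] lin_add[OF act_lin_right] lin_scale[OF act_lin_left] lin_scale[OF act_lin_right]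
  lin_diff[OF act_lin_left] lin_diff[OF act_lin_right] lin_0[OF act_lin_left] lin_0[OF act_lin_right]
  lin_neg[OF act_lin_left] lin_neg[OF act_lin_right]

definition trace_form :: "'v \<Rightarrow> 'v \<Rightarrow> 'f" where
  "trace_form x y = trace M (\<lambda>m. act x (act y m))"

lemma trace_act_add:
  assumes "lin h" "\<And>m. m \<in> M \<Longrightarrow> h m \<in> M" "x \<in> S" "y \<in> S"
  shows "trace M (\<lambda>m. act (x + y) (h m)) = trace M (\<lambda>m. act x (h m)) + trace M (\<lambda>m. act y (h m))"
  unfolding act_simps using assms
  by (intro trace_add M lin_compose[OF act_lin_right assms(1)]) (auto simp: act_closed)

lemma trace_act_scale:
  assumes "lin h" "\<And>m. m \<in> M \<Longrightarrow> h m \<in> M" "x \<in> S"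
  shows "trace M (\<lambda>m. act (c *s x) (h m)) = c * trace M (\<lambda>m. act x (h m))"
  unfolding act_simps using assms
  by (intro trace_smult M lin_compose[OF act_lin_right assms(1)]) (auto simp: act_closed)

lemma trace_form_commute: "x \<in> S \<Longrightarrow> y \<in> S \<Longrightarrow> trace_form x y = trace_form y x"
  unfolding trace_form_def by (intro trace_commute M act_lin_right) (auto simp: act_closed)

lemma trace_form_add_left: "x \<in> S \<Longrightarrow> y \<in> S \<Longrightarrow> z \<in> S \<Longrightarrow> trace_form (x + y) z = trace_form x z + trace_form y z"
  unfolding trace_form_def by (intro trace_act_add act_lin_right) (auto simp: act_closed)

lemma trace_form_scale_left: "x \<in> S \<Longrightarrow> z \<in> S \<Longrightarrow> trace_form (c *s x) z = c * trace_form x z"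
  unfolding trace_form_def by (intro trace_act_scale act_lin_right) (auto simp: act_closed)

text \<open>Each side is \<open>tr (x y z)\<close> minus a trace of three factors, namely
  \<open>tr (y x z)\<close> and \<open>tr (x z y)\<close>, and these agree by cyclicity.\<close>

lemma trace_form_invariant:
  assumes "x \<in> S" "y \<in> S" "z \<in> S"
  shows "trace_form (br x y) z = trace_form x (br y z)"
proof -
  note c = lin_compose[OF act_lin_right lin_compose[OF act_lin_right act_lin_right]]
  have "trace_form (br x y) z = trace M (\<lambda>m. act x (act y (act z m)) - act y (act x (act z m)))"
    unfolding trace_form_def using assms by (intro trace_cong M) (simp add: act_br act_closed)
  also have "\<dots> = trace M (\<lambda>m. act x (act y (act z m))) - trace M (\<lambda>m. act y (act x (act z m)))"
    using assms by (intro trace_diff M c) (auto simp: act_closed)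
  also have "trace M (\<lambda>m. act y (act x (act z m))) = trace M (\<lambda>m. act x (act z (act y m)))"
    using assms by (intro trace_commute[of M "act y" "\<lambda>m. act x (act z m)"] M act_lin_right lin_compose[OF act_lin_right act_lin_right])
      (auto simp: act_closed)
  also have "trace M (\<lambda>m. act x (act y (act z m))) - trace M (\<lambda>m. act x (act z (act y m)))
      = trace M (\<lambda>m. act x (act y (act z m)) - act x (act z (act y m)))"
    using assms by (intro trace_diff[symmetric] M c) (auto simp: act_closed)
  also have "\<dots> = trace_form x (br y z)"
    unfolding trace_form_def using assms by (intro trace_cong M) (simp add: act_br act_closed act_simps)
  finally show ?thesis .
qed

subsection \<open>Engel's theorem\<close>

text \<open>\<open>annihilated Q k\<close> consists of the vectors killed by every product of
  \<open>k\<close> elements of \<open>Q\<close>. The conclusion of Engel's theorem thus takes the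
  form \<open>annihilated Q n = M\<close>.\<close>

primrec annihilated :: "'v set \<Rightarrow> nat \<Rightarrow> 'v set" where
  "annihilated Q 0 = {0}"
| "annihilated Q (Suc k) = {m \<in> M. \<forall>q\<in>Q. act q m \<in> annihilated Q k}"

lemma subspace_annihilated: "subspace (annihilated Q k)"
  by (induction k) (use M in \<open>auto simp: subspace_def act_simps\<close>)

lemma annihilated_subset: "annihilated Q k \<subseteq> M"
  using M subspace_0 by (cases k) auto

lemma annihilated_Suc: "annihilated Q k \<subseteq> annihilated Q (Suc k)"
  by (induction k) (use M subspace_0 in \<open>auto simp: act_simps\<close>)

lemma annihilated_mono: "j \<le> k \<Longrightarrow> annihilated Q j \<subseteq> annihilated Q k"
  by (rule lift_Suc_mono_le[of "annihilated Q"]) (rule annihilated_Suc)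

lemma act_annihilated: "q \<in> Q \<Longrightarrow> m \<in> annihilated Q k \<Longrightarrow> act q m \<in> annihilated Q (k - 1)"
  by (cases k) (auto simp: act_simps)

lemma annihilated_stable: "\<exists>l. annihilated Q (Suc l) \<subseteq> annihilated Q l"
proof (rule ccontr)
  assume "\<not> ?thesis"
  then have "annihilated Q l \<subset> annihilated Q (Suc l)" for l using annihilated_Suc by blast
  then have "span (annihilated Q l) \<subset> span (annihilated Q (Suc l))" for l
    unfolding span_eq_iff[THEN iffD2, OF subspace_annihilated] .
  then have less: "dim (annihilated Q l) < dim (annihilated Q (Suc l))" for l by (rule dim_psubset)
  have "l \<le> dim (annihilated Q l)" for l
  proof (induction l)
    case (Suc l) then show ?case using less[of l] by linarith
  qed simp
  then show False using dim_subset_UNIV[of "annihilated Q (Suc dimension)"] by (metis Suc_n_not_le_n order.trans)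
qed

definition kernel :: "'v set \<Rightarrow> 'v set" where
  "kernel N = {x \<in> N. \<forall>m\<in>M. act x m = 0}"

lemma closed_kernel: "closed N \<Longrightarrow> closed (kernel N)"
  unfolding closed_def kernel_def subspace_def
  by (auto simp: act_simps act_br subset_iff)

text \<open>One step of Engel's theorem. Demanding that \<open>Q\<close> contain the kernel stands
  in for a faithful action. Some \<open>x\<close> outside \<open>Q\<close> normalises
  \<open>Q\<close>, and adjoining it keeps long products zero because \<open>x\<close> acts
  nilpotently and preserves the filtration of \<open>Q\<close>.\<close>

lemma engel_step:
  assumes N: "closed N" and nil: "\<And>x m. x \<in> N \<Longrightarrow> m \<in> M \<Longrightarrow> \<exists>k. (act x ^^ k) m = 0"
    and Q: "closed Q" "kernel N \<subseteq> Q" "Q \<subset> N" and n: "annihilated Q n = M"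
  shows "\<exists>Q'. closed Q' \<and> Q \<subset> Q' \<and> Q' \<subseteq> N \<and> (\<exists>n. annihilated Q' n = M)"
proof -
  note [simp] = subspace_annihilated
  have NS: "N \<subseteq> S" and QS: "Q \<subseteq> S" using N Q unfolding closed_def by auto
  \<comment> \<open>\<open>E i\<close> shifts the filtration by at least \<open>i - n\<close> steps, so bracketing with \<open>Q\<close> maps \<open>E i\<close> into \<open>E (Suc i)\<close>.\<close>
  define E where "E i = {p \<in> N. \<forall>j\<le>n. \<forall>m\<in>annihilated Q j. act p m \<in> annihilated Q (n + j - i)}" for i
  have top: "annihilated Q (n + j) = M" for j
    using annihilated_mono[of n "n + j" Q] annihilated_subset[of Q "n + j"] n by simp
  have "act p m \<in> M" if "p \<in> N" "m \<in> annihilated Q j" for p m j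
    using act_closed that annihilated_subset NS by blast
  then have "E 0 = N" unfolding E_def by (auto simp: top)
  \<comment> \<open>With \<open>j = n\<close> the filtration index becomes zero, so these elements
    kill all of \<open>M\<close>.\<close>
  moreover have "E (2 * n) \<subseteq> Q"
  proof -
    have "act p m = 0" if "p \<in> E (2 * n)" "m \<in> M" for p m
    proof -
      have "act p m \<in> annihilated Q (n + n - 2 * n)" using that n unfolding E_def by blast
      then show ?thesis by (simp add: mult_2)
    qed
    then have "E (2 * n) \<subseteq> kernel N" unfolding E_def kernel_def by blast
    with Q(2) show ?thesis by blast
  qed
  ultimately have E: "\<not> E 0 \<subseteq> Q" "E (2 * n) \<subseteq> Q" using Q(3) by auto
  \<comment> \<open>\<open>E\<close> starts at \<open>N\<close> and ends inside \<open>Q\<close>. An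
    element at a level not contained in \<open>Q\<close>, with the next level contained in
    \<open>Q\<close>, has its brackets with \<open>Q\<close> in that next level and so normalises
    \<open>Q\<close>.\<close>
  have "\<exists>i. \<not> E i \<subseteq> Q \<and> E (Suc i) \<subseteq> Q"
  proof (rule ccontr)
    assume not: "\<not> ?thesis"
    have "\<not> E i \<subseteq> Q" for i
    proof (induction i)
      case 0 show ?case by (rule E(1))
    next
      case (Suc i) then show ?case using not by blast
    qed
    then show False using E(2) by blast
  qed
  then obtain i where i: "\<not> E i \<subseteq> Q" "E (Suc i) \<subseteq> Q" by blast
  then obtain x where x: "x \<in> E i" "x \<notin> Q" by blast
  have xN: "x \<in> N" and xS: "x \<in> S" using x NS unfolding E_def by auto
  have qx: "br q x \<in> Q" if q: "q \<in> Q" for q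
  proof -
    have "act (br q x) m \<in> annihilated Q (n + j - Suc i)" if j: "j \<le> n" "m \<in> annihilated Q j" for j m
    proof -
      have mM: "m \<in> M" using j annihilated_subset by blast
      have "act x m \<in> annihilated Q (n + j - i)" using x j unfolding E_def by blast
      then have 1: "act q (act x m) \<in> annihilated Q (n + j - Suc i)"
        using act_annihilated[OF q] by fastforce
      have 2: "act x (act q m) \<in> annihilated Q (n + j - Suc i)"
      proof (cases j)
        case 0 then show ?thesis using j by (simp add: act_simps subspace_0)
      next
        case (Suc j')
        then have "act q m \<in> annihilated Q j'" using act_annihilated[OF q j(2)] by simp
        then have "act x (act q m) \<in> annihilated Q (n + j' - i)" using x j Suc unfolding E_def by simp
        then show ?thesis using Suc by simp
      qed
      have "act (br q x) m = act q (act x m) - act x (act q m)" using q QS xS mM by (intro act_br) auto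
      then show ?thesis using 1 2 by (simp add: subspace_diff)
    qed
    moreover have "br q x \<in> N" using q Q xN N unfolding closed_def by auto
    ultimately show ?thesis using i(2) unfolding E_def by blast
  qed
  define Q' where "Q' = span (insert x Q)"
  have Q'_iff: "p \<in> Q' \<longleftrightarrow> (\<exists>c. \<exists>q\<in>Q. p = c *s x + q)" for p
  proof -
    have sQ: "span Q = Q" using Q unfolding closed_def by simp
    have "p \<in> Q' \<longleftrightarrow> (\<exists>c. p - c *s x \<in> Q)" unfolding Q'_def span_breakdown_eq sQ ..
    moreover have "p - c *s x \<in> Q \<longleftrightarrow> (\<exists>q\<in>Q. p = c *s x + q)" for c
    proof
      assume "p - c *s x \<in> Q"
      then show "\<exists>q\<in>Q. p = c *s x + q" by (intro bexI[of _ "p - c *s x"]) simp_all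
    qed auto
    ultimately show ?thesis by simp
  qed
  have "insert x Q \<subseteq> N" "subspace N" using xN Q(3) N unfolding closed_def by auto
  then have "Q' \<subseteq> N" unfolding Q'_def by (rule span_minimal)
  moreover have "insert x Q \<subseteq> Q'" "subspace Q'" unfolding Q'_def by (simp_all add: span_superset)
  ultimately have sub: "Q \<subseteq> Q'" "x \<in> Q'" "Q' \<subseteq> N" "subspace Q'" by auto
  have "closed Q'"
    unfolding closed_def
  proof (intro conjI ballI)
    show "subspace Q'" "Q' \<subseteq> S" using sub NS by auto
    fix p p' assume "p \<in> Q'" "p' \<in> Q'"
    then obtain c q c' q' where p: "q \<in> Q" "q' \<in> Q" "p = c *s x + q" "p' = c' *s x + q'"
      unfolding Q'_iff by blast
    have "br p p' = c' *s br q x - c *s br q' x + br q q'"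
      using p xS QS br_alt[OF xS] br_skew[of x q'] by (auto simp: br_simps algebra_simps)
    also have "\<dots> \<in> Q"
      using Q(1) p(1,2) unfolding closed_def
      by (intro subspace_add[of Q] subspace_diff[of Q] subspace_scale[of Q] qx) blast+
    finally show "br p p' \<in> Q'" using sub by blast
  qed
  moreover have "\<exists>l. annihilated Q' l = M"
  proof -
    \<comment> \<open>At a level where the filtration of \<open>Q'\<close> is stationary, it remains
      to show that it swallows every \<open>annihilated Q k\<close>.\<close>
    obtain l where l: "annihilated Q' (Suc l) \<subseteq> annihilated Q' l" using annihilated_stable by blast
    have xZ: "m \<in> annihilated Q k \<Longrightarrow> act x m \<in> annihilated Q k" for m k
    proof (induction k arbitrary: m)
      case (Suc k)
      have mM: "m \<in> M" using Suc.prems by simp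
      have "act q (act x m) \<in> annihilated Q k" if q: "q \<in> Q" for q
      proof -
        have "act q (act x m) = act x (act q m) + act (br q x) m"
          using act_br[of q x m] q QS xS mM by auto
        moreover have "act (br q x) m \<in> annihilated Q k" "act q m \<in> annihilated Q k"
          using Suc.prems qx[OF q] q by auto
        ultimately show ?thesis using Suc.IH by (simp add: subspace_add)
      qed
      then show ?case using act_closed xS mM by simp
    qed (simp add: act_simps)
    have "annihilated Q k \<subseteq> annihilated Q' l" for k
    proof (induction k)
      case 0 show ?case using subspace_0 by simp
    next
      case (Suc k)
      \<comment> \<open>Inner induction on the exponent with which \<open>x\<close> kills
        \<open>m\<close>: it covers the image of \<open>m\<close> under \<open>x\<close>, while the
        outer induction covers the images under \<open>Q\<close>.\<close>
      have "(act x ^^ r) m = 0 \<Longrightarrow> m \<in> annihilated Q (Suc k) \<Longrightarrow> m \<in> annihilated Q' l" for r m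
      proof (induction r arbitrary: m)
        case 0 then show ?case using subspace_0 by simp
      next
        case (Suc r)
        have "act x m \<in> annihilated Q' l"
          using Suc.prems xZ by (intro Suc.IH) (simp_all add: funpow_swap1 del: annihilated.simps)
        moreover have "act q m \<in> annihilated Q' l" if "q \<in> Q" for q
          using Suc.prems(2) that \<open>annihilated Q k \<subseteq> annihilated Q' l\<close> by auto
        ultimately have "act p m \<in> annihilated Q' l" if "p \<in> Q'" for p
          using that unfolding Q'_iff by (auto simp: act_simps subspace_add subspace_scale)
        then have "m \<in> annihilated Q' (Suc l)" using Suc.prems(2) by simp
        then show ?case using l by blast
      qed
      then show ?case using nil[OF xN] annihilated_subset by blast
    qed
    then show ?thesis using n annihilated_subset by blast
  qed
  ultimately show ?thesis using sub x by blast
qed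

text \<open>The kernel starts the climb, since one step of its filtration is all of
  \<open>M\<close>. A candidate of maximal dimension cannot be enlarged by \<open>engel_step\<close>
  and is therefore \<open>N\<close>.\<close>

lemma engel:
  assumes N: "closed N" and nil: "\<And>x m. x \<in> N \<Longrightarrow> m \<in> M \<Longrightarrow> \<exists>k. (act x ^^ k) m = 0"
  shows "\<exists>n. annihilated N n = M"
proof -
  define P where "P Q \<longleftrightarrow> closed Q \<and> kernel N \<subseteq> Q \<and> Q \<subseteq> N \<and> (\<exists>n. annihilated Q n = M)" for Q
  have "annihilated (kernel N) (Suc 0) = M" unfolding kernel_def by auto
  moreover have "kernel N \<subseteq> N" by (auto simp: kernel_def)
  ultimately have "P (kernel N)" unfolding P_def using closed_kernel[OF N] by blast
  from exists_max_dim[of P, OF this] obtain Q where max: "P Q \<and> (\<forall>Q'. P Q' \<longrightarrow> dim Q' \<le> dim Q)" ..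
  then have Q: "P Q" "\<And>Q'. P Q' \<Longrightarrow> dim Q' \<le> dim Q" by simp_all
  have "Q = N"
  proof (rule ccontr)
    assume "Q \<noteq> N"
    obtain n where PQ: "closed Q" "kernel N \<subseteq> Q" "Q \<subseteq> N" "annihilated Q n = M"
      using Q(1) unfolding P_def by (elim conjE exE)
    have "\<exists>Q'. closed Q' \<and> Q \<subset> Q' \<and> Q' \<subseteq> N \<and> (\<exists>n. annihilated Q' n = M)"
      by (rule engel_step[OF N _ PQ(1,2) _ PQ(4)]) (use nil PQ(3) \<open>Q \<noteq> N\<close> in auto)
    then obtain Q' where "closed Q' \<and> Q \<subset> Q' \<and> Q' \<subseteq> N \<and> (\<exists>n. annihilated Q' n = M)" ..
    then have Q': "closed Q'" "Q \<subset> Q'" "Q' \<subseteq> N" "\<exists>n. annihilated Q' n = M" by simp_all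
    then have "P Q'" using PQ(2) unfolding P_def by (intro conjI) auto
    moreover have "dim Q < dim Q'"
      using Q'(1,2) PQ(1) unfolding closed_def by (intro dim_psubset) (simp add: span_eq_iff[THEN iffD2])
    ultimately show False using Q(2)[of Q'] by simp
  qed
  then show ?thesis using Q(1) unfolding P_def by blast
qed

text \<open>An element of \<open>D i\<close> lowers the filtration by at least \<open>i + 1\<close>
  steps. Commutators of such elements lower it further, so the derived series follows
  \<open>D\<close> until its elements act by zero.\<close>

lemma engel_derived:
  assumes N: "closed N" and nil: "\<And>x m. x \<in> N \<Longrightarrow> m \<in> M \<Longrightarrow> \<exists>k. (act x ^^ k) m = 0"
  shows "\<exists>k. \<forall>x\<in>der br N k. \<forall>m\<in>M. act x m = 0"
proof -
  obtain n where n: "annihilated N n = M" using engel[OF N nil] by blast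
  have NS: "subspace N" "N \<subseteq> S" "\<And>x y. x \<in> N \<Longrightarrow> y \<in> N \<Longrightarrow> br x y \<in> N" using N unfolding closed_def by auto
  define D where "D i = {p \<in> N. \<forall>j. \<forall>m\<in>annihilated N j. act p m \<in> annihilated N (j - Suc i)}" for i
  have D: "subspace (D i)" for i
    using NS(1) subspace_annihilated by (auto simp: D_def subspace_def act_simps)
  have "der br N i \<subseteq> D i" for i
  proof (induction i)
    case 0 show ?case unfolding D_def using act_annihilated by auto
  next
    case (Suc i)
    have "br x y \<in> D (Suc i)" if "x \<in> D i" "y \<in> D i" for x y
    proof -
      have xy: "x \<in> N" "y \<in> N" using that unfolding D_def by auto
      have "act (br x y) m \<in> annihilated N (j - Suc (Suc i))" if m: "m \<in> annihilated N j" for j m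
      proof -
        have mM: "m \<in> M" using m annihilated_subset by blast
        have "act y m \<in> annihilated N (j - Suc i)" using \<open>y \<in> D i\<close> m unfolding D_def by blast
        from act_annihilated[OF xy(1) this] have 1: "act x (act y m) \<in> annihilated N (j - Suc (Suc i))" by simp
        have "act x m \<in> annihilated N (j - Suc i)" using \<open>x \<in> D i\<close> m unfolding D_def by blast
        from act_annihilated[OF xy(2) this] have 2: "act y (act x m) \<in> annihilated N (j - Suc (Suc i))" by simp
        have "act (br x y) m = act x (act y m) - act y (act x m)" using xy NS(2) mM by (intro act_br) auto
        then show ?thesis using subspace_diff[OF subspace_annihilated 1 2] by simp
      qed
      then show ?thesis unfolding D_def using xy NS(3) by blast
    qed
    then have "{br x y |x y. x \<in> der br N i \<and> y \<in> der br N i} \<subseteq> D (Suc i)"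
      using Suc by (auto dest: subsetD)
    then show ?case by (simp add: span_minimal D)
  qed
  from this[of n] have "\<forall>x\<in>der br N n. \<forall>m\<in>M. act x m = 0"
  proof (intro ballI)
    fix x m assume "x \<in> der br N n" "m \<in> M"
    then have "x \<in> D n" "m \<in> annihilated N n" using \<open>der br N n \<subseteq> D n\<close> n by auto
    then have "act x m \<in> annihilated N (n - Suc n)" unfolding D_def by blast
    then show "act x m = 0" by simp
  qed
  then show ?thesis by blast
qed

end

context lie_module
begin

subsection \<open>Cartan's criterion\<close>

text \<open>By the Leibniz rule, \<open>x - (a + c)\<close> applied to \<open>act n m\<close> splits
  into \<open>x - c\<close> applied to \<open>n\<close> and \<open>x - a\<close> applied to
  \<open>m\<close>. Each of the two terms uses up one of the exponents.\<close>

lemma act_shift_funpow: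
  assumes x: "x \<in> S"
  shows "n \<in> S \<Longrightarrow> m \<in> M \<Longrightarrow> (shift (br x) c ^^ i) n = 0 \<Longrightarrow> (shift (act x) a ^^ j) m = 0
    \<Longrightarrow> (shift (act x) (a + c) ^^ (i + j)) (act n m) = 0"
proof (induction i arbitrary: n m j)
  case 0
  then show ?case using lin_0[OF lin_funpow[OF lin_shift[OF act_lin_right]]] by (simp add: act_simps)
next
  case (Suc i)
  note outer = Suc.IH
  from Suc.prems show ?case
  proof (induction j arbitrary: m)
    case 0
    then show ?case using lin_0[OF lin_funpow[OF lin_shift[OF act_lin_right]]]
      by (simp add: act_simps lin_0[OF lin_shift[OF act_lin_right]])
  next
    case (Suc j)
    let ?S = "shift (act x) (a + c)"
    have c1: "shift (br x) c n \<in> S" using S br_closed[OF x] Suc.prems(1) by (intro shift_closed)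
    have c2: "shift (act x) a m \<in> M" using M act_closed[OF x] Suc.prems(2) by (intro shift_closed)
    have "act x (act n m) = act (br x n) m + act n (act x m)"
      using act_br[OF x, of n m] Suc.prems by simp
    then have "?S (act n m) = act (shift (br x) c n) m + act n (shift (act x) a m)"
      by (simp add: shift_def act_simps algebra_simps)
    moreover have "(?S ^^ (i + Suc j)) (act (shift (br x) c n) m) = 0"
      using outer[OF c1 Suc.prems(2) _ Suc.prems(4)] Suc.prems(3) by (simp add: funpow_swap1)
    moreover have "(?S ^^ (Suc i + j)) (act n (shift (act x) a m)) = 0"
      using Suc.IH[OF Suc.prems(1) c2 Suc.prems(3)] Suc.prems(4) by (simp add: funpow_swap1)
    ultimately have "(?S ^^ (i + Suc j)) (?S (act n m)) = 0"
      using lin_add[OF lin_funpow[OF lin_shift[OF act_lin_right]]] by (simp del: funpow.simps)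
    then show ?case by (simp add: funpow_swap1)
  qed
qed

lemma act_gen_eigenspace:
  assumes "x \<in> S" "n \<in> S" "m \<in> M" "n \<in> gen_eigenspace (br x) c" "m \<in> gen_eigenspace (act x) a"
  shows "act n m \<in> gen_eigenspace (act x) (a + c)"
proof -
  obtain i j where "(shift (br x) c ^^ i) n = 0" "(shift (act x) a ^^ j) m = 0"
    using assms(4,5) by (auto simp: gen_eigenspace_def)
  from act_shift_funpow[OF assms(1-3) this] show ?thesis unfolding gen_eigenspace_def by blast
qed

text \<open>If \<open>y\<close> acts on each generalised eigenspace of \<open>x\<close> as a scalar depending additively on the
  eigenvalue, then \<open>ad y\<close> is a scalar on each generalised eigenspace of \<open>ad x\<close>. This is what makes
  \<open>tr ([u, v] y)\<close> a multiple of \<open>tr (u v)\<close>.\<close>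

lemma trace_bracket_diagonal:
  assumes N: "closed N" and tr: "\<And>u v. u \<in> N \<Longrightarrow> v \<in> N \<Longrightarrow> trace_form u v = 0"
    and x: "x \<in> N" and z: "z \<in> span {br u v | u v. u \<in> N \<and> v \<in> N}"
    and y: "lin y" "\<And>m. m \<in> M \<Longrightarrow> y m \<in> M"
      "\<And>a m. m \<in> M \<Longrightarrow> m \<in> gen_eigenspace (act x) a \<Longrightarrow> y m = g a *s m"
    and g: "\<And>a b. g (a + b) = g a + g b"
  shows "trace M (\<lambda>m. act z (y m)) = 0"
proof -
  have NS: "subspace N" "N \<subseteq> S" "\<And>x y. x \<in> N \<Longrightarrow> y \<in> N \<Longrightarrow> br x y \<in> N" using N unfolding closed_def by auto
  have xS: "x \<in> S" using x NS by blast
  define \<Phi> where "\<Phi> z = trace M (\<lambda>m. act z (y m))" for z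
  have add: "\<Phi> (z + z') = \<Phi> z + \<Phi> z'" if "z \<in> S" "z' \<in> S" for z z'
    unfolding \<Phi>_def using trace_act_add[OF y(1,2)] that by blast
  have scale: "\<Phi> (c *s z) = c * \<Phi> z" if "z \<in> S" for c z
    unfolding \<Phi>_def using trace_act_scale[OF y(1,2)] that by blast
  have eig: "\<Phi> (br u v) = 0" if u: "u \<in> N" and v: "v \<in> N" "v \<in> gen_eigenspace (br x) c" for u v c
  proof -
    have uS: "u \<in> S" and vS: "v \<in> S" using u v NS by auto
    note ly = lin_compose[OF act_lin_right y(1)] lin_compose[OF y(1) act_lin_right]
    \<comment> \<open>For \<open>m\<close> with eigenvalue \<open>a\<close>, the vector
      \<open>act v m\<close> has eigenvalue \<open>a + c\<close>; additivity of \<open>g\<close>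
      leaves \<open>[y, v] = g(c) v\<close>.\<close>
    have comm: "y (act v m) - act v (y m) - g c *s act v m = 0" if "m \<in> M" for m
    proof -
      have "y (act v m) - act v (y m) - g c *s act v m \<in> {0}"
      proof (rule lin_span_closed[of "\<lambda>m. y (act v m) - act v (y m) - g c *s act v m"
            "M \<inter> (\<Union>a. gen_eigenspace (act x) a)" "{0}"])
        show "lin (\<lambda>m. y (act v m) - act v (y m) - g c *s act v m)"
          by (intro lin_minus ly lin_smult act_lin_right)
        show "m \<in> span (M \<inter> (\<Union>a. gen_eigenspace (act x) a))"
          using that gen_eigenspaces_span[OF act_lin_right M act_closed[OF xS]] by simp
        fix m' assume "m' \<in> M \<inter> (\<Union>a. gen_eigenspace (act x) a)"
        then obtain a where m': "m' \<in> M" "m' \<in> gen_eigenspace (act x) a" by blast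
        have "y (act v m') = g (a + c) *s act v m'"
          using act_gen_eigenspace[OF xS vS m'(1) v(2) m'(2)] act_closed[OF vS m'(1)] by (rule y(3)[rotated])
        then show "y (act v m') - act v (y m') - g c *s act v m' \<in> {0}"
          using y(3)[OF m'] by (simp add: g act_simps algebra_simps)
      qed simp
      then show ?thesis by simp
    qed
    have "\<Phi> (br u v) = trace M (\<lambda>m. act u (act v (y m)) - act v (act u (y m)))"
      unfolding \<Phi>_def using y uS vS by (intro trace_cong M act_br) auto
    also have "\<dots> = trace M (\<lambda>m. act u (act v (y m))) - trace M (\<lambda>m. act v (act u (y m)))"
      using y uS vS by (intro trace_diff M lin_compose[OF act_lin_right ly(1)]) (auto simp: act_closed)
    \<comment> \<open>Cyclicity moves \<open>v\<close> behind \<open>y\<close>, so that the two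
      traces differ by the commutator of \<open>v\<close> and \<open>y\<close>.\<close>
    also have "trace M (\<lambda>m. act v (act u (y m))) = trace M (\<lambda>m. act u (y (act v m)))"
      using trace_commute[of M "act v" "\<lambda>m. act u (y m)"] M act_lin_right ly(1) y(2) act_closed uS vS by blast
    also have "trace M (\<lambda>m. act u (act v (y m))) - \<dots> = trace M (\<lambda>m. act u (act v (y m)) - act u (y (act v m)))"
      using y uS vS
      by (intro trace_diff[symmetric] M lin_compose[OF act_lin_right ly(1)] lin_compose[OF act_lin_right ly(2)])
        (auto simp: act_closed)
    also have "\<dots> = trace M (\<lambda>m. (- g c) *s act u (act v m))"
    proof (rule trace_cong[OF M])
      fix m assume "m \<in> M"
      then have "act v (y m) - y (act v m) = - (g c *s act v m)" using comm by (simp add: algebra_simps)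
      then have "act u (act v (y m) - y (act v m)) = act u (- (g c *s act v m))" by simp
      then show "act u (act v (y m)) - act u (y (act v m)) = (- g c) *s act u (act v m)"
        by (simp add: act_simps)
    qed
    also have "\<dots> = (- g c) * trace_form u v"
      unfolding trace_form_def using uS vS
      by (intro trace_smult M lin_compose[OF act_lin_right act_lin_right]) (auto simp: act_closed)
    finally show ?thesis using tr[OF u v(1)] by simp
  qed
  have "\<Phi> (br u v) = 0" if u: "u \<in> N" and v: "v \<in> N" for u v
  proof -
    have uS: "u \<in> S" using u NS by blast
    have sp: "span (N \<inter> (\<Union>c. gen_eigenspace (br x) c)) = N"
      by (rule gen_eigenspaces_span[OF br_lin_right NS(1)]) (rule NS(3)[OF x])
    show ?thesis
    proof (rule span_functional_zero[of S "N \<inter> (\<Union>c. gen_eigenspace (br x) c)" "\<lambda>v. \<Phi> (br u v)"])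
      show "\<Phi> (br u (v + v')) = \<Phi> (br u v) + \<Phi> (br u v')" if "v \<in> S" "v' \<in> S" for v v'
        unfolding br_simps using that uS br_closed by (intro add) auto
      show "\<Phi> (br u (c *s v)) = c * \<Phi> (br u v)" if "v \<in> S" for c v
        unfolding br_simps using that uS br_closed by (intro scale) auto
      show "\<Phi> (br u v') = 0" if "v' \<in> N \<inter> (\<Union>c. gen_eigenspace (br x) c)" for v'
        using eig[OF u] that by blast
    qed (use S NS(2) sp v in auto)
  qed
  then have "\<Phi> z = 0"
    using NS br_closed
    by (intro span_functional_zero[OF S _ add scale _ z]) auto
  then show ?thesis unfolding \<Phi>_def .
qed

text \<open>Suppose an eigenvalue of \<open>x\<close> is nonzero and let \<open>f\<close> be a
  rational functional with value 1 there. With \<open>y\<close> multiplying by \<open>f\<close> of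
  the eigenvalue, \<open>tr (x y)\<close> vanishes because \<open>x\<close> is a sum of commutators,
  yet it is the sum of all \<open>f(e) e\<close>. Applying \<open>f\<close> again gives a vanishing
  sum of rational squares, one of which is 1.\<close>

lemma nilpotent_if_trace_form_zero:
  assumes N: "closed N" and tr: "\<And>u v. u \<in> N \<Longrightarrow> v \<in> N \<Longrightarrow> trace_form u v = 0"
    and x: "x \<in> span {br u v | u v. u \<in> N \<and> v \<in> N}" and m: "m \<in> M"
  shows "\<exists>k. (act x ^^ k) m = 0"
proof -
  have NS: "subspace N" "N \<subseteq> S" "\<And>x y. x \<in> N \<Longrightarrow> y \<in> N \<Longrightarrow> br x y \<in> N" using N unfolding closed_def by auto
  have "span {br u v | u v. u \<in> N \<and> v \<in> N} \<subseteq> N" using NS by (intro span_minimal) auto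
  then have xN: "x \<in> N" and xS: "x \<in> S" using x NS(2) by auto
  let ?T = "act x"
  note T = act_lin_right[of x] M act_closed[OF xS]
  obtain B e where B: "independent B" "span B = M" "B \<subseteq> M"
    and e: "\<And>b. b \<in> B \<Longrightarrow> b \<in> gen_eigenspace ?T (e b)"
    using gen_eigenbasis[OF T] by blast
  have fin: "finite B" using B(1) by (rule finiteI_independent)
  obtain s where s: "lin s" "\<And>m. m \<in> M \<Longrightarrow> s m \<in> M"
      "\<And>a m. m \<in> M \<Longrightarrow> m \<in> gen_eigenspace ?T a \<Longrightarrow> s m = a *s m"
    using diagonal_operator[OF T, of "\<lambda>a. a"] by blast
  have "e b = 0" if b: "b \<in> B" for b
  proof (rule ccontr)
    assume "e b \<noteq> 0"
    then obtain f :: "'f \<Rightarrow> rat" where f: "\<And>x y. f (x + y) = f x + f y"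
        "\<And>r x. f (of_rat r * x) = r * f x" "f (e b) = 1"
      using exists_rat_functional[of "e b"] by blast
    define g :: "'f \<Rightarrow> 'f" where "g a = of_rat (f a)" for a
    have g: "g (a + b) = g a + g b" for a b by (simp add: g_def f of_rat_add)
    obtain y where y: "lin y" "\<And>m. m \<in> M \<Longrightarrow> y m \<in> M"
        "\<And>a m. m \<in> M \<Longrightarrow> m \<in> gen_eigenspace ?T a \<Longrightarrow> y m = g a *s m"
      using diagonal_operator[OF T, of g] by blast
    \<comment> \<open>\<open>h\<close> is the nilpotent part of \<open>x\<close> times
      \<open>y\<close>. Its trace vanishes, so \<open>x\<close> may be replaced by its diagonal part
      \<open>s\<close> in \<open>tr (x y)\<close>.\<close>
    define h where "h m = act x (y m) - s (y m)" for m
    have lh: "lin h"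
      unfolding h_def[abs_def] by (intro lin_minus lin_compose[OF act_lin_right y(1)] lin_compose[OF s(1) y(1)])
    have hM: "h m \<in> M" if "m \<in> M" for m
      unfolding h_def using that y s act_closed[OF xS] by (intro subspace_diff M) auto
    have "trace M h = 0"
    proof (rule trace_nilpotent[OF M lh hM])
      have nil: "b \<in> gen_eigenspace h 0" if b: "b \<in> B" for b
      proof -
        define a where "a = e b"
        have hm: "h m = g a *s shift ?T a m" if "m \<in> M" "m \<in> gen_eigenspace ?T a" for m
          unfolding h_def shift_def using that y(3) s(3) lin_scale[OF s(1)]
          by (simp add: act_simps algebra_simps)
        have "(h ^^ k) b = g a ^ k *s (shift ?T a ^^ k) b \<and> (shift ?T a ^^ k) b \<in> M
           \<and> (shift ?T a ^^ k) b \<in> gen_eigenspace ?T a" for k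
        proof (induction k)
          case 0 then show ?case using b B e unfolding a_def by auto
        next
          case (Suc k)
          then have "(h ^^ Suc k) b = g a ^ k *s h ((shift ?T a ^^ k) b)" by (simp add: lin_scale[OF lh])
          also have "\<dots> = g a ^ Suc k *s (shift ?T a ^^ Suc k) b" using hm Suc by (simp add: ac_simps)
          finally show ?case
            using Suc shift_closed[OF M, of ?T] act_closed[OF xS] gen_eigenspace_shift_closed[OF act_lin_right]
            by simp
        qed
        moreover obtain k where "(shift ?T a ^^ k) b = 0" using e[OF b] unfolding gen_eigenspace_def a_def by blast
        ultimately have "(h ^^ k) b = 0" by (metis scale_zero_right)
        then show ?thesis unfolding gen_eigenspace_0_iff by blast
      qed
      then have "span B \<subseteq> gen_eigenspace h 0" by (intro span_minimal subspace_gen_eigenspace lh) auto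
      then show "\<exists>n. (h ^^ n) w = 0" if "w \<in> M" for w using B(2) that unfolding gen_eigenspace_0_iff[symmetric] by blast
    qed
    moreover have "trace M h = trace M (\<lambda>m. act x (y m)) - trace M (\<lambda>m. s (y m))"
      unfolding h_def[abs_def] using y s act_closed[OF xS]
      by (intro trace_diff M lin_compose[OF act_lin_right y(1)] lin_compose[OF s(1) y(1)]) auto
    moreover have "trace M (\<lambda>m. act x (y m)) = 0"
      using trace_bracket_diagonal[OF N tr xN x y g] by blast
    moreover have "trace M (\<lambda>m. s (y m)) = (\<Sum>b\<in>B. g (e b) * e b)"
    proof -
      have "trace M (\<lambda>m. s (y m)) = (\<Sum>b\<in>B. representation B (s (y b)) b)"
        using B y s by (intro trace_basis lin_compose[OF s(1) y(1)]) auto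
      also have "\<dots> = (\<Sum>b\<in>B. g (e b) * e b)"
      proof (rule sum.cong[OF refl])
        fix b assume b: "b \<in> B"
        then have bM: "b \<in> M" using B by blast
        have "s (y b) = (g (e b) * e b) *s b"
          using y(3)[OF bM e[OF b]] s(3)[OF bM e[OF b]] lin_scale[OF s(1)] by simp
        then show "representation B (s (y b)) b = g (e b) * e b"
          using representation_scale[OF B(1) span_base[OF b]] representation_basis[OF B(1) b] by simp
      qed
      finally show ?thesis .
    qed
    ultimately have zero: "(\<Sum>b\<in>B. of_rat (f (e b)) * e b) = 0" by (simp add: g_def)
    have f0: "f 0 = 0" using f(1)[of 0 0] by simp
    have "f (\<Sum>b\<in>A. of_rat (f (e b)) * e b) = (\<Sum>b\<in>A. f (e b) * f (e b))" if "finite A" for A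
      using that by (induction A rule: finite_induct) (simp_all add: f0 f(1,2))
    from this[OF fin] have "(\<Sum>b\<in>B. f (e b) * f (e b)) = 0" using zero f0 by simp
    then have "f (e b) * f (e b) = 0" using fin b by (simp add: sum_nonneg_eq_0_iff)
    then show False using f(3) by simp
  qed
  then have "B \<subseteq> gen_eigenspace ?T 0" using e by (metis subsetI)
  then have "span B \<subseteq> gen_eigenspace ?T 0" by (intro span_minimal subspace_gen_eigenspace act_lin_right)
  then show ?thesis using m B(2) unfolding gen_eigenspace_0_iff[symmetric] by blast
qed

lemma closed_derived: "closed N \<Longrightarrow> closed (span {br u v | u v. u \<in> N \<and> v \<in> N})"
  (is "_ \<Longrightarrow> closed (span ?X)")
proof -
  assume N: "closed N"
  have sub: "span ?X \<subseteq> N" using N unfolding closed_def by (intro span_minimal) auto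
  then have "br x y \<in> span ?X" if "x \<in> span ?X" "y \<in> span ?X" for x y
    using that by (intro span_base) blast
  with sub N show ?thesis unfolding closed_def by auto
qed

text \<open>The trace condition makes commutators act nilpotently, so Engel is applied to the
  derived subalgebra, whose derived series is that of \<open>N\<close> shifted by one.\<close>

theorem cartan:
  assumes N: "closed N" and tr: "\<And>u v. u \<in> N \<Longrightarrow> v \<in> N \<Longrightarrow> trace_form u v = 0"
  shows "\<exists>k. \<forall>x\<in>der br N k. \<forall>m\<in>M. act x m = 0"
proof -
  let ?D = "span {br u v | u v. u \<in> N \<and> v \<in> N}"
  have "\<exists>k. \<forall>x\<in>der br ?D k. \<forall>m\<in>M. act x m = 0"
    by (rule engel_derived[OF closed_derived[OF N] nilpotent_if_trace_form_zero[OF N tr]])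
  moreover have "der br ?D k = der br N (Suc k)" for k by (induction k) simp_all
  ultimately show ?thesis by metis
qed

end

sublocale lie_on \<subseteq> adj: lie_module scale Basis S br S br
  by unfold_locales (simp_all add: S br_simps br_closed br_br)

section \<open>Ideals of an algebra with nondegenerate Killing form\<close>

context lie_on
begin

definition br_ideal :: "'v set \<Rightarrow> bool" where
  "br_ideal A \<longleftrightarrow> subspace A \<and> A \<subseteq> S \<and> (\<forall>x\<in>S. \<forall>y\<in>A. br x y \<in> A)"

abbreviation killing :: "'v \<Rightarrow> 'v \<Rightarrow> 'f" where
  "killing \<equiv> adj.trace_form"

text \<open>The working form of semisimplicity: the absence of solvable ideals follows from it
  (\<open>solvable_ideal_zero\<close>), and so do the dual bases behind Whitehead's lemma.\<close>

definition nondegenerate :: bool where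
  "nondegenerate \<longleftrightarrow> (\<forall>x\<in>S. (\<forall>y\<in>S. killing x y = 0) \<longrightarrow> x = 0)"

lemma br_ideal_closed: "br_ideal A \<Longrightarrow> closed A"
  unfolding br_ideal_def closed_def by blast

lemma br_ideal_right:
  assumes "br_ideal A" "a \<in> A" "x \<in> S"
  shows "br a x \<in> A"
proof -
  have "br a x = - br x a" using assms by (intro br_skew) (auto simp: br_ideal_def)
  then show ?thesis using assms by (simp add: br_ideal_def subspace_neg)
qed

lemma br_ideal_der: "br_ideal A \<Longrightarrow> br_ideal (der br A k) \<and> der br A k \<subseteq> A"
proof (induction k)
  case (Suc k)
  let ?D = "der br A k" and ?X = "{br x y | x y. x \<in> der br A k \<and> y \<in> der br A k}"
  have D: "br_ideal ?D" "?D \<subseteq> A" "?D \<subseteq> S" using Suc by (auto simp: br_ideal_def)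
  have sub: "span ?X \<subseteq> ?D" using D(1) by (intro span_minimal) (auto simp: br_ideal_def)
  have "br x y \<in> span ?X" if x: "x \<in> S" and y: "y \<in> span ?X" for x y
  proof (rule lin_span_closed[OF br_lin_right _ subspace_span y])
    fix y assume "y \<in> ?X"
    then obtain u v where uv: "u \<in> ?D" "v \<in> ?D" "y = br u v" by blast
    have "br x y = br (br x u) v + br u (br x v)"
    proof -
      have "u \<in> S" "v \<in> S" using uv D(3) by auto
      then show ?thesis using br_br[of x u v] x unfolding uv(3) by simp
    qed
    moreover have "br x u \<in> ?D" "br x v \<in> ?D" using uv x D(1) unfolding br_ideal_def by blast+
    then have "br (br x u) v \<in> ?X" "br u (br x v) \<in> ?X" using uv(1,2) by blast+
    then have "br (br x u) v \<in> span ?X" "br u (br x v) \<in> span ?X" by (simp_all only: span_base)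
    ultimately show "br x y \<in> span ?X" by (simp add: span_add)
  qed
  with sub D show ?case unfolding br_ideal_def by auto
qed (simp add: br_ideal_def)

text \<open>For \<open>a\<close> in \<open>A\<close> the operator \<open>ad a ad y\<close> maps into
  \<open>A\<close>, and applied twice it ends with a bracket of \<open>a\<close> with an element of
  \<open>A\<close>. Its square is zero, so its trace vanishes.\<close>

lemma abelian_ideal_zero:
  assumes nd: nondegenerate and A: "br_ideal A" and ab: "\<And>a b. a \<in> A \<Longrightarrow> b \<in> A \<Longrightarrow> br a b = 0"
  shows "A = {0}"
proof -
  have AS: "A \<subseteq> S" "subspace A" using A by (auto simp: br_ideal_def)
  have "a = 0" if a: "a \<in> A" for a
  proof -
    have aS: "a \<in> S" using a AS by blast
    have "killing a y = 0" if y: "y \<in> S" for y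
      unfolding adj.trace_form_def
    proof (rule trace_nilpotent[OF S lin_compose[OF br_lin_right br_lin_right]])
      fix w assume w: "w \<in> S"
      show "br a (br y w) \<in> S" using w y aS by (intro br_closed)
      have "br a (br y w) \<in> A" using w y a A by (intro br_ideal_right br_closed)
      then have "br y (br a (br y w)) \<in> A" using A y unfolding br_ideal_def by blast
      then have "br a (br y (br a (br y w))) = 0" by (rule ab[OF a])
      then have "((\<lambda>m. br a (br y m)) ^^ 2) w = 0" by (simp add: numeral_2_eq_2)
      then show "\<exists>n. ((\<lambda>m. br a (br y m)) ^^ n) w = 0" ..
    qed
    with nd aS show ?thesis unfolding nondegenerate_def by blast
  qed
  then show ?thesis using AS subspace_0 by blast
qed

text \<open>The last nonzero term of the derived series would be an abelian ideal.\<close>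

lemma solvable_ideal_zero:
  assumes nd: nondegenerate and A: "br_ideal A" and k: "der br A k = {0}"
  shows "A = {0}"
  using k
proof (induction k)
  case (Suc k)
  have "br a b = 0" if "a \<in> der br A k" "b \<in> der br A k" for a b
  proof -
    have "br a b \<in> der br A (Suc k)" using that by (auto intro: span_base)
    then show ?thesis using Suc.prems by blast
  qed
  then have "der br A k = {0}" using br_ideal_der[OF A] abelian_ideal_zero[OF nd] by blast
  then show ?case by (rule Suc.IH)
qed simp

lemma br_ideal_killing_radical: "br_ideal {x \<in> S. \<forall>y\<in>S. killing x y = 0}" (is "br_ideal ?T")
  unfolding br_ideal_def
proof (intro conjI ballI)
  show "subspace ?T"
    using S adj.trace_form_scale_left[of 0 _]
    by (auto simp: subspace_def adj.trace_form_add_left adj.trace_form_scale_left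
        intro: adj.trace_form_scale_left[of 0 _ 0, simplified])
  fix x y assume x: "x \<in> S" and y: "y \<in> ?T"
  have "killing (br x y) z = 0" if z: "z \<in> S" for z
  proof -
    have "br x y = br y (- x)" using br_skew[of x y] x y by (simp add: br_simps)
    then have "killing (br x y) z = killing y (br (- x) z)"
      using adj.trace_form_invariant[of y "- x" z] x y z S by (simp add: subspace_neg)
    then show ?thesis using y br_closed[of "- x" z] x z S by (simp add: subspace_neg)
  qed
  then show "br x y \<in> ?T" using x y br_closed by auto
qed auto

text \<open>Cartan's criterion for the adjoint action gives a derived term that brackets everything
  to zero; its own derived term is zero.\<close>

lemma killing_radical_solvable: "\<exists>k. der br {x \<in> S. \<forall>y\<in>S. killing x y = 0} k = {0}"
proof -
  let ?T = "{x \<in> S. \<forall>y\<in>S. killing x y = 0}"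
  note I = br_ideal_killing_radical
  obtain k where k: "\<forall>x\<in>der br ?T k. \<forall>m\<in>S. br x m = 0"
    using adj.cartan[OF br_ideal_closed[OF I]] by auto
  have "subspace (der br ?T k)" "der br ?T k \<subseteq> S" using br_ideal_der[OF I, of k] by (auto simp: br_ideal_def)
  then have "{br x y |x y. x \<in> der br ?T k \<and> y \<in> der br ?T k} \<subseteq> {0}" using k by auto
  then have "der br ?T (Suc k) \<subseteq> {0}" by (simp only: der.simps span_minimal subspace_single_0)
  then have "der br ?T (Suc k) = {0}" using span_zero by (auto simp only: der.simps)
  then show ?thesis by blast
qed

end

subsection \<open>Dual bases of an invariant form\<close>

locale dual_bases = ac_space scale Basis
  for scale :: "'f::{alg_closed_field, field_char_0} \<Rightarrow> 'v::ab_group_add \<Rightarrow> 'v" (infixr "*s" 75)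
    and Basis +
  fixes I :: "'v set" and \<beta> :: "'v \<Rightarrow> 'v \<Rightarrow> 'f" and B :: "'v set" and d :: "'v \<Rightarrow> 'v"
  assumes I: "subspace I"
    and form_add: "x \<in> I \<Longrightarrow> y \<in> I \<Longrightarrow> z \<in> I \<Longrightarrow> \<beta> (x + y) z = \<beta> x z + \<beta> y z"
    and form_scale: "x \<in> I \<Longrightarrow> z \<in> I \<Longrightarrow> \<beta> (a *s x) z = a * \<beta> x z"
    and form_sym: "x \<in> I \<Longrightarrow> y \<in> I \<Longrightarrow> \<beta> x y = \<beta> y x"
    and form_nondeg: "x \<in> I \<Longrightarrow> (\<And>y. y \<in> I \<Longrightarrow> \<beta> x y = 0) \<Longrightarrow> x = 0"
    and B: "independent B" "span B = I"
    and d: "b \<in> B \<Longrightarrow> d b \<in> I"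
    and dual: "b \<in> B \<Longrightarrow> c \<in> B \<Longrightarrow> \<beta> c (d b) = (if b = c then 1 else 0)"
begin

lemma finite_B: "finite B"
  using B(1) by (rule finiteI_independent)

lemma B_I: "b \<in> B \<Longrightarrow> b \<in> I"
  using B(2) span_base by blast

lemma form_sum:
  assumes "finite X" "\<And>i. i \<in> X \<Longrightarrow> u i \<in> I" "w \<in> I"
  shows "\<beta> (\<Sum>i\<in>X. u i) w = (\<Sum>i\<in>X. \<beta> (u i) w)"
  using assms
proof (induction X rule: finite_induct)
  case empty
  then show ?case using form_scale[of w w 0] by simp
next
  case (insert i X)
  then show ?case using I by (simp add: form_add subspace_sum)
qed

lemma representation_eq_form:
  assumes v: "v \<in> I" and c: "c \<in> B"
  shows "representation B v c = \<beta> v (d c)"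
proof -
  have "\<beta> v (d c) = \<beta> (\<Sum>b\<in>B. representation B v b *s b) (d c)"
    using basis_expand[OF B(1), of v] B(2) v by simp
  also have "\<dots> = (\<Sum>b\<in>B. representation B v b * \<beta> b (d c))"
    using c B_I d I by (subst form_sum[OF finite_B]) (auto simp: form_scale subspace_scale)
  also have "\<dots> = (\<Sum>b\<in>B. if b = c then representation B v b else 0)"
    using c dual by (intro sum.cong) auto
  finally show ?thesis using c finite_B by simp
qed

lemma expand: "v \<in> I \<Longrightarrow> (\<Sum>b\<in>B. \<beta> v (d b) *s b) = v"
  using basis_expand[OF B(1), of v] B(2) representation_eq_form[of v] by simp

lemma expand_dual:
  assumes v: "v \<in> I"
  shows "(\<Sum>b\<in>B. \<beta> b v *s d b) = v"
proof -
  let ?u = "(\<Sum>b\<in>B. \<beta> b v *s d b)"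
  have u: "?u \<in> I" using I d by (intro subspace_sum subspace_scale)
  have neg: "\<beta> (- v) z = - \<beta> v z" if "z \<in> I" for z
    using form_scale[OF v that, of "-1"] by simp
  have "\<beta> (?u + - v) z = 0" if z: "z \<in> I" for z
  proof -
    have "\<beta> ?u z = (\<Sum>b\<in>B. \<beta> b v * \<beta> z (d b))"
      using z d I form_sym[OF z d] by (subst form_sum[OF finite_B]) (auto simp: form_scale subspace_scale)
    also have "\<dots> = \<beta> (\<Sum>b\<in>B. \<beta> z (d b) *s b) v"
      using v B_I I by (subst form_sum[OF finite_B]) (auto simp: form_scale subspace_scale mult.commute)
    also have "\<dots> = \<beta> v z" using expand[OF z] form_sym[OF z v] by simp
    finally show ?thesis using form_add[OF u subspace_neg[OF I v] z] neg[OF z] by simp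
  qed
  then have "?u + - v = 0" by (rule form_nondeg[OF subspace_add[OF I u subspace_neg[OF I v]]])
  then show ?thesis by simp
qed

text \<open>The tensor that sums \<open>b \<otimes> d b\<close> is symmetric because the form is. A
  bilinear \<open>F\<close> expresses this without tensor products.\<close>

lemma swap:
  assumes F: "\<And>w. lin (\<lambda>u. F u w)" "\<And>u. lin (F u)"
  shows "(\<Sum>b\<in>B. F b (d b)) = (\<Sum>b\<in>B. F (d b) b)"
proof -
  have "F (d b) b = (\<Sum>c\<in>B. \<beta> (d b) (d c) *s F c b)" if "b \<in> B" for b
    using arg_cong[OF expand[OF d[OF that]], of "\<lambda>u. F u b"] by (simp add: lin_sum[OF F(1)] lin_scale[OF F(1)])
  moreover have "F c (d c) = (\<Sum>b\<in>B. \<beta> (d c) (d b) *s F c b)" if "c \<in> B" for c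
    using arg_cong[OF expand[OF d[OF that]], of "F c"] by (simp add: lin_sum[OF F(2)] lin_scale[OF F(2)])
  moreover have "(\<Sum>c\<in>B. \<Sum>b\<in>B. \<beta> (d c) (d b) *s F c b) = (\<Sum>c\<in>B. \<Sum>b\<in>B. \<beta> (d b) (d c) *s F c b)"
    using d form_sym by (intro sum.cong refl) auto
  moreover have "\<dots> = (\<Sum>b\<in>B. \<Sum>c\<in>B. \<beta> (d b) (d c) *s F c b)" by (rule sum.swap)
  ultimately show ?thesis by simp
qed

text \<open>A skew \<open>D\<close> annihilates the same tensor: the coefficients of
  \<open>D b\<close> in the basis and those of \<open>D (d c)\<close> in the dual basis are
  negatives of each other.\<close>

lemma invariance:
  assumes F: "\<And>w. lin (\<lambda>u. F u w)" "\<And>u. lin (F u)"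
    and D: "\<And>u. u \<in> I \<Longrightarrow> D u \<in> I" "\<And>u v. u \<in> I \<Longrightarrow> v \<in> I \<Longrightarrow> \<beta> (D u) v = - \<beta> u (D v)"
  shows "(\<Sum>b\<in>B. F (D b) (d b)) = - (\<Sum>b\<in>B. F b (D (d b)))"
proof -
  have "F (D b) (d b) = (\<Sum>c\<in>B. \<beta> (D b) (d c) *s F c (d b))" if "b \<in> B" for b
    using arg_cong[OF expand[OF D(1)[OF B_I[OF that]]], of "\<lambda>u. F u (d b)"]
    by (simp add: lin_sum[OF F(1)] lin_scale[OF F(1)])
  moreover have "F c (D (d c)) = (\<Sum>b\<in>B. - \<beta> (D b) (d c) *s F c (d b))" if c: "c \<in> B" for c
  proof -
    have "F c (D (d c)) = (\<Sum>b\<in>B. \<beta> b (D (d c)) *s F c (d b))"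
      using arg_cong[OF expand_dual[OF D(1)[OF d[OF c]]], of "F c"] by (simp add: lin_sum[OF F(2)] lin_scale[OF F(2)])
    then show ?thesis using D(2)[OF B_I d[OF c]] by simp
  qed
  moreover have "(\<Sum>b\<in>B. \<Sum>c\<in>B. \<beta> (D b) (d c) *s F c (d b)) = (\<Sum>c\<in>B. \<Sum>b\<in>B. \<beta> (D b) (d c) *s F c (d b))"
    by (rule sum.swap)
  ultimately show ?thesis by (simp add: sum_negf)
qed

end

context ac_space
begin

text \<open>\<open>g x\<close> has as coordinates in \<open>B\<close> the values of the form at
  \<open>x\<close>. Nondegeneracy makes \<open>g\<close> injective on \<open>I\<close>, hence onto
  for reasons of dimension, and the dual basis consists of the preimages of
  \<open>B\<close>.\<close>

lemma exists_dual_bases: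
  assumes I: "subspace I"
    and form_add: "\<And>x y z. x \<in> I \<Longrightarrow> y \<in> I \<Longrightarrow> z \<in> I \<Longrightarrow> \<beta> (x + y) z = \<beta> x z + (\<beta> y z :: 'f)"
    and form_scale: "\<And>c x z. x \<in> I \<Longrightarrow> z \<in> I \<Longrightarrow> \<beta> (c *s x) z = c * \<beta> x z"
    and form_sym: "\<And>x y. x \<in> I \<Longrightarrow> y \<in> I \<Longrightarrow> \<beta> x y = \<beta> y x"
    and form_nondeg: "\<And>x. x \<in> I \<Longrightarrow> (\<And>y. y \<in> I \<Longrightarrow> \<beta> x y = 0) \<Longrightarrow> x = 0"
  shows "\<exists>B d. dual_bases scale Basis I \<beta> B d"
proof -
  obtain B where B: "B \<subseteq> I" "independent B" "span B = I" using subspace_basis[OF I] by blast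
  have fin: "finite B" using B(2) by (rule finiteI_independent)
  obtain g where g: "lin g" "\<And>b. b \<in> B \<Longrightarrow> g b = (\<Sum>c\<in>B. \<beta> c b *s c)"
    using endo.linear_independent_extend[OF B(2), of "\<lambda>b. \<Sum>c\<in>B. \<beta> c b *s c"] by blast
  have gI: "g x \<in> I" if "x \<in> I" for x
    by (rule lin_span_closed[OF g(1) _ I, of B]) (use that B g(2) I in \<open>auto intro!: subspace_sum subspace_scale\<close>)
  have rep: "representation B (g x) c = \<beta> c x" if c: "c \<in> B" and x: "x \<in> I" for c x
  proof -
    have cI: "c \<in> I" using c B by blast
    have spg: "g y \<in> span B" if "y \<in> I" for y using gI[OF that] B(3) by simp
    have "representation B (g x) c - \<beta> x c = 0"
    proof (rule span_functional_zero[of I B "\<lambda>x. representation B (g x) c - \<beta> x c"])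
      show "representation B (g (x + y)) c - \<beta> (x + y) c
          = (representation B (g x) c - \<beta> x c) + (representation B (g y) c - \<beta> y c)" if "x \<in> I" "y \<in> I" for x y
        using that spg form_add[OF that cI] by (simp add: lin_add[OF g(1)] representation_add[OF B(2)])
      show "representation B (g (a *s x)) c - \<beta> (a *s x) c = a * (representation B (g x) c - \<beta> x c)" if "x \<in> I" for a x
        using that spg form_scale[OF that cI]
        by (simp add: lin_scale[OF g(1)] representation_scale[OF B(2)] algebra_simps)
      show "representation B (g b) c - \<beta> b c = 0" if b: "b \<in> B" for b
      proof -
        have "representation B (g b) c = (\<Sum>c'\<in>B. \<beta> c' b * representation B c' c)"
          unfolding g(2)[OF b] by (rule representation_lin_sum[OF B(2) span_base])
        also have "\<dots> = (\<Sum>c'\<in>B. if c' = c then \<beta> c' b else 0)"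
          using B(2) by (intro sum.cong) (auto simp: representation_basis)
        also have "\<dots> = \<beta> c b" using c fin by simp
        finally show ?thesis using form_sym[of b c] b cI B(1) by auto
      qed
    qed (use I B x in auto)
    then show ?thesis using form_sym[OF cI x] by simp
  qed
  have "inj_on g I"
    unfolding endo.linear_inj_on_iff_eq_0[OF g(1) I]
  proof (intro ballI impI)
    fix x assume x: "x \<in> I" and "g x = 0"
    then have B0: "\<beta> c x = 0" if "c \<in> B" for c using rep[OF that x] by (simp add: representation_zero)
    have "\<beta> y x = 0" if "y \<in> I" for y
      by (rule span_functional_zero[of I B "\<lambda>y. \<beta> y x"]) (use that x I B B0 form_add form_scale in auto)
    then show "x = 0" using x form_sym by (intro form_nondeg) auto
  qed
  then have "dim (g ` I) = dim I" using I by (intro endo.dim_image_eq[OF g(1)]) (simp add: span_eq_iff[THEN iffD2])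
  then have "g ` I = I"
    using gI by (intro subspace_dim_equal subspace_lin_image g(1) I) auto
  then have "\<forall>b\<in>B. \<exists>x\<in>I. g x = b" using B(1) by (metis imageE subsetD)
  then obtain d where d: "\<forall>b\<in>B. d b \<in> I \<and> g (d b) = b" by (metis bchoice)
  have "dual_bases scale Basis I \<beta> B d"
  proof unfold_locales
    show "\<beta> c (d b) = (if b = c then 1 else 0)" if "b \<in> B" "c \<in> B" for b c
      using rep[of c "d b"] that d representation_basis[OF B(2) that(1)] by auto
  qed (use assms B d in auto)
  then show ?thesis by blast
qed

text \<open>\<open>q\<close> chooses representatives modulo \<open>U\<close> linearly. Images under
  \<open>q\<close> model quotient modules; they may fail to be submodules, so the action there is
  followed by \<open>q\<close>.\<close>

lemma exists_projection:
  assumes "subspace U"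
  shows "\<exists>q. lin q \<and> (\<forall>x. x - q x \<in> U) \<and> (\<forall>x\<in>U. q x = 0)"
proof -
  obtain B where B: "independent B" "span B = U" using subspace_basis[OF assms] by blast
  let ?C = "extend_basis B"
  have C: "independent ?C" "span ?C = UNIV" "B \<subseteq> ?C"
    using B independent_extend_basis span_extend_basis extend_basis_superset by auto
  obtain q where q: "lin q" "\<And>c. c \<in> ?C \<Longrightarrow> q c = (if c \<in> B then 0 else c)"
    using endo.linear_independent_extend[OF C(1), of "\<lambda>c. if c \<in> B then 0 else c"] by blast
  have "x - q x \<in> U" for x
  proof (rule lin_span_closed[OF lin_minus[OF lin_id q(1)], of ?C U])
    show "c - q c \<in> U" if "c \<in> ?C" for c
      using q(2)[OF that] B(2) span_base assms subspace_0 by auto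
  qed (use assms C in auto)
  moreover have "q x \<in> {0}" if "x \<in> U" for x
    by (rule lin_span_closed[OF q(1), of B "{0}"]) (use that q(2) B(2) C in auto)
  ultimately show ?thesis using q(1) by blast
qed

end

context lie_on
begin

subsection \<open>Whitehead's second lemma\<close>

text \<open>The Chevalley-Eilenberg condition in cyclic form: skewness turns the usual
  \<open>- f([y, z], x)\<close> into \<open>+ f(x, [y, z])\<close>.\<close>

definition cocycle :: "'v set \<Rightarrow> ('v \<Rightarrow> 'v \<Rightarrow> 'v) \<Rightarrow> ('v \<Rightarrow> 'v \<Rightarrow> 'v) \<Rightarrow> bool" where
  "cocycle M act f \<longleftrightarrow> (\<forall>y. lin (\<lambda>x. f x y)) \<and> (\<forall>x. lin (f x)) \<and>
     (\<forall>x\<in>S. \<forall>y\<in>S. f x y \<in> M) \<and> (\<forall>x\<in>S. f x x = 0) \<and>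
     (\<forall>x\<in>S. \<forall>y\<in>S. \<forall>z\<in>S. act x (f y z) + act y (f z x) + act z (f x y)
        + f x (br y z) + f y (br z x) + f z (br x y) = 0)"

definition coboundary :: "'v set \<Rightarrow> ('v \<Rightarrow> 'v \<Rightarrow> 'v) \<Rightarrow> ('v \<Rightarrow> 'v \<Rightarrow> 'v) \<Rightarrow> bool" where
  "coboundary M act f \<longleftrightarrow> (\<exists>\<phi>. lin \<phi> \<and> (\<forall>x\<in>S. \<phi> x \<in> M) \<and>
     (\<forall>x\<in>S. \<forall>y\<in>S. f x y = act x (\<phi> y) - act y (\<phi> x) - \<phi> (br x y)))"

lemma killing_dual_bases:
  assumes nondegenerate
  obtains B d where "dual_bases scale Basis S killing B d"
  using exists_dual_bases[OF S adj.trace_form_add_left adj.trace_form_scale_left adj.trace_form_commute] assms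
  unfolding nondegenerate_def by blast

text \<open>Paired with \<open>y\<close>, the sum collects the diagonal entries of
  \<open>ad y ad v\<close>, so the result is the Killing form of \<open>y\<close> and
  \<open>v\<close>. The Casimir operator is thus exactly the identity on the adjoint module.\<close>

lemma killing_casimir:
  assumes nd: nondegenerate and db: "dual_bases scale Basis S killing B d" and v: "v \<in> S"
  shows "(\<Sum>b\<in>B. br (d b) (br b v)) = v"
proof -
  interpret db: dual_bases scale Basis S killing B d by (rule db)
  let ?u = "\<Sum>b\<in>B. br (d b) (br b v)"
  have mem: "br (d b) (br b v) \<in> S" if "b \<in> B" for b
    using db.d[OF that] db.B_I[OF that] v by (intro br_closed)
  have u: "?u \<in> S" using S mem by (intro subspace_sum)
  have "killing ?u y = killing v y" if y: "y \<in> S" for y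
  proof -
    note l = lin_compose[OF br_lin_right br_lin_right]
    have "killing (br (d b) (br b v)) y = representation B (br y (br v b)) b" if b: "b \<in> B" for b
    proof -
      note S1 = db.d[OF b] db.B_I[OF b]
      have yv: "br y (br v b) \<in> S" using S1 y v by (intro br_closed)
      have "br (br b v) y = br y (br v b)"
        using br_skew[OF br_closed[OF S1(2) v] y] br_skew[OF S1(2) v] by (simp add: br_simps)
      then have "killing (br (d b) (br b v)) y = killing (d b) (br y (br v b))"
        using adj.trace_form_invariant[of "d b" "br b v" y] br_closed S1 y v by simp
      also have "\<dots> = killing (br y (br v b)) (d b)"
        using S1 yv by (intro adj.trace_form_commute)
      also have "\<dots> = representation B (br y (br v b)) b"
        using db.representation_eq_form[OF yv b] by simp
      finally show ?thesis .
    qed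
    then have "killing ?u y = (\<Sum>b\<in>B. representation B (br y (br v b)) b)"
      using db.form_sum[OF db.finite_B mem y] by simp
    also have "\<dots> = killing y v"
      unfolding adj.trace_form_def using db.B y v br_closed
      by (intro trace_basis[symmetric] l) auto
    also have "\<dots> = killing v y" using y v by (rule adj.trace_form_commute)
    finally show ?thesis .
  qed
  then have "killing (?u + (- 1) *s v) y = 0" if "y \<in> S" for y
    using adj.trace_form_add_left[OF u subspace_scale[OF S v] that, of "- 1"]
      adj.trace_form_scale_left[OF v that, of "- 1"] that by simp
  moreover have "?u + (- 1) *s v \<in> S" by (rule subspace_add[OF S u subspace_scale[OF S v]])
  ultimately have "?u + (- 1) *s v = 0" using nd unfolding nondegenerate_def by blast
  then show ?thesis by (simp add: add_eq_0_iff2)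
qed

text \<open>A Casimir operator of \<open>M\<close> would be zero here. That of the adjoint module
  takes its place: it is the identity by \<open>killing_casimir\<close>, and it is applied inside an
  argument of \<open>f\<close>.\<close>

lemma coboundary_if_trivial:
  assumes nd: nondegenerate and triv: "\<And>x m. x \<in> S \<Longrightarrow> m \<in> M \<Longrightarrow> act x m = 0"
    and M: "subspace M" and f: "cocycle M act f"
  shows "coboundary M act f"
proof -
  obtain B d where db: "dual_bases scale Basis S killing B d" using killing_dual_bases[OF nd] .
  interpret db: dual_bases scale Basis S killing B d by (rule db)
  have fl: "\<And>y. lin (\<lambda>x. f x y)" "\<And>x. lin (f x)" and fM: "\<And>x y. x \<in> S \<Longrightarrow> y \<in> S \<Longrightarrow> f x y \<in> M"
    and falt: "\<And>x. x \<in> S \<Longrightarrow> f x x = 0"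
    using f unfolding cocycle_def by auto
  note f_simps = lin_add[OF fl(1)] lin_add[OF fl(2)] lin_neg[OF fl(1)] lin_neg[OF fl(2)] lin_0[OF fl(2)]
  have fc: "f x (br y z) = - f y (br z x) - f z (br x y)" if "x \<in> S" "y \<in> S" "z \<in> S" for x y z
  proof -
    have "act x (f y z) + act y (f z x) + act z (f x y)
        + f x (br y z) + f y (br z x) + f z (br x y) = 0"
      using f that unfolding cocycle_def by blast
    then show ?thesis using triv fM that by (simp add: algebra_simps add_eq_0_iff2)
  qed
  have fskew: "f x y = - f y x" if "x \<in> S" "y \<in> S" for x y
    using falt[of "x + y"] falt[of x] falt[of y] that S
    by (simp add: f_simps subspace_add add_eq_0_iff2)
  note dS = db.d and BS = db.B_I
  \<comment> \<open>\<open>f\<close> is a 1-cocycle with values in the coadjoint module; this is its contraction with the Casimir element.\<close>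
  define \<phi> where "\<phi> v = (\<Sum>b\<in>B. f (d b) (br b v))" for v
  have l\<phi>: "lin \<phi>"
    unfolding \<phi>_def[abs_def] by (intro lin_sum_fun lin_compose[OF fl(2) br_lin_right])
  have "\<phi> (br v w) = f v w" if v: "v \<in> S" and w: "w \<in> S" for v w
  proof -
    \<comment> \<open>The Jacobi and cocycle identities turn \<open>\<phi> [v, w]\<close> into
      \<open>f v w - Y + X\<close>; symmetry and invariance of the dual bases identify the two
      remainders.\<close>
    define X where "X = (\<Sum>b\<in>B. f (d b) (br v (br b w)))"
    define Y where "Y = (\<Sum>b\<in>B. f (br b w) (br (d b) v))"
    have "\<phi> (br v w) = (\<Sum>b\<in>B. f (d b) (br (br b v) w)) + X"
      unfolding \<phi>_def X_def sum.distrib[symmetric]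
    proof (rule sum.cong[OF refl])
      fix b assume b: "b \<in> B"
      have "br b (br v w) = br (br b v) w + br v (br b w)" using br_br[OF BS[OF b] v w] by simp
      then show "f (d b) (br b (br v w)) = f (d b) (br (br b v) w) + f (d b) (br v (br b w))"
        by (simp add: f_simps)
    qed
    moreover have "(\<Sum>b\<in>B. f (d b) (br (br b v) w)) = f v w - Y"
    proof -
      have "f (d b) (br (br b v) w) = f (br b v) (br (d b) w) - f w (br (d b) (br b v))" if b: "b \<in> B" for b
        using fc[OF dS[OF b] br_closed[OF BS[OF b] v] w] br_skew[OF w dS[OF b]]
        by (simp add: f_simps)
      then have "(\<Sum>b\<in>B. f (d b) (br (br b v) w))
          = (\<Sum>b\<in>B. f (br b v) (br (d b) w)) - f w (\<Sum>b\<in>B. br (d b) (br b v))"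
        by (simp add: sum_subtractf lin_sum[OF fl(2)])
      also have "f w (\<Sum>b\<in>B. br (d b) (br b v)) = - f v w"
        using killing_casimir[OF nd db v] fskew[OF w v] by simp
      also have "(\<Sum>b\<in>B. f (br b v) (br (d b) w)) = (\<Sum>b\<in>B. f (br (d b) v) (br b w))"
        by (rule db.swap[of "\<lambda>x y. f (br x v) (br y w)"])
          (rule lin_compose[OF fl(1) br_lin_left] lin_compose[OF fl(2) br_lin_left])+
      also have "\<dots> = - Y"
        unfolding Y_def sum_negf[symmetric] using dS BS v w by (intro sum.cong refl fskew br_closed) auto
      finally show ?thesis by simp
    qed
    moreover have "Y = X"
    proof -
      have "Y = - (\<Sum>b\<in>B. f (br w b) (br (d b) v))"
        unfolding Y_def sum_negf[symmetric]
        using br_skew[OF BS w] by (intro sum.cong) (simp_all add: f_simps)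
      also have "(\<Sum>b\<in>B. f (br w b) (br (d b) v)) = - (\<Sum>b\<in>B. f b (br (br w (d b)) v))"
      proof (rule db.invariance[of "\<lambda>x y. f x (br y v)" "br w"])
        show "killing (br w x) y = - killing x (br w y)" if "x \<in> S" "y \<in> S" for x y
        proof -
          have "br w x = br x (- w)" using br_skew[OF w that(1)] by (simp add: br_simps)
          then have "killing (br w x) y = killing x (br (- w) y)"
            using adj.trace_form_invariant[of x "- w" y] that w S by (simp add: subspace_neg)
          also have "br (- w) y = (- 1) *s br w y" by (simp add: br_simps)
          also have "killing x \<dots> = - killing x (br w y)"
            using adj.trace_form_scale_left[of "br w y" x "- 1"] adj.trace_form_commute[of x] that w S br_closed
            by (simp add: subspace_scale subspace_neg)
          finally show ?thesis .
        qed
      qed (use w br_closed fl(1) lin_compose[OF fl(2) br_lin_left] in auto)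
      also have "(\<Sum>b\<in>B. f b (br (br w (d b)) v)) = (\<Sum>b\<in>B. f b (br v (br (d b) w)))"
      proof (rule sum.cong[OF refl])
        fix b assume b: "b \<in> B"
        have "br (br w (d b)) v = br v (br (d b) w)"
          using br_skew[OF br_closed[OF w dS[OF b]] v] br_skew[OF w dS[OF b]] by (simp add: br_simps)
        then show "f b (br (br w (d b)) v) = f b (br v (br (d b) w))" by simp
      qed
      also have "\<dots> = X"
        unfolding X_def by (rule db.swap[of "\<lambda>x y. f x (br v (br y w))"])
          (rule fl(1) lin_compose[OF fl(2) lin_compose[OF br_lin_right br_lin_left]])+
      finally show ?thesis by simp
    qed
    ultimately show ?thesis by simp
  qed
  moreover have "\<phi> v \<in> M" if "v \<in> S" for v
    unfolding \<phi>_def by (intro subspace_sum[OF M] fM dS br_closed BS that)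
  then have "- \<phi> v \<in> M" if "v \<in> S" for v using that by (rule_tac subspace_neg[OF M])
  \<comment> \<open>For the trivial action the coboundary of a map is minus its value on the
    bracket, hence the sign of the witness.\<close>
  ultimately show ?thesis
    unfolding coboundary_def using triv lin_uminus[OF l\<phi>]
    by (intro exI[of _ "\<lambda>v. - \<phi> v"]) simp
qed

text \<open>An ideal meets its orthogonal space in an abelian ideal, since there
  \<open>killing [a, b] y = killing a [b, y] = 0\<close>; so the intersection is zero. The form is
  then nondegenerate on \<open>C\<close> itself, and dual bases of \<open>C\<close> provide the
  orthogonal projection onto it.\<close>

lemma ideal_complement:
  assumes nd: nondegenerate and C: "br_ideal C"
  defines "I \<equiv> {x \<in> S. \<forall>c\<in>C. killing x c = 0}"
  shows "br_ideal I" "C \<inter> I = {0}" "\<And>s. s \<in> S \<Longrightarrow> \<exists>c\<in>C. s - c \<in> I"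
proof -
  have CS: "C \<subseteq> S" "subspace C" and Cc: "\<And>x c. x \<in> S \<Longrightarrow> c \<in> C \<Longrightarrow> br x c \<in> C"
    using C unfolding br_ideal_def by auto
  have z: "killing 0 c = 0" if "c \<in> S" for c using adj.trace_form_scale_left[of c c 0] that by simp
  show I: "br_ideal I"
    unfolding br_ideal_def
  proof (intro conjI ballI)
    show "subspace I"
      unfolding I_def subspace_def using S CS z
      by (auto simp: subspace_def adj.trace_form_add_left adj.trace_form_scale_left subset_iff)
    show "I \<subseteq> S" unfolding I_def by blast
    fix x y assume x: "x \<in> S" and y: "y \<in> I"
    have yS: "y \<in> S" using y unfolding I_def by blast
    have "killing (br x y) c = 0" if c: "c \<in> C" for c
    proof -
      have cS: "c \<in> S" using c CS by blast
      have "br x y = br y (- x)" using br_skew[OF x yS] by (simp add: br_simps)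
      then have "killing (br x y) c = killing y (br (- x) c)"
        using adj.trace_form_invariant[of y "- x" c] x yS cS S by (simp add: subspace_neg)
      moreover have "br (- x) c \<in> C" using Cc[OF _ c, of "- x"] x S by (simp add: subspace_neg)
      ultimately show ?thesis using y unfolding I_def by simp
    qed
    then show "br x y \<in> I" unfolding I_def using br_closed[OF x yS] by blast
  qed
  have "br_ideal (C \<inter> I)" using I C unfolding br_ideal_def by (auto intro: subspace_inter)
  moreover have "br a b = 0" if a: "a \<in> C \<inter> I" and b: "b \<in> C \<inter> I" for a b
  proof -
    have S1: "a \<in> S" "b \<in> S" using a b CS by auto
    have "killing (br a b) y = 0" if "y \<in> S" for y
    proof -
      have "br b y \<in> C" using br_ideal_right[OF C _ that] b by blast
      then show ?thesis using adj.trace_form_invariant[OF S1 that] a unfolding I_def by simp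
    qed
    then show ?thesis using nd br_closed[OF S1] unfolding nondegenerate_def by blast
  qed
  ultimately show CI: "C \<inter> I = {0}" using abelian_ideal_zero[OF nd] by blast
  have "\<exists>B d. dual_bases scale Basis C killing B d"
  proof (rule exists_dual_bases[OF CS(2)])
    show "x = 0" if "x \<in> C" "\<And>y. y \<in> C \<Longrightarrow> killing x y = 0" for x
    proof -
      have "x \<in> C \<inter> I" using that CS unfolding I_def by blast
      then show ?thesis using CI by blast
    qed
    show "killing (x + y) z = killing x z + killing y z" if "x \<in> C" "y \<in> C" "z \<in> C" for x y z
      using that CS(1) by (intro adj.trace_form_add_left) auto
    show "killing (a *s x) z = a * killing x z" if "x \<in> C" "z \<in> C" for a x z
      using that CS(1) by (intro adj.trace_form_scale_left) auto
    show "killing x y = killing y x" if "x \<in> C" "y \<in> C" for x y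
      using that CS(1) by (intro adj.trace_form_commute) auto
  qed
  then obtain B d where "dual_bases scale Basis C killing B d" by blast
  then interpret db: dual_bases scale Basis C killing B d .
  show "\<exists>c\<in>C. s - c \<in> I" if s: "s \<in> S" for s
  proof
    let ?c = "\<Sum>b\<in>B. killing s b *s d b"
    show c: "?c \<in> C" by (intro subspace_sum subspace_scale db.d CS)
    have cS: "?c \<in> S" using c CS by blast
    have "killing (s - ?c) x = 0" if x: "x \<in> C" for x
    proof (rule span_functional_zero[of S B "\<lambda>x. killing (s - ?c) x"])
      have sc: "s - ?c \<in> S" by (rule subspace_diff[OF S s cS])
      show "killing (s - ?c) (x + y) = killing (s - ?c) x + killing (s - ?c) y" if "x \<in> S" "y \<in> S" for x y
        using that sc S adj.trace_form_commute[OF sc] by (simp add: subspace_add adj.trace_form_add_left)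
      show "killing (s - ?c) (a *s x) = a * killing (s - ?c) x" if "x \<in> S" for a x
        using that sc S adj.trace_form_commute[OF sc] by (simp add: subspace_scale adj.trace_form_scale_left)
      show "killing (s - ?c) b = 0" if b: "b \<in> B" for b
      proof -
        have bC: "b \<in> C" and bS: "b \<in> S" using db.B_I[OF b] CS by auto
        have "killing (s + (- 1) *s ?c) b = killing s b - killing ?c b"
          using adj.trace_form_add_left[OF s subspace_scale[OF S cS] bS, of "- 1"]
            adj.trace_form_scale_left[OF cS bS, of "- 1"] by simp
        moreover have "killing ?c b = (\<Sum>b'\<in>B. killing s b' * killing (d b') b)"
          using db.form_scale[OF db.d bC] db.form_sum[OF db.finite_B subspace_scale[OF CS(2) db.d] bC] by simp
        moreover have "\<dots> = (\<Sum>b'\<in>B. if b' = b then killing s b' else 0)"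
          using db.dual[OF _ b] db.form_sym[OF db.d bC] by (intro sum.cong) auto
        ultimately show ?thesis using b db.finite_B by simp
      qed
    qed (use S CS x db.B db.B_I in auto)
    then show "s - ?c \<in> I" unfolding I_def using subspace_diff[OF S s cS] by blast
  qed
qed

end

section \<open>Casimir operators on modules\<close>

context lie_module
begin

lemma br_ideal_kernel: "br_ideal (kernel S)"
proof -
  have "subspace (kernel S)" using closed_kernel[OF closed_S] by (simp add: closed_def)
  moreover have "br x y \<in> kernel S" if "x \<in> S" "y \<in> kernel S" for x y
    using that act_closed by (simp add: kernel_def br_closed act_br act_simps)
  ultimately show ?thesis unfolding br_ideal_def kernel_def by blast
qed

lemma trace_form_skew:
  assumes "s \<in> S" "x \<in> S" "y \<in> S"
  shows "trace_form (br s x) y = - trace_form x (br s y)"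
proof -
  have c: "br s x \<in> S" "br x s \<in> S" "br s y \<in> S" using assms by (auto intro: br_closed)
  have "br s x = (- 1) *s br x s" using br_skew[OF assms(1,2)] by simp
  then have "trace_form (br s x) y = - trace_form (br x s) y"
    using trace_form_scale_left[OF c(2) assms(3), of "- 1"] by simp
  then show ?thesis using trace_form_invariant[OF assms(2,1,3)] by simp
qed

text \<open>By Cartan's criterion some derived term of the radical of the form on \<open>I\<close>
  acts by zero. It lies in the kernel and in \<open>I\<close>, so it vanishes, and the radical is a
  solvable ideal.\<close>

lemma trace_form_dual_bases:
  assumes nd: nondegenerate and I: "br_ideal I" "kernel S \<inter> I = {0}"
  obtains B d where "dual_bases scale Basis I trace_form B d"
proof -
  have IS: "I \<subseteq> S" "subspace I" using I(1) unfolding br_ideal_def by auto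
  define T where "T = {x \<in> I. \<forall>y\<in>I. trace_form x y = 0}"
  have z: "trace_form 0 y = 0" if "y \<in> S" for y using trace_form_scale_left[of y y 0] that by simp
  have T: "br_ideal T"
    unfolding br_ideal_def
  proof (intro conjI ballI)
    show "subspace T"
      unfolding T_def using IS z
      by (auto simp: subspace_def trace_form_add_left trace_form_scale_left subset_iff)
    show "T \<subseteq> S" unfolding T_def using IS by blast
    fix s x assume s: "s \<in> S" and x: "x \<in> T"
    have "trace_form (br s x) y = 0" if y: "y \<in> I" for y
    proof -
      have "br s y \<in> I" using I(1) s y unfolding br_ideal_def by blast
      moreover have "x \<in> S" "y \<in> S" using x y IS unfolding T_def by auto
      ultimately show ?thesis using trace_form_skew[OF s] x unfolding T_def by simp
    qed
    moreover have "br s x \<in> I" using I(1) s x unfolding br_ideal_def T_def by blast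
    ultimately show "br s x \<in> T" unfolding T_def by blast
  qed
  obtain k where k: "\<forall>x\<in>der br T k. \<forall>m\<in>M. act x m = 0"
    using cartan[OF br_ideal_closed[OF T]] unfolding T_def by auto
  have D: "subspace (der br T k)" "der br T k \<subseteq> T" "der br T k \<subseteq> S"
    using br_ideal_der[OF T, of k] unfolding br_ideal_def by auto
  have "der br T k \<subseteq> kernel S \<inter> I" using k D unfolding kernel_def T_def by blast
  then have "der br T k = {0}" using I(2) subspace_0[OF D(1)] by blast
  then have T0: "T = {0}" by (rule solvable_ideal_zero[OF nd T])
  have "\<exists>B d. dual_bases scale Basis I trace_form B d"
  proof (rule exists_dual_bases[OF IS(2)])
    show "trace_form (x + y) z = trace_form x z + trace_form y z" if "x \<in> I" "y \<in> I" "z \<in> I" for x y z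
      using that IS(1) by (intro trace_form_add_left) auto
    show "trace_form (a *s x) z = a * trace_form x z" if "x \<in> I" "z \<in> I" for a x z
      using that IS(1) by (intro trace_form_scale_left) auto
    show "trace_form x y = trace_form y x" if "x \<in> I" "y \<in> I" for x y
      using that IS(1) by (intro trace_form_commute) auto
    show "x = 0" if "x \<in> I" "\<And>y. y \<in> I \<Longrightarrow> trace_form x y = 0" for x
    proof -
      have "x \<in> T" unfolding T_def using that by simp
      then show ?thesis using T0 by simp
    qed
  qed
  with that show ?thesis by blast
qed

text \<open>The Casimir operator is built on the complement \<open>I\<close> of the kernel, where
  the trace form is nondegenerate. Its null space is a submodule, and a proper one because its trace
  is nonzero; simplicity makes the operator invertible on \<open>M\<close>.\<close>

lemma coboundary_if_simple_nontrivial: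
  assumes nd: nondegenerate and f: "cocycle M act f"
    and nontriv: "x0 \<in> S" "m0 \<in> M" "act x0 m0 \<noteq> 0"
    and simple: "\<And>U. subspace U \<Longrightarrow> U \<subseteq> M \<Longrightarrow> (\<And>x u. x \<in> S \<Longrightarrow> u \<in> U \<Longrightarrow> act x u \<in> U) \<Longrightarrow> U = {0} \<or> U = M"
  shows "coboundary M act f"
proof -
  define I where "I = {x \<in> S. \<forall>c\<in>kernel S. killing x c = 0}"
  note compl = ideal_complement[OF nd br_ideal_kernel, folded I_def]
  have IS: "I \<subseteq> S" "\<And>s x. s \<in> S \<Longrightarrow> x \<in> I \<Longrightarrow> br s x \<in> I" using compl(1) unfolding br_ideal_def by auto
  obtain B d where db: "dual_bases scale Basis I trace_form B d"
    using trace_form_dual_bases[OF nd compl(1,2)] .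
  interpret db: dual_bases scale Basis I trace_form B d by (rule db)
  have BI: "b \<in> I" "d b \<in> I" and BS: "b \<in> S" "d b \<in> S" if "b \<in> B" for b
    using that db.B_I db.d IS(1) by auto
  have fl: "\<And>y. lin (\<lambda>x. f x y)" "\<And>x. lin (f x)" and fM: "\<And>x y. x \<in> S \<Longrightarrow> y \<in> S \<Longrightarrow> f x y \<in> M"
    and falt: "\<And>x. x \<in> S \<Longrightarrow> f x x = 0"
    using f unfolding cocycle_def by auto
  note f_simps = lin_add[OF fl(1)] lin_add[OF fl(2)] lin_neg[OF fl(1)] lin_neg[OF fl(2)]
  have fskew: "f x y = - f y x" if "x \<in> S" "y \<in> S" for x y
    using falt[of "x + y"] falt[of x] falt[of y] that S
    by (simp add: f_simps subspace_add add_eq_0_iff2)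
  note ll = lin_compose[OF act_lin_right act_lin_right]
  define cas where "cas m = (\<Sum>b\<in>B. act b (act (d b) m))" for m
  have lcas: "lin cas" unfolding cas_def[abs_def] by (intro lin_sum_fun ll)
  have casM: "cas m \<in> M" if "m \<in> M" for m
    unfolding cas_def by (intro subspace_sum[OF M] act_closed BS that)
  have cas_act: "cas (act s m) = act s (cas m)" if s: "s \<in> S" and m: "m \<in> M" for s m
  proof -
    have "act s (act b (act (d b) m))
        = act (br s b) (act (d b) m) + act b (act (br s (d b)) m) + act b (act (d b) (act s m))" if b: "b \<in> B" for b
      using act_br[OF s BS(1)[OF b] act_closed[OF BS(2)[OF b] m]] act_br[OF s BS(2)[OF b] m]
      by (simp add: act_simps)
    then have "act s (cas m) = (\<Sum>b\<in>B. act (br s b) (act (d b) m))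
        + (\<Sum>b\<in>B. act b (act (br s (d b)) m)) + cas (act s m)"
      unfolding cas_def by (simp add: lin_sum[OF act_lin_right] sum.distrib)
    moreover have "(\<Sum>b\<in>B. act (br s b) (act (d b) m)) = - (\<Sum>b\<in>B. act b (act (br s (d b)) m))"
    proof (rule db.invariance[of "\<lambda>x y. act x (act y m)" "br s"])
      show "trace_form (br s u) v = - trace_form u (br s v)" if "u \<in> I" "v \<in> I" for u v
        using that IS(1) s by (intro trace_form_skew) auto
    qed (use s IS act_lin_left lin_compose[OF act_lin_right act_lin_left] in auto)
    ultimately show ?thesis by simp
  qed
  have "B \<noteq> {}"
  proof
    assume "B = {}"
    then have "I = {0}" using db.B(2) by simp
    then have "x0 \<in> kernel S" using compl(3)[OF nontriv(1)] by auto
    with nontriv show False unfolding kernel_def by blast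
  qed
  have "trace M cas = (\<Sum>b\<in>B. trace M (\<lambda>m. act b (act (d b) m)))"
    unfolding cas_def[abs_def] by (intro trace_sum[OF M ll] act_closed BS)
  \<comment> \<open>Each basis vector contributes \<open>trace_form b (d b) = 1\<close>, so the
    trace is the cardinality of \<open>B\<close>, nonzero in characteristic 0.\<close>
  also have "\<dots> = (\<Sum>b\<in>B. 1)" using db.dual unfolding trace_form_def by (intro sum.cong) auto
  also have "\<dots> \<noteq> 0" using \<open>B \<noteq> {}\<close> db.finite_B by simp
  finally have tr: "trace M cas \<noteq> 0" .
  let ?U = "{m \<in> M. cas m = 0}"
  have "subspace ?U" using M by (auto simp: subspace_def lin_0[OF lcas] lin_add[OF lcas] lin_scale[OF lcas])
  then have "?U = {0} \<or> ?U = M"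
    using act_closed by (intro simple) (auto simp: cas_act act_simps)
  moreover have "?U \<noteq> M"
  proof
    assume "?U = M"
    then have "trace M cas = trace M (\<lambda>x. 0)" by (intro trace_cong[OF M]) blast
    with tr show False by (simp add: trace_zero)
  qed
  ultimately have U0: "?U = {0}" by blast
  have inj: "inj_on cas M"
    unfolding endo.linear_inj_on_iff_eq_0[OF lcas M] using U0 by blast
  then have "dim (cas ` M) = dim M" using M by (intro endo.dim_image_eq[OF lcas]) (simp add: span_eq_iff[THEN iffD2])
  then have surj: "cas ` M = M"
    using casM by (intro subspace_dim_equal subspace_lin_image lcas M) auto
  obtain g where g: "g ` UNIV \<subseteq> M" "lin g" "\<And>m. m \<in> M \<Longrightarrow> g (cas m) = m"
    using endo.linear_exists_left_inverse_on[OF lcas M inj] by blast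
  have g_act: "g (act s m) = act s (g m)" if s: "s \<in> S" and m: "m \<in> M" for s m
  proof -
    obtain m' where m': "m' \<in> M" "m = cas m'" using surj m by blast
    then show ?thesis using cas_act[OF s m'(1)] g(3)[OF m'(1)] g(3)[OF act_closed[OF s m'(1)]] by simp
  qed
  \<comment> \<open>Contraction with the Casimir element is a homotopy between the Casimir operator and zero.\<close>
  define \<phi> where "\<phi> v = (\<Sum>b\<in>B. act b (f (d b) v))" for v
  have l\<phi>: "lin \<phi>"
    unfolding \<phi>_def[abs_def] by (intro lin_sum_fun lin_compose[OF act_lin_right fl(2)])
  have \<phi>M: "\<phi> v \<in> M" if "v \<in> S" for v
    unfolding \<phi>_def by (intro subspace_sum[OF M] act_closed fM BS that)
  have key: "cas (f v w) = act v (\<phi> w) - act w (\<phi> v) - \<phi> (br v w)" if v: "v \<in> S" and w: "w \<in> S" for v w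
  proof -
    have inv: "(\<Sum>b\<in>B. act (br x b) (f (d b) y)) = - (\<Sum>b\<in>B. act b (f (br x (d b)) y))"
      if x: "x \<in> S" for x y
    proof (rule db.invariance[of "\<lambda>u u'. act u (f u' y)" "br x"])
      show "trace_form (br x u) v = - trace_form u (br x v)" if "u \<in> I" "v \<in> I" for u v
        using that IS(1) x by (intro trace_form_skew) auto
    qed (use x IS act_lin_left lin_compose[OF act_lin_right fl(1)] in auto)
    have summand: "act b (act (d b) (f v w)) =
        (act v (act b (f (d b) w)) - act (br v b) (f (d b) w))
        - (act w (act b (f (d b) v)) - act (br w b) (f (d b) v))
        - act b (f (d b) (br v w))
        + act b (f (br w (d b)) v) - act b (f (br v (d b)) w)" if b: "b \<in> B" for b
    proof -
      note bS = BS[OF b]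
      have "act (d b) (f v w) + act v (f w (d b)) + act w (f (d b) v)
          + f (d b) (br v w) + f v (br w (d b)) + f w (br (d b) v) = 0"
        using f bS v w unfolding cocycle_def by blast
      moreover have "f w (d b) = - f (d b) w" "f v (br w (d b)) = - f (br w (d b)) v"
        "f w (br (d b) v) = f (br v (d b)) w"
        using fskew[OF w bS(2)] fskew[OF v br_closed[OF w bS(2)]] fskew[OF w br_closed[OF bS(2) v]]
          br_skew[OF bS(2) v] by (simp_all add: f_simps)
      ultimately have "act (d b) (f v w) = act v (f (d b) w) - act w (f (d b) v)
          - f (d b) (br v w) + f (br w (d b)) v - f (br v (d b)) w"
        by (simp add: act_simps algebra_simps add_eq_0_iff2)
      then have "act b (act (d b) (f v w)) = act b (act v (f (d b) w)) - act b (act w (f (d b) v))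
          - act b (f (d b) (br v w)) + act b (f (br w (d b)) v) - act b (f (br v (d b)) w)"
        by (simp add: act_simps)
      moreover have "act b (act v (f (d b) w)) = act v (act b (f (d b) w)) - act (br v b) (f (d b) w)"
        using act_br[OF v bS(1) fM[OF bS(2) w]] by simp
      moreover have "act b (act w (f (d b) v)) = act w (act b (f (d b) v)) - act (br w b) (f (d b) v)"
        using act_br[OF w bS(1) fM[OF bS(2) v]] by simp
      ultimately show ?thesis by simp
    qed
    have "cas (f v w) = (act v (\<phi> w) - (\<Sum>b\<in>B. act (br v b) (f (d b) w)))
        - (act w (\<phi> v) - (\<Sum>b\<in>B. act (br w b) (f (d b) v))) - \<phi> (br v w)
        + (\<Sum>b\<in>B. act b (f (br w (d b)) v)) - (\<Sum>b\<in>B. act b (f (br v (d b)) w))"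
      unfolding cas_def \<phi>_def using summand
      by (simp add: sum.distrib sum_subtractf lin_sum[OF act_lin_right])
    \<comment> \<open>Invariance of the dual bases cancels the sum with \<open>[v, b]\<close>
      against the one with \<open>[v, d b]\<close>, and likewise for \<open>w\<close>.\<close>
    then show ?thesis using inv[OF v, of w] inv[OF w, of v] by simp
  qed
  \<comment> \<open>The inverse \<open>g\<close> of the Casimir operator commutes with the action,
    so it passes through the coboundary of \<open>\<phi>\<close>.\<close>
  have "f v w = act v (g (\<phi> w)) - act w (g (\<phi> v)) - g (\<phi> (br v w))" if v: "v \<in> S" and w: "w \<in> S" for v w
  proof -
    have "f v w = g (cas (f v w))" using g(3)[OF fM[OF v w]] by simp
    also have "\<dots> = g (act v (\<phi> w)) - g (act w (\<phi> v)) - g (\<phi> (br v w))"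
      unfolding key[OF v w] by (simp add: lin_diff[OF g(2)])
    finally show ?thesis using g_act[OF v \<phi>M[OF w]] g_act[OF w \<phi>M[OF v]] by simp
  qed
  then show ?thesis
    unfolding coboundary_def using lin_compose[OF g(2) l\<phi>] g(1)
    by (intro exI[of _ "\<lambda>v. g (\<phi> v)"]) blast
qed

text \<open>The square of the coboundary operator is zero: once \<open>act_br\<close> has cancelled
  the double actions, only \<open>\<phi>\<close> of the Jacobi sum remains.\<close>

lemma cocycle_diff_coboundary:
  assumes f: "cocycle M act f" and \<phi>: "lin \<phi>" "\<And>x. x \<in> S \<Longrightarrow> \<phi> x \<in> M"
  shows "cocycle M act (\<lambda>x y. f x y - (act x (\<phi> y) - act y (\<phi> x) - \<phi> (br x y)))"
proof -
  let ?g = "\<lambda>x y. act x (\<phi> y) - act y (\<phi> x) - \<phi> (br x y)"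
  have fl: "\<And>y. lin (\<lambda>x. f x y)" "\<And>x. lin (f x)" and fM: "\<And>x y. x \<in> S \<Longrightarrow> y \<in> S \<Longrightarrow> f x y \<in> M"
    and falt: "\<And>x. x \<in> S \<Longrightarrow> f x x = 0"
    using f unfolding cocycle_def by auto
  note \<phi>s = lin_add[OF \<phi>(1)] lin_diff[OF \<phi>(1)] lin_neg[OF \<phi>(1)] lin_0[OF \<phi>(1)]
  have "lin (\<lambda>x. f x y - ?g x y)" for y
    by (intro lin_minus fl act_lin_left lin_compose[OF act_lin_right \<phi>(1)] lin_compose[OF \<phi>(1) br_lin_left])
  moreover have "lin (\<lambda>y. f x y - ?g x y)" for x
    by (intro lin_minus fl act_lin_left lin_compose[OF act_lin_right \<phi>(1)] lin_compose[OF \<phi>(1) br_lin_right])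
  moreover have "f x y - ?g x y \<in> M" if "x \<in> S" "y \<in> S" for x y
    using that \<phi>(2) fM br_closed by (intro subspace_diff[OF M] act_closed) auto
  moreover have "f x x - ?g x x = 0" if "x \<in> S" for x
    using falt[OF that] br_alt[OF that] by (simp add: \<phi>s)
  moreover have "act x (f y z - ?g y z) + act y (f z x - ?g z x) + act z (f x y - ?g x y)
      + (f x (br y z) - ?g x (br y z)) + (f y (br z x) - ?g y (br z x)) + (f z (br x y) - ?g z (br x y)) = 0"
    if xyz: "x \<in> S" "y \<in> S" "z \<in> S" for x y z
  proof -
    have 1: "act x (f y z) + act y (f z x) + act z (f x y)
        + f x (br y z) + f y (br z x) + f z (br x y) = 0"
      using f xyz unfolding cocycle_def by blast
    have "\<phi> (br x (br y z) + br y (br z x) + br z (br x y)) = 0"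
      using br_jacobi[OF xyz] by (simp add: \<phi>s)
    then have 2: "\<phi> (br x (br y z)) + \<phi> (br y (br z x)) + \<phi> (br z (br x y)) = 0"
      by (simp add: \<phi>s)
    have 3: "act x (?g y z) + act y (?g z x) + act z (?g x y) + ?g x (br y z) + ?g y (br z x) + ?g z (br x y)
       = - (\<phi> (br x (br y z)) + \<phi> (br y (br z x)) + \<phi> (br z (br x y)))"
      using act_br[OF xyz(1,2) \<phi>(2)[OF xyz(3)]] act_br[OF xyz(2,3) \<phi>(2)[OF xyz(1)]]
        act_br[OF xyz(3,1) \<phi>(2)[OF xyz(2)]]
      by (simp add: act_simps)
    have "act x (f y z - ?g y z) + act y (f z x - ?g z x) + act z (f x y - ?g x y)
      + (f x (br y z) - ?g x (br y z)) + (f y (br z x) - ?g y (br z x)) + (f z (br x y) - ?g z (br x y))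
      = (act x (f y z) + act y (f z x) + act z (f x y) + f x (br y z) + f y (br z x) + f z (br x y))
      - (act x (?g y z) + act y (?g z x) + act z (?g x y) + ?g x (br y z) + ?g y (br z x) + ?g z (br x y))"
      by (simp add: act_simps(5,6))
    then show ?thesis unfolding 1 3 2 by simp
  qed
  ultimately show ?thesis unfolding cocycle_def by blast
qed

end

context lie_on
begin

text \<open>A proper nonzero submodule \<open>U\<close> has smaller dimension, and so has the
  quotient, modelled by \<open>q\<close>. A solution on the quotient is a map whose coboundary
  differs from \<open>f\<close> by a cocycle with values in \<open>U\<close>. Without such a
  \<open>U\<close>, the two preceding cases apply according to whether the action is
  trivial.\<close>

theorem whitehead:
  assumes nd: nondegenerate
  shows "lie_module scale Basis S br M act \<Longrightarrow> cocycle M act f \<Longrightarrow> coboundary M act f"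
proof (induction "dim M" arbitrary: M act f rule: less_induct)
  case less
  interpret lie_module scale Basis S br M act by (rule less.prems(1))
  note f = less.prems(2)
  show ?case
  proof (cases "\<exists>U. subspace U \<and> U \<subseteq> M \<and> (\<forall>x\<in>S. \<forall>u\<in>U. act x u \<in> U) \<and> U \<noteq> {0} \<and> U \<noteq> M")
    case True
    then obtain U where U: "subspace U" "U \<subseteq> M" "\<And>x u. x \<in> S \<Longrightarrow> u \<in> U \<Longrightarrow> act x u \<in> U" "U \<noteq> {0}" "U \<noteq> M"
      by blast
    obtain q where q: "lin q" "\<And>x. x - q x \<in> U" "\<And>x. x \<in> U \<Longrightarrow> q x = 0"
      using exists_projection[OF U(1)] by blast
    have qM: "q m \<in> M" if "m \<in> M" for m
      using subspace_diff[OF M that, of "m - q m"] q(2)[of m] U(2) by auto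
    have qact: "q (act x (q m)) = q (act x m)" if "x \<in> S" for x m
      using q(3)[OF U(3)[OF that q(2)[of m]]] by (simp add: act_simps lin_diff[OF q(1)])
    have qq: "q (q m) = q m" for m using q(3)[OF q(2)[of m]] by (simp add: lin_diff[OF q(1)])
    let ?M = "q ` M" and ?act = "\<lambda>x m. q (act x m)"
    have M': "subspace ?M" by (rule subspace_lin_image[OF q(1) M])
    have mod': "lie_module scale Basis S br ?M ?act"
      by unfold_locales
        (auto simp: M' act_simps lin_add[OF q(1)] lin_scale[OF q(1)] lin_diff[OF q(1)] qact act_br qM
          intro!: imageI act_closed)
    have sub: "?M \<subset> M"
    proof -
      obtain u where u: "u \<in> U" "u \<noteq> 0" using U(4) subspace_0[OF U(1)] by blast
      have "u \<notin> ?M" using u q(3)[OF u(1)] qq by auto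
      then show ?thesis using qM u U(2) by auto
    qed
    have dim': "dim ?M < dim M"
      using sub M M' by (intro dim_psubset) (simp add: span_eq_iff[THEN iffD2])
    have fl: "\<And>y. lin (\<lambda>x. f x y)" "\<And>x. lin (f x)" and fM: "\<And>x y. x \<in> S \<Longrightarrow> y \<in> S \<Longrightarrow> f x y \<in> M"
      and falt: "\<And>x. x \<in> S \<Longrightarrow> f x x = 0"
      using f unfolding cocycle_def by auto
    have "q (act x (q (f y z))) + q (act y (q (f z x))) + q (act z (q (f x y)))
          + q (f x (br y z)) + q (f y (br z x)) + q (f z (br x y)) = 0"
      if "x \<in> S" "y \<in> S" "z \<in> S" for x y z
    proof -
      have "q (act x (f y z) + act y (f z x) + act z (f x y)
        + f x (br y z) + f y (br z x) + f z (br x y)) = 0"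
        using f that unfolding cocycle_def by (simp add: lin_0[OF q(1)])
      then show ?thesis using that by (simp add: qact lin_add[OF q(1)])
    qed
    then have "cocycle ?M ?act (\<lambda>x y. q (f x y))"
      unfolding cocycle_def using lin_compose[OF q(1) fl(1)] lin_compose[OF q(1) fl(2)] fM falt
      by (simp add: lin_0[OF q(1)])
    from less.hyps[OF dim' mod' this] obtain \<phi> where \<phi>: "lin \<phi>" "\<And>x. x \<in> S \<Longrightarrow> \<phi> x \<in> ?M"
      "\<And>x y. x \<in> S \<Longrightarrow> y \<in> S \<Longrightarrow> q (f x y) = q (act x (\<phi> y)) - q (act y (\<phi> x)) - \<phi> (br x y)"
      unfolding coboundary_def by blast
    have \<phi>M: "\<phi> x \<in> M" if "x \<in> S" for x using \<phi>(2)[OF that] sub by blast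
    have q\<phi>: "q (\<phi> x) = \<phi> x" if "x \<in> S" for x using \<phi>(2)[OF that] qq by auto
    define h where "h x y = f x y - (act x (\<phi> y) - act y (\<phi> x) - \<phi> (br x y))" for x y
    have h: "cocycle M act h" unfolding h_def[abs_def] by (rule cocycle_diff_coboundary[OF f \<phi>(1) \<phi>M])
    have hU: "h x y \<in> U" if "x \<in> S" "y \<in> S" for x y
    proof -
      have "q (h x y) = 0"
        unfolding h_def using \<phi>(3)[OF that] q\<phi>[OF br_closed[OF that]] by (simp add: lin_diff[OF q(1)])
      then show ?thesis using q(2)[of "h x y"] by simp
    qed
    have cocU: "cocycle U act h" using h hU unfolding cocycle_def by blast
    have modU: "lie_module scale Basis S br U act"
      by unfold_locales (use U act_br in \<open>auto simp: act_simps subset_iff\<close>)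
    have dimU: "dim U < dim M"
      using U M by (intro dim_psubset) (simp add: span_eq_iff[THEN iffD2] psubset_eq)
    from less.hyps[OF dimU modU cocU] obtain \<psi> where \<psi>: "lin \<psi>" "\<And>x. x \<in> S \<Longrightarrow> \<psi> x \<in> U"
      "\<And>x y. x \<in> S \<Longrightarrow> y \<in> S \<Longrightarrow> h x y = act x (\<psi> y) - act y (\<psi> x) - \<psi> (br x y)"
      unfolding coboundary_def by blast
    have "f x y = act x (\<phi> y + \<psi> y) - act y (\<phi> x + \<psi> x) - (\<phi> (br x y) + \<psi> (br x y))"
      if "x \<in> S" "y \<in> S" for x y
      using \<psi>(3)[OF that] unfolding h_def by (simp add: act_simps algebra_simps)
    moreover have "\<phi> x + \<psi> x \<in> M" if "x \<in> S" for x
      using \<phi>M[OF that] \<psi>(2)[OF that] U(2) M by (auto intro: subspace_add)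
    ultimately show ?thesis
      unfolding coboundary_def using lin_plus[OF \<phi>(1) \<psi>(1)] by (intro exI[of _ "\<lambda>x. \<phi> x + \<psi> x"]) blast
  next
    case False
    then have simple: "U = {0} \<or> U = M"
      if "subspace U" "U \<subseteq> M" "\<And>x u. x \<in> S \<Longrightarrow> u \<in> U \<Longrightarrow> act x u \<in> U" for U
      using that by blast
    show ?thesis
    proof (cases "\<exists>x\<in>S. \<exists>m\<in>M. act x m \<noteq> 0")
      case True
      then obtain x m where "x \<in> S" "m \<in> M" "act x m \<noteq> 0" by blast
      from coboundary_if_simple_nontrivial[OF nd f this simple] show ?thesis .
    next
      case False
      then show ?thesis by (intro coboundary_if_trivial[OF nd _ M f]) blast
    qed
  qed
qed

end

section \<open>Quotients by ideals\<close>

locale fd_lie_algebra = lie_algebra scale bracket + ac_space scale Basis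
  for scale :: "'f::{alg_closed_field, field_char_0} \<Rightarrow> 'v::ab_group_add \<Rightarrow> 'v" (infixr "*s" 75)
    and bracket :: "'v \<Rightarrow> 'v \<Rightarrow> 'v" and Basis
begin

lemmas bracket_simps =
  lin_add[OF linear_left] lin_add[OF linear_right] lin_scale[OF linear_left] lin_scale[OF linear_right]
  lin_diff[OF linear_left] lin_diff[OF linear_right] lin_0[OF linear_left] lin_0[OF linear_right]
  lin_neg[OF linear_left] lin_neg[OF linear_right]

lemma bracket_skew: "bracket x y = - bracket y x"
  using alternating[of "x + y"] unfolding bracket_simps(1,2) by (simp add: alternating add_eq_0_iff2)

lemma bracket_bracket: "bracket (bracket x y) z = bracket x (bracket y z) - bracket y (bracket x z)"
  using jacobi[of x y z] bracket_skew[of z "bracket x y"] bracket_skew[of z x]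
  by (simp add: bracket_simps algebra_simps add_eq_0_iff2)

lemma subspace_derived_series: "subspace A \<Longrightarrow> subspace (derived_series A k)"
  by (cases k) auto

lemma derived_series_mono: "A \<subseteq> B \<Longrightarrow> derived_series A k \<subseteq> derived_series B k"
proof (induction k)
  case (Suc k)
  then show ?case unfolding derived_series.simps by (intro span_mono) blast
qed simp

lemma derived_series_add: "derived_series A (k + l) = derived_series (derived_series A k) l"
  by (induction l) simp_all

lemma solvable_subset:
  assumes "solvable B" "A \<subseteq> B" "subspace A"
  shows "solvable A"
proof -
  obtain n where "derived_series B n = {0}" using assms(1) unfolding solvable_def by blast
  then have "derived_series A n = {0}"
    using derived_series_mono[OF assms(2), of n] subspace_0[OF subspace_derived_series[OF assms(3), of n]] by blast
  then show ?thesis unfolding solvable_def by blast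
qed

lemma ideal_right: "ideal UNIV J \<Longrightarrow> x \<in> J \<Longrightarrow> bracket x y \<in> J"
  using bracket_skew[of x y] unfolding ideal_def by (metis UNIV_I subspace_neg)

lemma ideal_derived_series: "ideal UNIV J \<Longrightarrow> ideal UNIV (derived_series J k) \<and> derived_series J (Suc k) \<subseteq> derived_series J k"
proof (induction k)
  case 0
  then have "{bracket x y |x y. x \<in> J \<and> y \<in> J} \<subseteq> J" "subspace J" unfolding ideal_def by blast+
  with 0 show ?case by (simp add: span_minimal)
next
  case (Suc k)
  let ?D = "derived_series J k" and ?E = "derived_series J (Suc k)"
  have D: "ideal UNIV ?D" "?E \<subseteq> ?D" using Suc by auto
  have E: "bracket x y \<in> ?E" if "y \<in> ?E" for x y
    unfolding derived_series.simps
  proof (rule lin_span_closed[OF linear_right _ subspace_span that[unfolded derived_series.simps]])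
    fix y assume "y \<in> {bracket x y |x y. x \<in> ?D \<and> y \<in> ?D}"
    then obtain u v where uv: "u \<in> ?D" "v \<in> ?D" "y = bracket u v" by blast
    have eq: "bracket x y = bracket (bracket x u) v + bracket u (bracket x v)"
      unfolding uv(3) bracket_bracket[of x u v] by simp
    have "bracket x u \<in> ?D" "bracket x v \<in> ?D" using uv D(1) unfolding ideal_def by blast+
    then have "bracket (bracket x u) v \<in> {bracket x y |x y. x \<in> ?D \<and> y \<in> ?D}"
      "bracket u (bracket x v) \<in> {bracket x y |x y. x \<in> ?D \<and> y \<in> ?D}"
      using uv(1,2) by blast+
    then show "bracket x y \<in> span {bracket x y |x y. x \<in> ?D \<and> y \<in> ?D}"
      unfolding eq by (simp only: span_add span_base)
  qed
  have I: "ideal UNIV ?E" unfolding ideal_def using E by simp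
  have "{bracket x y |x y. x \<in> ?E \<and> y \<in> ?E} \<subseteq> ?E" using E by blast
  then have "derived_series J (Suc (Suc k)) \<subseteq> ?E"
    unfolding derived_series.simps(2)[of J "Suc k"] by (rule span_minimal) (simp add: subspace_derived_series)
  with I show ?case by blast
qed

end

locale quotient_algebra = fd_lie_algebra scale bracket Basis
  for scale :: "'f::{alg_closed_field, field_char_0} \<Rightarrow> 'v::ab_group_add \<Rightarrow> 'v" (infixr "*s" 75)
    and bracket :: "'v \<Rightarrow> 'v \<Rightarrow> 'v" and Basis +
  fixes I V :: "'v set" and p :: "'v \<Rightarrow> 'v"
  assumes I: "ideal UNIV I"
    and V: "subspace V"
    and p: "lin p"
    and p_V: "p x \<in> V"
    and p_I: "x - p x \<in> I"
    and p_zero: "x \<in> I \<Longrightarrow> p x = 0"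
    and p_id: "x \<in> V \<Longrightarrow> p x = x"
begin

lemma p_bracket_right: "p (bracket x (p y)) = p (bracket x y)"
proof -
  have "bracket x (y - p y) \<in> I" using I p_I unfolding ideal_def by blast
  then show ?thesis using p_zero lin_diff[OF p] by (force simp: bracket_simps)
qed

lemma p_bracket_left: "p (bracket (p x) y) = p (bracket x y)"
proof -
  have "bracket (x - p x) y \<in> I" by (rule ideal_right[OF I p_I])
  then show ?thesis using p_zero lin_diff[OF p] by (force simp: bracket_simps)
qed

abbreviation br :: "'v \<Rightarrow> 'v \<Rightarrow> 'v" where
  "br x y \<equiv> p (bracket x y)"

sublocale Q: lie_on scale Basis V br
proof unfold_locales
  show "p (bracket x (p (bracket y z))) + p (bracket y (p (bracket z x))) + p (bracket z (p (bracket x y))) = 0" for x y z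
    using arg_cong[OF jacobi[of x y z], of p] by (simp add: p_bracket_right lin_add[OF p] lin_0[OF p])
qed (simp_all add: V p_V bracket_simps lin_add[OF p] lin_scale[OF p] lin_0[OF p] alternating)

lemma der_image: "der br (p ` J) k = p ` derived_series J k"
proof (induction k)
  case (Suc k)
  have "{br x y |x y. x \<in> p ` derived_series J k \<and> y \<in> p ` derived_series J k}
      = p ` {bracket x y |x y. x \<in> derived_series J k \<and> y \<in> derived_series J k}" (is "?A = ?B")
  proof -
    have "?A = {br (p x) (p y) |x y. x \<in> derived_series J k \<and> y \<in> derived_series J k}" by blast
    also have "\<dots> = {br x y |x y. x \<in> derived_series J k \<and> y \<in> derived_series J k}"
      by (simp only: p_bracket_left p_bracket_right)
    also have "\<dots> = ?B" by blast
    finally show ?thesis .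
  qed
  then show ?case using Suc by (simp add: endo.linear_span_image[OF p])
qed simp

text \<open>Because \<open>C\<close> covers the quotient, the image of \<open>J\<close> is an ideal
  of it, and its derived series is the image of that of \<open>J\<close>.\<close>

lemma solvable_ideal_subset:
  assumes nd: "Q.nondegenerate" and C: "p ` C = V" and J: "ideal C J" "solvable J"
  shows "J \<subseteq> I"
proof -
  obtain n where n: "derived_series J n = {0}" using J(2) unfolding solvable_def by blast
  have "Q.br_ideal (p ` J)"
    unfolding Q.br_ideal_def
  proof (intro conjI ballI)
    show "subspace (p ` J)" using J(1) by (intro subspace_lin_image p) (simp add: ideal_def)
    show "p ` J \<subseteq> V" using p_V by blast
    fix x y assume "x \<in> V" "y \<in> p ` J"
    then obtain c j where cj: "c \<in> C" "x = p c" "j \<in> J" "y = p j" using C by blast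
    have "br x y = br c j" unfolding cj by (simp add: p_bracket_left p_bracket_right)
    moreover have "bracket c j \<in> J" using J(1) cj unfolding ideal_def by blast
    ultimately show "br x y \<in> p ` J" by simp
  qed
  moreover have "der br (p ` J) n = {0}" using der_image[of J n] n lin_0[OF p] by simp
  ultimately have J0: "p ` J = {0}" by (rule Q.solvable_ideal_zero[OF nd])
  show ?thesis
  proof
    fix x assume "x \<in> J"
    then have "p x = 0" using J0 by blast
    then show "x \<in> I" using p_I[of x] by simp
  qed
qed

text \<open>Stated for every subalgebra that covers the quotient, so that one formula gives the
  radical of the whole algebra, the semisimplicity of a Levi complement and its maximality.\<close>

lemma solvable_radical_eq:
  assumes nd: "Q.nondegenerate" and sI: "solvable I" and C: "subalgebra C" "p ` C = V"
  shows "solvable_radical C = C \<inter> I"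
  unfolding solvable_radical_def
proof (rule Greatest_equality)
  have s: "subspace (C \<inter> I)" using C(1) I unfolding subalgebra_def ideal_def by (simp add: subspace_inter)
  then show "ideal C (C \<inter> I) \<and> solvable (C \<inter> I)"
    using C(1) I solvable_subset[OF sI _ s] unfolding subalgebra_def ideal_def by auto
  show "J \<subseteq> C \<inter> I" if "ideal C J \<and> solvable J" for J
    using solvable_ideal_subset[OF nd C(2)] that unfolding ideal_def by blast
qed

text \<open>\<open>T + I\<close> is the preimage of an ideal of the quotient. Its derived series
  enters \<open>I\<close> after \<open>k\<close> steps and ends there, as \<open>I\<close> is
  solvable.\<close>

lemma ideal_sum:
  assumes T: "Q.br_ideal T" "der br T k = {0}" and sI: "solvable I"
  defines "J \<equiv> {t + i | t i. t \<in> T \<and> i \<in> I}"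
  shows "ideal UNIV J" "solvable J"
proof -
  have TV: "subspace T" "T \<subseteq> V" using T(1) unfolding Q.br_ideal_def by auto
  have sI': "subspace I" using I by (simp add: ideal_def)
  have "bracket x y \<in> J" if y: "y \<in> J" for x y
  proof -
    obtain t i where ti: "t \<in> T" "i \<in> I" "y = t + i" using y unfolding J_def by blast
    have "br x t = br (p x) t" by (simp add: p_bracket_left)
    then have 1: "br x t \<in> T" using T(1) ti p_V unfolding Q.br_ideal_def by simp
    have 2: "(bracket x t - br x t) + bracket x i \<in> I"
      using I ti p_I[of "bracket x t"] unfolding ideal_def by (simp add: subspace_add)
    have "bracket x y = br x t + ((bracket x t - br x t) + bracket x i)"
      unfolding ti by (simp add: bracket_simps)
    then show ?thesis unfolding J_def using 1 2 by blast
  qed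
  moreover have sJ: "subspace J" unfolding J_def by (rule subspace_sums[OF TV(1) sI'])
  ultimately show "ideal UNIV J" unfolding ideal_def by simp
  have "derived_series J n \<subseteq> {t + i | t i. t \<in> der br T n \<and> i \<in> I}" for n
  proof (induction n)
    case 0 show ?case by (simp add: J_def)
  next
    case (Suc n)
    let ?D = "der br T n"
    have "{bracket x y |x y. x \<in> derived_series J n \<and> y \<in> derived_series J n}
        \<subseteq> {t + i | t i. t \<in> der br T (Suc n) \<and> i \<in> I}"
    proof
      fix z assume "z \<in> {bracket x y |x y. x \<in> derived_series J n \<and> y \<in> derived_series J n}"
      then obtain x y where "x \<in> derived_series J n" "y \<in> derived_series J n" and z: "z = bracket x y" by blast
      then obtain t i t' i' where t: "t \<in> ?D" "i \<in> I" "x = t + i" "t' \<in> ?D" "i' \<in> I" "y = t' + i'"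
        using Suc by blast
      have "br t t' \<in> der br T (Suc n)" using t(1,4) by (auto intro: span_base)
      moreover have "bracket t i' + bracket i y + (bracket t t' - br t t') \<in> I"
        using I ideal_right[OF I t(2)] t p_I[of "bracket t t'"] unfolding ideal_def
        by (intro subspace_add) auto
      moreover have "z = br t t' + (bracket t i' + bracket i y + (bracket t t' - br t t'))"
        unfolding z t by (simp add: bracket_simps)
      ultimately show "z \<in> {t + i | t i. t \<in> der br T (Suc n) \<and> i \<in> I}" by blast
    qed
    moreover have "subspace {t + i | t i. t \<in> der br T (Suc n) \<and> i \<in> I}"
      by (rule subspace_sums) (simp_all add: sI')
    ultimately show ?case unfolding derived_series.simps by (rule span_minimal)
  qed
  from this[of k] have "derived_series J k \<subseteq> I" unfolding T(2) by auto
  then have "solvable (derived_series J k)"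
    by (rule solvable_subset[OF sI _ subspace_derived_series[OF sJ]])
  then obtain l where "derived_series J (k + l) = {0}" unfolding solvable_def derived_series_add[symmetric] by blast
  then show "solvable J" unfolding solvable_def by blast
qed

end

section \<open>Gradings\<close>

locale graded_fd_lie_algebra =
  graded_lie_algebra scale bracket G component + fd_lie_algebra scale bracket Basis
  for scale :: "'f::{alg_closed_field, field_char_0} \<Rightarrow> 'v::ab_group_add \<Rightarrow> 'v" (infixr "*s" 75)
    and bracket :: "'v \<Rightarrow> 'v \<Rightarrow> 'v"
    and G :: "('g, 'm) monoid_scheme" (structure)
    and component :: "'g \<Rightarrow> 'v set"
    and Basis
begin

definition components_of :: "'v \<Rightarrow> ('g \<Rightarrow> 'v) \<Rightarrow> bool" where
  "components_of x f \<longleftrightarrow> (\<forall>i\<in>carrier G. f i \<in> component i) \<and> (\<forall>i. i \<notin> carrier G \<longrightarrow> f i = 0) \<and>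
     finite {i. f i \<noteq> 0} \<and> x = (\<Sum>i | f i \<noteq> 0. f i)"

text \<open>\<open>hc\<close> stands for homogeneous component; it is zero at degrees outside the
  group.\<close>

definition hc :: "'g \<Rightarrow> 'v \<Rightarrow> 'v" where
  "hc g x = (THE f. components_of x f) g"

lemma ex1_components: "\<exists>!f. components_of x f"
  using decomposition unfolding direct_sum_family_def components_of_def by blast

lemma subspace_component: "g \<in> carrier G \<Longrightarrow> subspace (component g)"
  using decomposition unfolding direct_sum_family_def by blast

lemma components_of_hc: "components_of x (\<lambda>g. hc g x)"
  unfolding hc_def by (rule theI'[OF ex1_components])

lemma components_of_unique: "components_of x f \<Longrightarrow> f = (\<lambda>g. hc g x)"
  using ex1_components[of x] components_of_hc by blast

lemma hc_component: "g \<in> carrier G \<Longrightarrow> hc g x \<in> component g"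
  and hc_outside: "g \<notin> carrier G \<Longrightarrow> hc g x = 0"
  and finite_support: "finite {g. hc g x \<noteq> 0}"
  and sum_support: "x = (\<Sum>g | hc g x \<noteq> 0. hc g x)"
  using components_of_hc[of x] unfolding components_of_def by auto

lemma hc_sum:
  assumes A: "finite A" "A \<subseteq> carrier G" "\<And>a. a \<in> A \<Longrightarrow> u a \<in> component a"
  shows "hc g (\<Sum>a\<in>A. u a) = (if g \<in> A then u g else 0)"
proof -
  let ?f = "\<lambda>g. if g \<in> A then u g else 0"
  have fin: "finite {i. ?f i \<noteq> 0}" by (rule finite_subset[OF _ A(1)]) auto
  have "(\<Sum>a\<in>A. u a) = (\<Sum>a\<in>A. ?f a)" by simp
  also have "\<dots> = (\<Sum>i | ?f i \<noteq> 0. ?f i)"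
    by (rule sum.mono_neutral_right[OF A(1)]) auto
  finally have "components_of (\<Sum>a\<in>A. u a) ?f"
    unfolding components_of_def using fin A subspace_0[OF subspace_component] by auto
  from components_of_unique[OF this] show ?thesis by (metis (no_types, lifting))
qed

lemma sum_superset:
  assumes "finite A" "{g. hc g x \<noteq> 0} \<subseteq> A"
  shows "(\<Sum>g\<in>A. hc g x) = x"
proof -
  have "(\<Sum>g\<in>A. hc g x) = (\<Sum>g | hc g x \<noteq> 0. hc g x)"
    using assms by (intro sum.mono_neutral_right) auto
  then show ?thesis using sum_support by simp
qed

lemma support_carrier: "{g. hc g x \<noteq> 0} \<subseteq> carrier G"
  using hc_outside by blast

lemma lin_hc: "lin (hc g)"
proof (rule linI)
  fix x y
  let ?A = "{g. hc g x \<noteq> 0} \<union> {g. hc g y \<noteq> 0}"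
  have fin: "finite ?A" using finite_support by simp
  have A: "?A \<subseteq> carrier G" using support_carrier by blast
  have "x + y = (\<Sum>a\<in>?A. hc a x + hc a y)"
    unfolding sum.distrib using sum_superset[OF fin, of x] sum_superset[OF fin, of y] by auto
  also have "hc g \<dots> = (if g \<in> ?A then hc g x + hc g y else 0)"
    using A by (intro hc_sum[OF fin]) (auto intro: subspace_add[OF subspace_component] hc_component)
  finally show "hc g (x + y) = hc g x + hc g y" by auto
next
  fix c x
  let ?A = "{g. hc g x \<noteq> 0}"
  have "c *s x = (\<Sum>a\<in>?A. c *s hc a x)"
    unfolding scale_sum_right[symmetric] using sum_support[of x] by simp
  also have "hc g \<dots> = (if g \<in> ?A then c *s hc g x else 0)"
    using support_carrier by (intro hc_sum finite_support) (auto intro: subspace_scale[OF subspace_component] hc_component)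
  finally show "hc g (c *s x) = c *s hc g x" by auto
qed

lemma hc_of_component:
  assumes "h \<in> carrier G" "x \<in> component h"
  shows "hc g x = (if g = h then x else 0)"
  using hc_sum[of "{h}" "\<lambda>_. x" g] assms by auto

lemma hc_hc: "hc g (hc h x) = (if g = h then hc h x else 0)"
proof (cases "h \<in> carrier G")
  case True
  then show ?thesis by (rule hc_of_component[OF _ hc_component[OF True]])
next
  case False
  then show ?thesis using hc_outside[OF False] lin_0[OF lin_hc] by simp
qed

text \<open>In finite dimension only finitely many degrees occur, even for infinite
  \<open>G\<close>; all sums over degrees can run over this one set.\<close>

definition supp :: "'g set" where
  "supp = (\<Union>b\<in>Basis. {g. hc g b \<noteq> 0})"

lemma finite_supp: "finite supp"
  unfolding supp_def using finite_Basis finite_support by blast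

lemma supp_carrier: "supp \<subseteq> carrier G"
  unfolding supp_def using support_carrier by blast

lemma hc_outside_supp: "g \<notin> supp \<Longrightarrow> hc g x = 0"
proof -
  assume "g \<notin> supp"
  then have "hc g b \<in> {0}" if "b \<in> Basis" for b using that unfolding supp_def by blast
  then have "hc g x \<in> {0}"
    using lin_span_closed[OF lin_hc[of g] _ subspace_single_0, of Basis x] span_Basis by blast
  then show ?thesis by simp
qed

lemma sum_supp: "(\<Sum>g\<in>supp. hc g x) = x"
  using hc_outside_supp by (intro sum_superset[OF finite_supp]) auto

text \<open>Left multiplication by \<open>g\<close> is injective, so among the brackets of
  \<open>x\<close> with the components of \<open>y\<close> only the one for \<open>h\<close> lands
  in degree \<open>g \<otimes> h\<close>.\<close>

lemma hc_bracket_left: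
  assumes g: "g \<in> carrier G" and h: "h \<in> carrier G" and x: "x \<in> component g"
  shows "hc (g \<otimes> h) (bracket x y) = bracket x (hc h y)"
proof -
  have inj: "g \<otimes> h = g \<otimes> k \<longleftrightarrow> h = k" if "k \<in> carrier G" for k using g h that by simp
  have "bracket x y = (\<Sum>k\<in>supp. bracket x (hc k y))"
    unfolding lin_sum[OF linear_right, symmetric] sum_supp ..
  then have "hc (g \<otimes> h) (bracket x y) = (\<Sum>k\<in>supp. hc (g \<otimes> h) (bracket x (hc k y)))"
    by (simp add: lin_sum[OF lin_hc])
  also have "\<dots> = (\<Sum>k\<in>supp. if h = k then bracket x (hc k y) else 0)"
  proof (rule sum.cong[OF refl])
    fix k assume "k \<in> supp"
    then have k: "k \<in> carrier G" using supp_carrier by blast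
    show "hc (g \<otimes> h) (bracket x (hc k y)) = (if h = k then bracket x (hc k y) else 0)"
      using hc_of_component[OF m_closed[OF g k] bracket_component[OF g k x hc_component[OF k]], of "g \<otimes> h"]
      by (simp add: inj[OF k])
  qed
  also have "\<dots> = bracket x (hc h y)"
    using finite_supp hc_outside_supp[of h y] by (simp add: bracket_simps)
  finally show ?thesis .
qed

lemma hc_bracket_right:
  assumes g: "g \<in> carrier G" and h: "h \<in> carrier G" and y: "y \<in> component h"
  shows "hc (g \<otimes> h) (bracket x y) = bracket (hc g x) y"
proof -
  have inj: "g \<otimes> h = k \<otimes> h \<longleftrightarrow> g = k" if "k \<in> carrier G" for k using g h that by simp
  have "bracket x y = (\<Sum>k\<in>supp. bracket (hc k x) y)"
    unfolding lin_sum[OF linear_left, symmetric] sum_supp ..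
  then have "hc (g \<otimes> h) (bracket x y) = (\<Sum>k\<in>supp. hc (g \<otimes> h) (bracket (hc k x) y))"
    by (simp add: lin_sum[OF lin_hc])
  also have "\<dots> = (\<Sum>k\<in>supp. if g = k then bracket (hc k x) y else 0)"
  proof (rule sum.cong[OF refl])
    fix k assume "k \<in> supp"
    then have k: "k \<in> carrier G" using supp_carrier by blast
    show "hc (g \<otimes> h) (bracket (hc k x) y) = (if g = k then bracket (hc k x) y else 0)"
      using hc_of_component[OF m_closed[OF k h] bracket_component[OF k h hc_component[OF k] y], of "g \<otimes> h"]
      by (simp add: inj[OF k])
  qed
  also have "\<dots> = bracket (hc g x) y"
    using finite_supp hc_outside_supp[of g x] by (simp add: bracket_simps)
  finally show ?thesis .
qed

text \<open>The working form of gradedness, as stability under the projections;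
  \<open>gr_imp_graded_subspace\<close> leads back to the official notion.\<close>

definition gr :: "'v set \<Rightarrow> bool" where
  "gr W \<longleftrightarrow> subspace W \<and> (\<forall>x\<in>W. \<forall>g. hc g x \<in> W)"

lemma gr_subspace: "gr W \<Longrightarrow> subspace W"
  and gr_hc: "gr W \<Longrightarrow> x \<in> W \<Longrightarrow> hc g x \<in> W"
  unfolding gr_def by blast+

lemma gr_imp_graded_subspace:
  assumes W: "gr W"
  shows "graded_subspace W"
  unfolding graded_subspace_def direct_sum_family_def
proof (intro conjI ballI)
  show "subspace W" by (rule gr_subspace[OF W])
  show "subspace (component g \<inter> W)" if "g \<in> carrier G" for g
    by (rule subspace_inter[OF subspace_component[OF that] gr_subspace[OF W]])
  fix x assume x: "x \<in> W"
  have c: "(\<forall>i\<in>carrier G. f i \<in> component i \<inter> W) \<and> (\<forall>i. i \<notin> carrier G \<longrightarrow> f i = 0) \<and>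
      finite {i. f i \<noteq> 0} \<and> x = (\<Sum>i | f i \<noteq> 0. f i)
    \<longleftrightarrow> components_of x f \<and> (\<forall>i\<in>carrier G. f i \<in> W)" for f
    unfolding components_of_def by blast
  show "\<exists>!f. (\<forall>i\<in>carrier G. f i \<in> component i \<inter> W) \<and> (\<forall>i. i \<notin> carrier G \<longrightarrow> f i = 0) \<and>
      finite {i. f i \<noteq> 0} \<and> x = (\<Sum>i | f i \<noteq> 0. f i)"
    unfolding c
  proof (rule ex1I[of _ "\<lambda>g. hc g x"])
    show "components_of x (\<lambda>g. hc g x) \<and> (\<forall>i\<in>carrier G. hc i x \<in> W)"
      using components_of_hc gr_hc[OF W x] by blast
    show "f = (\<lambda>g. hc g x)" if "components_of x f \<and> (\<forall>i\<in>carrier G. f i \<in> W)" for f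
      using components_of_unique that by blast
  qed
qed blast

lemma gr_span:
  assumes "\<And>x g. x \<in> X \<Longrightarrow> hc g x \<in> span X"
  shows "gr (span X)"
  unfolding gr_def using lin_span_closed[OF lin_hc assms subspace_span] by blast

lemma gr_sums:
  assumes "gr A" "gr B"
  shows "gr {a + b | a b. a \<in> A \<and> b \<in> B}"
  unfolding gr_def
proof (intro conjI ballI allI)
  show "subspace {a + b | a b. a \<in> A \<and> b \<in> B}" using assms by (intro subspace_sums gr_subspace)
  fix x g assume "x \<in> {a + b | a b. a \<in> A \<and> b \<in> B}"
  then obtain a b where "a \<in> A" "b \<in> B" "x = a + b" by blast
  then show "hc g x \<in> {a + b | a b. a \<in> A \<and> b \<in> B}"
    using gr_hc[OF assms(1), of a g] gr_hc[OF assms(2), of b g] lin_add[OF lin_hc] by blast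
qed

lemma gr_derived_series:
  assumes "gr A"
  shows "gr (derived_series A k)"
proof (induction k)
  case (Suc k)
  let ?X = "{bracket x y |x y. x \<in> derived_series A k \<and> y \<in> derived_series A k}"
  show ?case
    unfolding derived_series.simps
  proof (rule gr_span)
    fix z g assume "z \<in> ?X"
    then obtain x y where xy: "x \<in> derived_series A k" "y \<in> derived_series A k" "z = bracket x y" by blast
    have "z = (\<Sum>i\<in>supp. \<Sum>j\<in>supp. bracket (hc i x) (hc j y))"
      unfolding xy(3) lin_sum[OF linear_right, symmetric] lin_sum[OF linear_left, symmetric] sum_supp ..
    then have "hc g z = (\<Sum>i\<in>supp. \<Sum>j\<in>supp. hc g (bracket (hc i x) (hc j y)))"
      by (simp add: lin_sum[OF lin_hc])
    also have "\<dots> \<in> span ?X"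
    proof (intro span_sum)
      fix i j assume "i \<in> supp" "j \<in> supp"
      then have ij: "i \<in> carrier G" "j \<in> carrier G" using supp_carrier by auto
      have "bracket (hc i x) (hc j y) \<in> ?X" using gr_hc[OF Suc] xy by blast
      then have "bracket (hc i x) (hc j y) \<in> span ?X" by (rule span_base)
      then show "hc g (bracket (hc i x) (hc j y)) \<in> span ?X"
        using hc_of_component[OF m_closed[OF ij] bracket_component[OF ij hc_component[OF ij(1)] hc_component[OF ij(2)]], of g]
        by (simp add: span_zero)
    qed
    finally show "hc g z \<in> span ?X" .
  qed
qed (simp add: assms)

text \<open>Take \<open>V\<close> graded of maximal dimension with trivial intersection with
  \<open>W\<close>. A vector outside \<open>V + W\<close> would have a homogeneous component outside
  it, and a homogeneous vector can be adjoined to \<open>V\<close> without losing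
  gradedness.\<close>

lemma exists_graded_complement:
  assumes W: "gr W"
  shows "\<exists>V. gr V \<and> V \<inter> W = {0} \<and> (\<forall>x. \<exists>v\<in>V. x - v \<in> W)"
proof -
  have sW: "subspace W" by (rule gr_subspace[OF W])
  define P where "P V \<longleftrightarrow> gr V \<and> V \<inter> W = {0}" for V
  have "P {0}" unfolding P_def gr_def using subspace_0[OF sW] lin_0[OF lin_hc] by auto
  from exists_max_dim[of P, OF this] obtain V where max: "P V \<and> (\<forall>V'. P V' \<longrightarrow> dim V' \<le> dim V)" ..
  then have V: "gr V" "V \<inter> W = {0}" unfolding P_def by auto
  have sV: "subspace V" by (rule gr_subspace[OF V(1)])
  define Y where "Y = {v + w | v w. v \<in> V \<and> w \<in> W}"
  have sY: "subspace Y" unfolding Y_def by (rule subspace_sums[OF sV sW])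
  have VY: "V \<subseteq> Y" unfolding Y_def using subspace_0[OF sW] by force
  have WY: "W \<subseteq> Y" unfolding Y_def using subspace_0[OF sV] by force
  have hcY: "hc g x \<in> Y" for g x
  proof (rule ccontr)
    assume y: "hc g x \<notin> Y"
    define y where "y = hc g x"
    have yY: "y \<notin> Y" using y unfolding y_def .
    have hy: "hc h y \<in> {0, y}" for h unfolding y_def hc_hc by auto
    have eV: "span V = V" using sV by simp
    let ?V = "span (insert y V)"
    have "gr ?V"
    proof (rule gr_span)
      fix z h assume "z \<in> insert y V"
      then have "hc h z \<in> insert 0 (insert y V)" using hy[of h] gr_hc[OF V(1), of z h] by blast
      then have "hc h z = 0 \<or> hc h z \<in> insert y V" by simp
      then show "hc h z \<in> ?V" by (elim disjE) (simp_all only: span_zero span_base)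
    qed
    moreover have "z = 0" if z: "z \<in> ?V" "z \<in> W" for z
    proof -
      obtain c where c: "z - c *s y \<in> V" using z(1) unfolding span_breakdown_eq eV by blast
      have "z - (z - c *s y) \<in> Y"
        by (rule subspace_diff[OF sY subsetD[OF WY z(2)] subsetD[OF VY c]])
      then have cy: "c *s y \<in> Y" by simp
      have "c = 0"
      proof (rule ccontr)
        assume "c \<noteq> 0"
        then have "y \<in> Y" using subspace_scale[OF sY cy, of "inverse c"] by simp
        with yY show False ..
      qed
      then have "z \<in> V \<inter> W" using c z(2) by simp
      then show ?thesis using V(2) by blast
    qed
    then have "?V \<inter> W = {0}" using span_zero subspace_0[OF sW] by blast
    ultimately have "P ?V" unfolding P_def by blast
    then have "dim ?V \<le> dim V" using max by blast
    moreover have "dim V < dim (insert y V)"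
    proof (rule dim_psubset)
      have "y \<notin> V" using yY VY by blast
      moreover have "y \<in> span (insert y V)" by (simp add: span_base)
      moreover have "span V \<subseteq> span (insert y V)" by (rule span_mono) blast
      ultimately show "span V \<subset> span (insert y V)" unfolding eV by (metis psubsetI)
    qed
    ultimately show False by simp
  qed
  have "x \<in> Y" for x
    using subspace_sum[OF sY, of supp "\<lambda>g. hc g x"] hcY sum_supp[of x] by simp
  then have "\<exists>v\<in>V. x - v \<in> W" for x
  proof -
    obtain v w where "v \<in> V" "w \<in> W" "x = v + w" using \<open>x \<in> Y\<close> unfolding Y_def by blast
    then show ?thesis by (intro bexI[of _ v]) simp_all
  qed
  with V show ?thesis by blast
qed

end

section \<open>Graded quotients\<close>

context ac_space
begin

lemma exists_projection_onto:
  assumes V: "subspace V" and W: "subspace W" and VW: "V \<inter> W = {0}" "\<And>x. \<exists>v\<in>V. x - v \<in> W"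
  shows "\<exists>p. lin p \<and> (\<forall>x. p x \<in> V \<and> x - p x \<in> W) \<and> (\<forall>x\<in>W. p x = 0) \<and> (\<forall>x\<in>V. p x = x)"
proof -
  have "\<forall>x. \<exists>v. v \<in> V \<and> x - v \<in> W" using VW(2) by blast
  then obtain p where p: "\<And>x. p x \<in> V" "\<And>x. x - p x \<in> W" by metis
  have uniq: "p x = v" if v: "v \<in> V" "x - v \<in> W" for x v
  proof -
    have "p x - v \<in> V" by (rule subspace_diff[OF V p(1) v(1)])
    moreover have "(x - v) - (x - p x) \<in> W" by (rule subspace_diff[OF W v(2) p(2)])
    ultimately have "p x - v \<in> V \<inter> W" by simp
    then show ?thesis using VW(1) by simp
  qed
  have "lin p"
  proof (rule linI)
    fix x y show "p (x + y) = p x + p y"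
    proof (rule uniq)
      have "(x - p x) + (y - p y) \<in> W" by (rule subspace_add[OF W p(2) p(2)])
      then show "x + y - (p x + p y) \<in> W" by (simp add: algebra_simps)
    qed (rule subspace_add[OF V p(1) p(1)])
  next
    fix c x show "p (c *s x) = c *s p x"
    proof (rule uniq)
      have "c *s (x - p x) \<in> W" by (rule subspace_scale[OF W p(2)])
      then show "c *s x - c *s p x \<in> W" by (simp add: algebra_simps)
    qed (rule subspace_scale[OF V p(1)])
  qed
  moreover have "p x = 0" if "x \<in> W" for x using that subspace_0[OF V] by (intro uniq) simp_all
  moreover have "p x = x" if "x \<in> V" for x using that subspace_0[OF W] by (intro uniq) simp_all
  ultimately show ?thesis using p by blast
qed

end

context lie_module
begin

lemma trace_form_sum_left:
  assumes "finite A" "\<And>i. i \<in> A \<Longrightarrow> u i \<in> S" "y \<in> S"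
  shows "trace_form (\<Sum>i\<in>A. u i) y = (\<Sum>i\<in>A. trace_form (u i) y)"
  using assms
proof (induction A rule: finite_induct)
  case empty
  then show ?case using trace_form_scale_left[of y y 0] by simp
next
  case (insert i A)
  then show ?case using S by (simp add: trace_form_add_left subspace_sum)
qed

end

locale graded_quotient =
  graded_fd_lie_algebra scale bracket G component Basis + quotient_algebra scale bracket Basis I V p
  for scale :: "'f::{alg_closed_field, field_char_0} \<Rightarrow> 'v::ab_group_add \<Rightarrow> 'v" (infixr "*s" 75)
    and bracket :: "'v \<Rightarrow> 'v \<Rightarrow> 'v"
    and G :: "('g, 'm) monoid_scheme" (structure)
    and component :: "'g \<Rightarrow> 'v set"
    and Basis and I V :: "'v set" and p :: "'v \<Rightarrow> 'v" +
  assumes gr_I: "gr I" and gr_V: "gr V"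
begin

text \<open>In \<open>x = p x + (x - p x)\<close> both summands stay in their spaces when a
  component is taken, as \<open>V\<close> and \<open>I\<close> are graded.\<close>

lemma hc_p: "hc g (p x) = p (hc g x)"
proof -
  have "hc g x = hc g (p x) + hc g (x - p x)" by (simp add: lin_diff[OF lin_hc])
  then have "p (hc g x) = p (hc g (p x)) + p (hc g (x - p x))" by (metis lin_add[OF p])
  then show ?thesis using p_id[OF gr_hc[OF gr_V p_V]] p_zero[OF gr_hc[OF gr_I p_I]] by simp
qed

lemma p_component:
  assumes g: "g \<in> carrier G" and x: "x \<in> component g"
  shows "p x \<in> component g"
proof -
  have "hc g (p x) = p x" unfolding hc_p using hc_of_component[OF g x] by simp
  then show ?thesis using hc_component[OF g, of "p x"] by simp
qed

lemma br_component:
  "g \<in> carrier G \<Longrightarrow> h \<in> carrier G \<Longrightarrow> x \<in> component g \<Longrightarrow> y \<in> component h \<Longrightarrow> br x y \<in> component (g \<otimes> h)"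
  by (intro p_component bracket_component m_closed)

lemma V_Int_I: "V \<inter> I = {0}"
proof -
  have "x = 0" if "x \<in> V" "x \<in> I" for x using p_id[OF that(1)] p_zero[OF that(2)] by simp
  then show ?thesis using subspace_0[OF V] I unfolding ideal_def by (auto intro: subspace_0)
qed

text \<open>In a basis of homogeneous vectors \<open>ad x ad y\<close> moves degree \<open>k\<close>
  to \<open>g h k\<close>, which differs from \<open>k\<close>, so all diagonal entries are
  zero.\<close>

lemma killing_degree:
  assumes g: "g \<in> carrier G" "x \<in> component g" and h: "h \<in> carrier G" "y \<in> component h"
    and gh: "g \<otimes> h \<noteq> \<one>"
  shows "Q.killing x y = 0"
proof -
  let ?X = "V \<inter> (\<Union>g\<in>carrier G. component g)"
  have "v \<in> span ?X" if v: "v \<in> V" for v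
  proof -
    have "hc g v \<in> ?X" if "g \<in> supp" for g using that supp_carrier hc_component gr_hc[OF gr_V v] by blast
    then have "(\<Sum>g\<in>supp. hc g v) \<in> span ?X" by (intro span_sum span_base)
    then show ?thesis unfolding sum_supp .
  qed
  moreover have "span ?X \<subseteq> V" by (rule span_minimal[OF _ V]) blast
  ultimately have "span ?X = V" by blast
  from sub_basis[OF this] obtain B where B: "B \<subseteq> ?X" "independent B" "span B = V" by blast
  have fin: "finite B" using B(2) by (rule finiteI_independent)
  have "representation B (br x (br y b)) b = 0" if b: "b \<in> B" for b
  proof -
    obtain k where k: "k \<in> carrier G" "b \<in> component k" using b B(1) by blast
    let ?v = "br x (br y b)" and ?r = "representation B (br x (br y b))"
    have v: "?v \<in> component (g \<otimes> (h \<otimes> k))" using g h k by (intro br_component m_closed)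
    have "g \<otimes> (h \<otimes> k) \<noteq> k"
    proof
      assume "g \<otimes> (h \<otimes> k) = k"
      then have "(g \<otimes> h) \<otimes> k = \<one> \<otimes> k" using g h k by (simp add: m_assoc)
      then show False using gh g h k by (simp del: l_one)
    qed
    then have "hc k ?v = 0" using hc_of_component[OF _ v, of k] g h k by simp
    moreover have "hc k ?v = hc k (\<Sum>c\<in>B. ?r c *s c)"
      using basis_expand[OF B(2), of ?v] p_V B(3) by simp
    then have "hc k ?v = (\<Sum>c\<in>B. ?r c *s hc k c)"
      by (simp only: lin_sum[OF lin_hc] lin_scale[OF lin_hc])
    \<comment> \<open>The condition \<open>hc k c = c\<close> selects the basis vectors of degree
      \<open>k\<close>. Since \<open>b\<close> is among them, independence annuls its
      coefficient.\<close>
    moreover have "\<dots> = (\<Sum>c\<in>B. (if hc k c = c then ?r c else 0) *s c)"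
    proof (rule sum.cong[OF refl])
      fix c assume "c \<in> B"
      then obtain l where "l \<in> carrier G" "c \<in> component l" using B(1) by blast
      then have "hc k c = c \<or> hc k c = 0" using hc_of_component[of l c k] by auto
      then show "?r c *s hc k c = (if hc k c = c then ?r c else 0) *s c" by auto
    qed
    ultimately have "(\<Sum>c\<in>B. (if hc k c = c then ?r c else 0) *s c) = 0" by simp
    from independentD[OF B(2) fin order.refl this b] show ?thesis
      using hc_of_component[OF k, of k] by simp
  qed
  then show ?thesis
    unfolding Q.adj.trace_form_def
    using trace_basis[OF B(2,3) lin_compose[OF Q.br_lin_right Q.br_lin_right], of x y] p_V by simp
qed

lemma gr_killing_radical: "gr {x \<in> V. \<forall>y\<in>V. Q.killing x y = 0}" (is "gr ?T")
  unfolding gr_def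
proof (intro conjI ballI allI)
  show "subspace ?T" using Q.br_ideal_killing_radical unfolding Q.br_ideal_def by blast
  fix x g assume x: "x \<in> ?T"
  have hV: "hc k z \<in> V" if "z \<in> V" for k z using gr_hc[OF gr_V that] .
  have xV: "x \<in> V" using x by blast
  have killing_0: "Q.killing 0 z = 0" if "z \<in> V" for z
    using Q.adj.trace_form_scale_left[OF that that, of 0] by simp
  have "Q.killing (hc g x) y = 0" if y: "y \<in> V" for y
  proof -
    \<comment> \<open>If \<open>g \<otimes> h = \<one>\<close>, right cancellation leaves only the
      component of \<open>x\<close> of degree \<open>g\<close> in the pairing with
      \<open>hc h y\<close>, so the value equals \<open>killing x (hc h y)\<close>, which is zero.
      Otherwise \<open>killing_degree\<close> or \<open>hc_outside\<close> applies.\<close>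
    have zero: "Q.killing (hc h y) (hc g x) = 0" if h: "h \<in> supp" for h
    proof (cases "g \<in> carrier G \<and> g \<otimes> h = \<one>")
      case True
      have hG: "h \<in> carrier G" using h supp_carrier by blast
      have other: "Q.killing (hc k x) (hc h y) = 0" if k: "k \<in> supp" "k \<noteq> g" for k
      proof -
        have kG: "k \<in> carrier G" using k supp_carrier by blast
        have "k \<otimes> h \<noteq> \<one>"
        proof
          assume "k \<otimes> h = \<one>"
          then have "k \<otimes> h = g \<otimes> h" using True by simp
          then show False using k(2) right_cancel[OF hG kG] True by blast
        qed
        then show ?thesis using killing_degree[OF kG hc_component[OF kG] hG hc_component[OF hG]] by blast
      qed
      have "Q.killing (\<Sum>k\<in>supp. hc k x) (hc h y) = (\<Sum>k\<in>supp. Q.killing (hc k x) (hc h y))"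
        by (intro Q.adj.trace_form_sum_left finite_supp hV xV y)
      then have "Q.killing x (hc h y) = (\<Sum>k\<in>supp. Q.killing (hc k x) (hc h y))" unfolding sum_supp .
      also have "\<dots> = (\<Sum>k\<in>supp. if k = g then Q.killing (hc k x) (hc h y) else 0)"
        using other by (intro sum.cong) auto
      also have "\<dots> = Q.killing (hc g x) (hc h y)"
      proof (cases "g \<in> supp")
        case False
        then have "hc g x = 0" by (rule hc_outside_supp)
        then show ?thesis
          using False finite_supp killing_0[OF hV[OF y]] by simp
      qed (simp add: finite_supp)
      finally have "Q.killing (hc g x) (hc h y) = 0" using x hV[OF y] by simp
      then show ?thesis using Q.adj.trace_form_commute[OF hV[OF xV] hV[OF y]] by simp
    next
      case False
      have hG: "h \<in> carrier G" using h supp_carrier by blast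
      show ?thesis
      proof (cases "g \<in> carrier G")
        case True
        with False have "Q.killing (hc g x) (hc h y) = 0"
          by (intro killing_degree[OF True hc_component hG hc_component]) (use hG in auto)
        then show ?thesis using Q.adj.trace_form_commute[OF hV[OF xV] hV[OF y]] by simp
      next
        case False
        then have "hc g x = 0" by (rule hc_outside)
        then show ?thesis
          using killing_0[OF hV[OF y]] Q.adj.trace_form_commute[OF hV[OF y] subspace_0[OF V]] by simp
      qed
    qed
    have "Q.killing (\<Sum>h\<in>supp. hc h y) (hc g x) = (\<Sum>h\<in>supp. Q.killing (hc h y) (hc g x))"
      by (intro Q.adj.trace_form_sum_left finite_supp hV xV y)
    then have "Q.killing y (hc g x) = (\<Sum>h\<in>supp. Q.killing (hc h y) (hc g x))" unfolding sum_supp .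
    then have "Q.killing y (hc g x) = 0" using zero by simp
    then show ?thesis using Q.adj.trace_form_commute[OF hV[OF xV] y] by simp
  qed
  then show "hc g x \<in> ?T" using hV[OF xV] by blast
qed

text \<open>Added to \<open>I\<close>, the radical of the Killing form yields a graded solvable
  ideal of the whole algebra, which is \<open>I\<close> by maximality. So the radical lies in both
  \<open>V\<close> and \<open>I\<close>.\<close>

lemma nondegenerate_if_maximal:
  assumes sI: "solvable I"
    and max: "\<And>J. gr J \<Longrightarrow> ideal UNIV J \<Longrightarrow> solvable J \<Longrightarrow> I \<subseteq> J \<Longrightarrow> J = I"
  shows "Q.nondegenerate"
proof -
  let ?T = "{x \<in> V. \<forall>y\<in>V. Q.killing x y = 0}"
  let ?J = "{t + i | t i. t \<in> ?T \<and> i \<in> I}"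
  obtain k where k: "der br ?T k = {0}" using Q.killing_radical_solvable by blast
  have T0: "0 \<in> ?T" by (rule subspace_0[OF gr_subspace[OF gr_killing_radical]])
  have I0: "0 \<in> I" by (rule subspace_0[OF gr_subspace[OF gr_I]])
  have "gr ?J" by (rule gr_sums[OF gr_killing_radical gr_I])
  moreover have "I \<subseteq> ?J"
  proof
    fix i assume "i \<in> I"
    then have "\<exists>t i'. i = t + i' \<and> t \<in> ?T \<and> i' \<in> I" using T0 by (intro exI[of _ 0] exI[of _ i]) simp
    then show "i \<in> ?J" by blast
  qed
  ultimately have J: "?J = I"
    by (rule max[OF _ ideal_sum[OF Q.br_ideal_killing_radical k sI]])
  have "x = 0" if x: "x \<in> ?T" for x
  proof -
    have "\<exists>t i'. x = t + i' \<and> t \<in> ?T \<and> i' \<in> I" using x I0 by (intro exI[of _ x] exI[of _ 0]) simp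
    then have "x \<in> I" using J by blast
    then show ?thesis using x V_Int_I by blast
  qed
  then show ?thesis unfolding Q.nondegenerate_def by blast
qed

text \<open>A solution of the cocycle equation stays a solution after replacing it by its
  degree-preserving part. No commutativity of \<open>G\<close> is needed: left and right cancellation single out
  the component of the second factor of a bracket and of the first factor, respectively.\<close>

lemma levi_step:
  assumes nd: "Q.nondegenerate"
    and J: "ideal UNIV J" "gr J" "J \<subseteq> I" and K: "ideal UNIV K" "gr K" "K \<subseteq> J"
    and JJ: "\<And>x y. x \<in> J \<Longrightarrow> y \<in> J \<Longrightarrow> bracket x y \<in> K"
    and VV: "\<And>x y. x \<in> V \<Longrightarrow> y \<in> V \<Longrightarrow> bracket x y - p (bracket x y) \<in> J"
  shows "\<exists>V'. gr V' \<and> V' \<inter> I = {0} \<and> (\<forall>x. \<exists>v\<in>V'. x - v \<in> I) \<and>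
    (\<forall>x\<in>V'. \<forall>y\<in>V'. \<exists>z\<in>V'. bracket x y - z \<in> K)"
proof -
  have sJ: "subspace J" and sK: "subspace K" and sI: "subspace I" using J K I by (auto simp: ideal_def)
  \<comment> \<open>\<open>q\<close> models the passage modulo \<open>K\<close>; the image of
    \<open>J\<close> stands for the abelian quotient of \<open>J\<close> by
    \<open>K\<close>.\<close>
  obtain q where q: "lin q" "\<And>x. x - q x \<in> K" "\<And>x. x \<in> K \<Longrightarrow> q x = 0"
    using exists_projection[OF sK] by blast
  have bK: "bracket x k \<in> K" if "k \<in> K" for x k using K(1) that unfolding ideal_def by blast
  have bJ: "bracket x j \<in> J" if "j \<in> J" for x j using J(1) that unfolding ideal_def by blast
  have qJ: "q x \<in> J" if "x \<in> J" for x
    using subspace_diff[OF sJ that, of "x - q x"] q(2)[of x] K(3) by auto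
  have q_br: "q (bracket x (q y)) = q (bracket x y)" for x y
    using q(3)[OF bK[OF q(2)[of y], of x]] by (simp add: bracket_simps lin_diff[OF q(1)])
  have qq: "q (q x) = q x" for x using q(3)[OF q(2)[of x]] by (simp add: lin_diff[OF q(1)])
  let ?M = "q ` J" and ?act = "\<lambda>v m. q (bracket v m)"
  have MJ: "?M \<subseteq> J" using qJ by blast
  \<comment> \<open>\<open>[x, y]\<close> and \<open>br x y\<close> differ by an element of
    \<open>J\<close>, which brackets \<open>J\<close> into \<open>K\<close>. Modulo \<open>K\<close>
    the action therefore respects the bracket of the quotient.\<close>
  have act_br: "?act (br x y) m = ?act x (?act y m) - ?act y (?act x m)" if xy: "x \<in> V" "y \<in> V" and m: "m \<in> ?M" for x y m
  proof -
    have "m \<in> J" using m MJ by blast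
    then have "q (bracket (bracket x y - br x y) m) = 0" using JJ[OF VV[OF xy]] q(3) by blast
    then have "q (bracket (br x y) m) = q (bracket (bracket x y) m)"
      by (simp add: bracket_simps lin_diff[OF q(1)])
    also have "\<dots> = q (bracket x (bracket y m)) - q (bracket y (bracket x m))"
      unfolding bracket_bracket lin_diff[OF q(1)] ..
    finally show ?thesis by (simp add: q_br)
  qed
  have mod: "lie_module scale Basis V br ?M ?act"
  proof unfold_locales
    show "subspace ?M" by (rule subspace_lin_image[OF q(1) sJ])
    show "?act x m \<in> ?M" if "x \<in> V" "m \<in> ?M" for x m
      using that MJ bJ[of m x] by blast
    show "?act (br x y) m = ?act x (?act y m) - ?act y (?act x m)" if "x \<in> V" "y \<in> V" "m \<in> ?M" for x y m
      using that by (rule act_br)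
  qed (simp_all add: bracket_simps lin_add[OF q(1)] lin_scale[OF q(1)])
  \<comment> \<open>\<open>f\<close> measures, modulo \<open>K\<close>, how far \<open>V\<close> is
    from being closed under the bracket.\<close>
  define f where "f x y = q (bracket x y - br x y)" for x y
  have "Q.cocycle ?M ?act f"
    unfolding Q.cocycle_def
  proof (intro conjI ballI allI)
    show "lin (\<lambda>x. f x y)" for y
      unfolding f_def by (rule lin_compose[OF q(1) lin_minus[OF linear_left lin_compose[OF p linear_left]]])
    show "lin (f x)" for x
      unfolding f_def[abs_def] by (rule lin_compose[OF q(1) lin_minus[OF linear_right lin_compose[OF p linear_right]]])
    show "f x y \<in> ?M" if "x \<in> V" "y \<in> V" for x y unfolding f_def using VV[OF that] by blast
    show "f x x = 0" for x unfolding f_def by (simp add: alternating lin_0[OF p] lin_0[OF q(1)])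
    fix x y z assume xyz: "x \<in> V" "y \<in> V" "z \<in> V"
    have 1: "?act u (f v w) + f u (br v w) = q (bracket u (bracket v w)) - q (br u (br v w))" for u v w
      unfolding f_def q_br by (simp add: bracket_simps lin_diff[OF q(1)])
    have 2: "q (bracket x (bracket y z)) + q (bracket y (bracket z x)) + q (bracket z (bracket x y)) = 0"
      using arg_cong[OF jacobi[of x y z], of q] by (simp add: lin_add[OF q(1)] lin_0[OF q(1)])
    have 3: "q (br x (br y z)) + q (br y (br z x)) + q (br z (br x y)) = 0"
      using arg_cong[OF Q.br_jacobi[OF xyz], of q] by (simp add: lin_add[OF q(1)] lin_0[OF q(1)])
    have "?act x (f y z) + ?act y (f z x) + ?act z (f x y) + f x (br y z) + f y (br z x) + f z (br x y)
      = (?act x (f y z) + f x (br y z)) + (?act y (f z x) + f y (br z x)) + (?act z (f x y) + f z (br x y))"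
      by (simp add: algebra_simps)
    also have "\<dots> = (q (bracket x (bracket y z)) + q (bracket y (bracket z x)) + q (bracket z (bracket x y)))
      - (q (br x (br y z)) + q (br y (br z x)) + q (br z (br x y)))"
      unfolding 1 by (simp add: algebra_simps)
    finally show "?act x (f y z) + ?act y (f z x) + ?act z (f x y) + f x (br y z) + f y (br z x) + f z (br x y) = 0"
      unfolding 2 3 by simp
  qed
  from Q.whitehead[OF nd mod this] obtain \<phi> where \<phi>: "lin \<phi>" "\<And>x. x \<in> V \<Longrightarrow> \<phi> x \<in> ?M"
    "\<And>x y. x \<in> V \<Longrightarrow> y \<in> V \<Longrightarrow> f x y = ?act x (\<phi> y) - ?act y (\<phi> x) - \<phi> (br x y)"
    unfolding Q.coboundary_def by blast
  have \<phi>J: "\<phi> x \<in> J" if "x \<in> V" for x using \<phi>(2)[OF that] MJ by blast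
  have q\<phi>: "q (\<phi> x) = \<phi> x" if "x \<in> V" for x using \<phi>(2)[OF that] qq by auto
  \<comment> \<open>The closure error of the vectors \<open>v - \<theta> v\<close>, with the
    quadratic term \<open>[\<theta> v, \<theta> w]\<close> left out. For maps into \<open>J\<close>
    that term lies in \<open>K\<close>, and in what remains every term contains
    \<open>\<theta>\<close> at most once.\<close>
  define D where "D \<theta> v w = bracket v w - bracket v (\<theta> w) - bracket (\<theta> v) w - br v w + \<theta> (br v w)" for \<theta> v w
  have D\<phi>: "D \<phi> v w \<in> K" if vw: "v \<in> V" "w \<in> V" for v w
  proof -
    have "q (D \<phi> v w) = f v w - ?act v (\<phi> w) + ?act w (\<phi> v) + \<phi> (br v w)"
      using bracket_skew[of "\<phi> v" w] q\<phi>[OF Q.br_closed[OF vw]] unfolding D_def f_def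
      by (simp add: lin_add[OF q(1)] lin_diff[OF q(1)] lin_neg[OF q(1)])
    then have "q (D \<phi> v w) = 0" using \<phi>(3)[OF vw] by simp
    then show ?thesis using q(2)[of "D \<phi> v w"] by simp
  qed
  define \<sigma> where "\<sigma> v = (\<Sum>g\<in>supp. hc g (\<phi> (hc g v)))" for v
  have l\<sigma>: "lin \<sigma>"
    unfolding \<sigma>_def[abs_def] by (intro lin_sum_fun lin_compose[OF lin_hc lin_compose[OF \<phi>(1) lin_hc]])
  have hV: "hc g v \<in> V" if "v \<in> V" for g v using gr_hc[OF gr_V that] .
  have \<sigma>J: "\<sigma> v \<in> J" if "v \<in> V" for v
    unfolding \<sigma>_def by (intro subspace_sum[OF sJ] gr_hc[OF J(2)] \<phi>J hV that)
  have \<sigma>_hc: "\<sigma> (hc g v) = hc g (\<phi> (hc g v))" for g v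
  proof -
    have "\<sigma> (hc g v) = (\<Sum>k\<in>supp. if k = g then hc k (\<phi> (hc k v)) else 0)"
      unfolding \<sigma>_def by (intro sum.cong) (auto simp: hc_hc lin_0[OF \<phi>(1)] lin_0[OF lin_hc])
    then show ?thesis using finite_supp hc_outside_supp[of g] by simp
  qed
  have \<sigma>_component: "\<sigma> v = hc g (\<phi> v)" if "g \<in> carrier G" "v \<in> component g" for g v
    using \<sigma>_hc[of g v] hc_of_component[OF that, of g] by simp
  have hc_\<sigma>: "hc g (\<sigma> v) = \<sigma> (hc g v)" for g v
  proof -
    have "hc g (\<sigma> v) = (\<Sum>k\<in>supp. if g = k then hc k (\<phi> (hc k v)) else 0)"
      unfolding \<sigma>_def lin_sum[OF lin_hc] hc_hc ..
    then show ?thesis using finite_supp hc_outside_supp[of g] \<sigma>_hc[of g v] by simp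
  qed
  \<comment> \<open>On homogeneous vectors, the component of \<open>D \<phi> v w\<close> of degree
    \<open>g \<otimes> h\<close> is the same expression with \<open>\<sigma>\<close> for
    \<open>\<phi>\<close>, and it stays in \<open>K\<close> because \<open>K\<close> is
    graded.\<close>
  have hom: "D \<sigma> v w \<in> K"
    if v: "v \<in> V" "v \<in> component g" "g \<in> carrier G" and w: "w \<in> V" "w \<in> component h" "h \<in> carrier G" for v w g h
  proof -
    let ?gh = "g \<otimes> h"
    have gh: "?gh \<in> carrier G" using v w by simp
    have "hc ?gh (bracket v w) = bracket v w" "hc ?gh (br v w) = br v w"
      using hc_of_component[OF gh, of "bracket v w" ?gh] hc_of_component[OF gh, of "br v w" ?gh]
        bracket_component[OF v(3) w(3) v(2) w(2)] br_component[OF v(3) w(3) v(2) w(2)] by auto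
    moreover have "hc ?gh (bracket v (\<phi> w)) = bracket v (\<sigma> w)"
      unfolding hc_bracket_left[OF v(3) w(3) v(2)] \<sigma>_component[OF w(3,2)] ..
    moreover have "hc ?gh (bracket (\<phi> v) w) = bracket (\<sigma> v) w"
      unfolding hc_bracket_right[OF v(3) w(3) w(2)] \<sigma>_component[OF v(3,2)] ..
    moreover have "hc ?gh (\<phi> (br v w)) = \<sigma> (br v w)"
      using \<sigma>_component[OF gh br_component[OF v(3) w(3) v(2) w(2)]] by simp
    ultimately have "hc ?gh (D \<phi> v w) = D \<sigma> v w"
      unfolding D_def by (simp add: lin_add[OF lin_hc] lin_diff[OF lin_hc])
    then show ?thesis using gr_hc[OF K(2) D\<phi>[OF v(1) w(1)], of ?gh] by simp
  qed
  have lD1: "lin (\<lambda>v. D \<sigma> v w)" for w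
    unfolding D_def
    by (intro lin_plus lin_minus linear_left lin_compose[OF linear_left l\<sigma>] lin_compose[OF p linear_left]
        lin_compose[OF l\<sigma> lin_compose[OF p linear_left]])
  have lD2: "lin (\<lambda>w. D \<sigma> v w)" for v
    unfolding D_def
    by (intro lin_plus lin_minus linear_right lin_compose[OF linear_right l\<sigma>] lin_compose[OF p linear_right]
        lin_compose[OF l\<sigma> lin_compose[OF p linear_right]])
  have D\<sigma>: "D \<sigma> v w \<in> K" if vw: "v \<in> V" "w \<in> V" for v w
  proof -
    have "D \<sigma> v w = (\<Sum>i\<in>supp. \<Sum>j\<in>supp. D \<sigma> (hc i v) (hc j w))"
      unfolding lin_sum[OF lD2, symmetric] lin_sum[OF lD1, symmetric] sum_supp ..
    also have "\<dots> \<in> K"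
    proof (intro subspace_sum[OF sK])
      fix i j assume "i \<in> supp" "j \<in> supp"
      then have ij: "i \<in> carrier G" "j \<in> carrier G" using supp_carrier by auto
      show "D \<sigma> (hc i v) (hc j w) \<in> K"
        by (rule hom[OF hV[OF vw(1)] hc_component[OF ij(1)] ij(1) hV[OF vw(2)] hc_component[OF ij(2)] ij(2)])
    qed
    finally show ?thesis .
  qed
  define V' where "V' = (\<lambda>v. v - \<sigma> v) ` V"
  have "gr V'"
    unfolding gr_def
  proof (intro conjI ballI allI)
    show "subspace V'" unfolding V'_def by (rule subspace_lin_image[OF lin_minus[OF lin_id l\<sigma>] V])
    fix x g assume "x \<in> V'"
    then obtain v where v: "v \<in> V" "x = v - \<sigma> v" unfolding V'_def by blast
    have "hc g x = hc g v - \<sigma> (hc g v)" unfolding v(2) by (simp add: lin_diff[OF lin_hc] hc_\<sigma>)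
    then show "hc g x \<in> V'" unfolding V'_def using hV[OF v(1)] by blast
  qed
  moreover have "V' \<inter> I = {0}"
  proof -
    have "x = 0" if x: "x \<in> V'" "x \<in> I" for x
    proof -
      obtain v where v: "v \<in> V" "x = v - \<sigma> v" using x(1) unfolding V'_def by blast
      have "x + \<sigma> v \<in> I" using x(2) \<sigma>J[OF v(1)] J(3) by (intro subspace_add[OF sI]) auto
      then have "v = 0" using v V_Int_I by auto
      then show ?thesis using v(2) by (simp add: lin_0[OF l\<sigma>])
    qed
    then show ?thesis using subspace_0[OF gr_subspace[OF \<open>gr V'\<close>]] subspace_0[OF sI] by blast
  qed
  moreover have "\<exists>v\<in>V'. x - v \<in> I" for x
  proof (rule bexI[of _ "p x - \<sigma> (p x)"])
    have "(x - p x) + \<sigma> (p x) \<in> I" using p_I \<sigma>J[OF p_V] J(3) by (intro subspace_add[OF sI]) auto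
    then show "x - (p x - \<sigma> (p x)) \<in> I" by (simp add: algebra_simps)
    show "p x - \<sigma> (p x) \<in> V'" unfolding V'_def using p_V by blast
  qed
  moreover have "\<exists>z\<in>V'. bracket x y - z \<in> K" if xy: "x \<in> V'" "y \<in> V'" for x y
  proof -
    obtain v w where vw: "v \<in> V" "w \<in> V" "x = v - \<sigma> v" "y = w - \<sigma> w" using xy unfolding V'_def by blast
    have "bracket x y - (br v w - \<sigma> (br v w)) = D \<sigma> v w + bracket (\<sigma> v) (\<sigma> w)"
      unfolding vw D_def by (simp add: bracket_simps algebra_simps)
    also have "\<dots> \<in> K" by (rule subspace_add[OF sK D\<sigma>[OF vw(1,2)] JJ[OF \<sigma>J[OF vw(1)] \<sigma>J[OF vw(2)]]])
    finally show ?thesis unfolding V'_def using p_V by blast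
  qed
  ultimately show ?thesis by blast
qed

end

section \<open>The graded Levi decomposition\<close>

context graded_fd_lie_algebra
begin

lemma graded_quotientI:
  assumes "gr I" "ideal UNIV I" "gr V" "V \<inter> I = {0}" "\<And>x. \<exists>v\<in>V. x - v \<in> I"
  obtains p where "graded_quotient scale bracket G component Basis I V p"
proof -
  obtain p where p: "lin p" "\<And>x. p x \<in> V" "\<And>x. x - p x \<in> I" "\<And>x. x \<in> I \<Longrightarrow> p x = 0" "\<And>x. x \<in> V \<Longrightarrow> p x = x"
    using exists_projection_onto[OF gr_subspace[OF assms(3)] gr_subspace[OF assms(1)] assms(4,5)] by blast
  have "graded_quotient scale bracket G component Basis I V p"
    by (intro graded_quotient.intro quotient_algebra.intro quotient_algebra_axioms.intro graded_quotient_axioms.intro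
        graded_fd_lie_algebra_axioms fd_lie_algebra_axioms assms(1-3) gr_subspace[OF assms(3)] p)
  then show ?thesis by (rule that)
qed

lemma exists_maximal_graded_solvable_ideal:
  obtains I where "gr I" "ideal UNIV I" "solvable I"
    "\<And>J. gr J \<Longrightarrow> ideal UNIV J \<Longrightarrow> solvable J \<Longrightarrow> I \<subseteq> J \<Longrightarrow> J = I"
proof -
  define P where "P J \<longleftrightarrow> gr J \<and> ideal UNIV J \<and> solvable J" for J
  have "derived_series {0} 0 = {0}" by simp
  then have "solvable {0}" unfolding solvable_def by blast
  then have "P {0}" unfolding P_def gr_def ideal_def by (simp add: lin_0[OF lin_hc] bracket_simps)
  from exists_max_dim[of P, OF this] obtain I where max: "P I \<and> (\<forall>J. P J \<longrightarrow> dim J \<le> dim I)" ..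
  have "J = I" if "gr J" "ideal UNIV J" "solvable J" "I \<subseteq> J" for J
  proof -
    have "dim J \<le> dim I" using max that unfolding P_def by blast
    then show ?thesis
      using subspace_dim_equal[of I J] that max unfolding P_def by (auto dest: gr_subspace)
  qed
  with max that show ?thesis unfolding P_def by blast
qed

theorem graded_levi:
  "\<exists>B. maximal_semisimple_subalgebra B \<and> direct_sum UNIV B (solvable_radical UNIV)
    \<and> graded_subspace B \<and> graded_subspace (solvable_radical UNIV)"
proof -
  obtain I where RI: "gr I" "ideal UNIV I" "solvable I"
    and max: "\<And>J. gr J \<Longrightarrow> ideal UNIV J \<Longrightarrow> solvable J \<Longrightarrow> I \<subseteq> J \<Longrightarrow> J = I"
    using exists_maximal_graded_solvable_ideal by blast
  \<comment> \<open>At \<open>k = 0\<close> the last condition holds because a complement meets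
    every class modulo \<open>I\<close>; where the derived series reaches zero it says that
    \<open>V\<close> is a subalgebra.\<close>
  have levi: "\<exists>V. gr V \<and> V \<inter> I = {0} \<and> (\<forall>x. \<exists>v\<in>V. x - v \<in> I) \<and>
      (\<forall>x\<in>V. \<forall>y\<in>V. \<exists>z\<in>V. bracket x y - z \<in> derived_series I k)" for k
  proof (induction k)
    case 0
    obtain V where "gr V" "V \<inter> I = {0}" "\<forall>x. \<exists>v\<in>V. x - v \<in> I"
      using exists_graded_complement[OF RI(1)] by blast
    then show ?case unfolding derived_series.simps by blast
  next
    case (Suc k)
    then obtain V where V: "gr V" "V \<inter> I = {0}" "\<And>x. \<exists>v\<in>V. x - v \<in> I"
      and VV: "\<And>x y. x \<in> V \<Longrightarrow> y \<in> V \<Longrightarrow> \<exists>z\<in>V. bracket x y - z \<in> derived_series I k"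
      by blast
    obtain p where gq: "graded_quotient scale bracket G component Basis I V p"
      using graded_quotientI[OF RI(1,2) V] .
    interpret graded_quotient scale bracket G component Basis I V p by (rule gq)
    let ?J = "derived_series I k" and ?K = "derived_series I (Suc k)"
    have nd: "Q.nondegenerate" by (rule nondegenerate_if_maximal[OF RI(3) max])
    note ds = ideal_derived_series[OF RI(2)]
    have JI: "?J \<subseteq> I"
    proof (induction k)
      case (Suc k)
      then show ?case using ds[of k] by blast
    qed simp
    have KJ: "?K \<subseteq> ?J" using ds[of k] by blast
    have JJ: "bracket x y \<in> ?K" if "x \<in> ?J" "y \<in> ?J" for x y
    proof -
      have "bracket x y \<in> {bracket x y |x y. x \<in> ?J \<and> y \<in> ?J}" using that by blast
      then show ?thesis unfolding derived_series.simps by (rule span_base)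
    qed
    \<comment> \<open>The witness of the induction hypothesis is forced: it lies in \<open>V\<close>
      and is congruent to \<open>[x, y]\<close> modulo \<open>I\<close>, so it is
      \<open>p [x, y]\<close>.\<close>
    have VVp: "bracket x y - p (bracket x y) \<in> ?J" if xy: "x \<in> V" "y \<in> V" for x y
    proof -
      obtain z where z: "z \<in> V" "bracket x y - z \<in> ?J" using VV[OF xy] by blast
      have "p (bracket x y - z) = 0" using z(2) JI p_zero by blast
      then have "p (bracket x y) = z" using p_id[OF z(1)] by (simp add: lin_diff[OF p])
      then show ?thesis using z(2) by simp
    qed
    show ?case
      by (rule levi_step[OF nd _ gr_derived_series[OF RI(1)] JI _ gr_derived_series[OF RI(1)] KJ JJ VVp])
        (use ds in blast)+
  qed
  obtain n where n: "derived_series I n = {0}" using RI(3) unfolding solvable_def by blast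
  obtain B where B: "gr B" "B \<inter> I = {0}" "\<And>x. \<exists>v\<in>B. x - v \<in> I"
    and BB: "\<And>x y. x \<in> B \<Longrightarrow> y \<in> B \<Longrightarrow> \<exists>z\<in>B. bracket x y - z \<in> {0}"
    using levi[of n] unfolding n by blast
  obtain p where gq: "graded_quotient scale bracket G component Basis I B p"
    using graded_quotientI[OF RI(1,2) B] .
  interpret graded_quotient scale bracket G component Basis I B p by (rule gq)
  have nd: "Q.nondegenerate" by (rule nondegenerate_if_maximal[OF RI(3) max])
  have sB: "subspace B" by (rule V)
  have subB: "subalgebra B"
    unfolding subalgebra_def
  proof (intro conjI ballI sB)
    fix x y assume "x \<in> B" "y \<in> B"
    then obtain z where "z \<in> B" "bracket x y - z \<in> {0}" using BB by blast
    then show "bracket x y \<in> B" by simp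
  qed
  have pC: "p ` C = B" if "B \<subseteq> C" for C
  proof
    show "p ` C \<subseteq> B" using p_V by blast
    show "B \<subseteq> p ` C"
    proof
      fix b assume b: "b \<in> B"
      then have "b = p b" using p_id by simp
      then show "b \<in> p ` C" using b that by blast
    qed
  qed
  note rad = solvable_radical_eq[OF nd RI(3) _ pC]
  have radU: "solvable_radical UNIV = I"
    using rad[of UNIV] by (simp add: subalgebra_def)
  have ssB: "semisimple_subalgebra B"
    unfolding semisimple_subalgebra_def using rad[OF subB] subB B(2) by simp
  \<comment> \<open>The radical of such a \<open>C\<close> is its intersection with
    \<open>I\<close>. As this is zero, every \<open>c - p c\<close> vanishes.\<close>
  have "C = B" if C: "semisimple_subalgebra C" "B \<subseteq> C" for C
  proof -
    have subC: "subalgebra C" using C(1) unfolding semisimple_subalgebra_def by blast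
    have CI: "C \<inter> I = {0}"
      using rad[OF subC C(2)] C(1) unfolding semisimple_subalgebra_def by simp
    have "c \<in> B" if c: "c \<in> C" for c
    proof -
      have "c - p c \<in> C"
        using subC c C(2) p_V unfolding subalgebra_def by (blast intro: subspace_diff)
      then have "c - p c = 0" using CI p_I by blast
      then show ?thesis using p_V[of c] by simp
    qed
    with C(2) show ?thesis by blast
  qed
  then have "maximal_semisimple_subalgebra B"
    unfolding maximal_semisimple_subalgebra_def using ssB by blast
  moreover have "direct_sum UNIV B I"
    unfolding direct_sum_def
  proof (intro conjI sB gr_subspace[OF RI(1)] B(2))
    have "\<exists>u v. x = u + v \<and> u \<in> B \<and> v \<in> I" for x
      using p_V p_I by (intro exI[of _ "p x"] exI[of _ "x - p x"]) simp
    then show "UNIV = {u + v |u v. u \<in> B \<and> v \<in> I}" by blast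
  qed
  ultimately show ?thesis
    unfolding radU using gr_imp_graded_subspace[OF RI(1)] gr_imp_graded_subspace[OF B(1)] by blast
qed

end

theorem mainTheorem15:
  fixes scale :: "'f::{alg_closed_field, field_char_0} \<Rightarrow> 'v::ab_group_add \<Rightarrow> 'v"
    and bracket :: "'v \<Rightarrow> 'v \<Rightarrow> 'v"
    and G :: "('g, 'm) monoid_scheme"
    and component :: "'g \<Rightarrow> 'v set"
    and R :: "'v set"
  assumes "graded_lie_algebra scale bracket G component"
    and "\<exists>E. finite E \<and> module.span scale E = UNIV"
    and "R = lie_algebra.solvable_radical scale bracket UNIV"
  shows "\<exists>B. lie_algebra.maximal_semisimple_subalgebra scale bracket B
    \<and> vector_space.direct_sum scale UNIV B R
    \<and> graded_lie_algebra.graded_subspace scale G component B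
    \<and> graded_lie_algebra.graded_subspace scale G component R"
proof -
  interpret L: graded_lie_algebra scale bracket G component by (rule assms(1))
  obtain E where E: "finite E" "L.span E = UNIV" using assms(2) by blast
  \<comment> \<open>The locales carry a fixed finite basis, so one is extracted from the spanning
    set.\<close>
  obtain Basis where Basis: "Basis \<subseteq> E" "L.independent Basis" "E \<subseteq> L.span Basis"
    using L.maximal_independent_subset by blast
  have "L.span E \<subseteq> L.span Basis" using Basis(3) by (rule L.span_minimal) simp
  then have span: "L.span Basis = UNIV" using E(2) by blast
  have "finite_dimensional_vector_space_axioms scale Basis"
    using finite_subset[OF Basis(1) E(1)] Basis(2) span
    by (rule finite_dimensional_vector_space_axioms.intro)
  then have "graded_fd_lie_algebra scale bracket G component Basis"
    by (intro graded_fd_lie_algebra.intro fd_lie_algebra.intro ac_space.intro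
        finite_dimensional_vector_space.intro assms(1) L.lie_algebra_axioms L.vector_space_axioms)
  then show ?thesis unfolding assms(3) by (rule graded_fd_lie_algebra.graded_levi)
qed

end
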